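(* Let $r\ge 1$ and $\rho\ge r$ be integers, and consider the cross-neighborhood growth dynamics of range $\rho$ with the bootstrap percolation zero-set $\mathcal Z=\{(u,v)\in\mathbb Z_+^2: u+v\le r-1\}$. Let $$\widehat m=\left\lceil\frac{\sqrt{9+8r}-5}{2}\right\rceil .$$ Then the critical power $\gamma_c$ of $\mathcal Z$ exists, is pure, and equals $$\gamma_c=\frac{(\widehat m+1)(2r-\widehat m)}{2(\widehat m+2)}.$$
   Context: Let $\mathbb Z_+=\{0,1,2,\dots\}$. A zero-set is a set $\mathcal Z\subseteq\mathbb Z_+^2$ such that $(u,v)\in\mathcal Z$ implies $([0,u]\times[0,v])\cap\mathbb Z_+^2\subseteq\mathcal Z$. Given an integer range $\rho$, for $x\in\mathbb Z^2$ let $\mathcal N^h_x=x+([-\rho,\rho]\cap\mathbb Z)\times\{0\}$ and $\mathcal N^v_x=x+\{0\}\times([-\rho,\rho]\cap\mathbb Z)$. Given $\xi_0\subseteq\mathbb Z^2$, define recursively, for $t\in\mathbb Z_+$, $$\xi_{t+1}=\xi_t\cup\{x\in\mathbb Z^2:(|\mathcal N_x^h\cap\xi_t|,|\mathcal N_x^v\cap\xi_t|)\notin\mathcal Z\}.$$ The points of $\xi_t$ are the occupied points at time $t$. Each $x\in\mathbb Z^2$ is included in $\xi_0$ independently with probability $p\in[0,1]$, and $T=\inf\{t\ge0:(0,0)\in\xi_t\}$. For a deterministic $a=a(p)$ and nonnegative random variables $X=X(p)$: $X\lesssim a$ means $\lim_{\lambda\to\infty}\limsup_{p\to0}\mathbb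 P(X\ge\lambda a)=0$; $X\gtrsim a$ means $\lim_{\lambda\to0}\limsup_{p\to0}\mathbb P(X\le\lambda a)=0$; $X\asymp a$ means both. A number $\gamma>0$ is a lower power (resp. upper power) for $\mathcal Z$ if for every $\epsilon>0$, $T\gtrsim p^{-(\gamma-\epsilon)}$ (resp. $T\lesssim p^{-(\gamma+\epsilon)}$). The critical power $\gamma_c=\gamma_c(\mathcal Z)$ is a number that is both a lower and an upper power; it is pure if $T\asymp p^{-\gamma_c}$. *)

theory Defs
  imports "HOL-Probability.Probability"
begin

section \<open>Cross-neighborhood growth dynamics\<close>

definition zero_set :: "(nat \<times> nat) set \<Rightarrow> bool" where
  "zero_set Z \<longleftrightarrow> (\<forall>u v. (u, v) \<in> Z \<longrightarrow> {0..u} \<times> {0..v} \<subseteq> Z)"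

definition nbhd_h :: "nat \<Rightarrow> int \<times> int \<Rightarrow> (int \<times> int) set" where
  "nbhd_h \<rho> x = (\<lambda>k. x + (k, 0)) ` {- int \<rho>..int \<rho>}"

definition nbhd_v :: "nat \<Rightarrow> int \<times> int \<Rightarrow> (int \<times> int) set" where
  "nbhd_v \<rho> x = (\<lambda>k. x + (0, k)) ` {- int \<rho>..int \<rho>}"

primrec occupied ::
  "nat \<Rightarrow> (nat \<times> nat) set \<Rightarrow> (int \<times> int) set \<Rightarrow> nat \<Rightarrow> (int \<times> int) set" where
  "occupied \<rho> Z \<xi>0 0 = \<xi>0"
| "occupied \<rho> Z \<xi>0 (Suc t) = occupied \<rho> Z \<xi>0 t \<union>
     {x. (card (nbhd_h \<rho> x \<inter> occupied \<rho> Z \<xi>0 t),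
          card (nbhd_v \<rho> x \<inter> occupied \<rho> Z \<xi>0 t)) \<notin> Z}"

definition initial_measure :: "real \<Rightarrow> (int \<times> int \<Rightarrow> bool) measure" where
  "initial_measure p = (\<Pi>\<^sub>M x\<in>UNIV. measure_pmf (bernoulli_pmf p))"

text \<open>The hitting time is \<open>\<infinity>\<close> (the infimum of the empty set) if the origin never becomes occupied.\<close>

definition hitting_time :: "nat \<Rightarrow> (nat \<times> nat) set \<Rightarrow> (int \<times> int \<Rightarrow> bool) \<Rightarrow> ennreal" where
  "hitting_time \<rho> Z \<omega> =
     ennreal_of_enat (INF t\<in>{t. (0, 0) \<in> occupied \<rho> Z {x. \<omega> x} t}. enat t)"

section \<open>Orders of magnitude in probability\<close>

text \<open>
  The random variable \<open>X p\<close> lives on the probability space \<open>M p\<close>, and \<open>p\<close> tends to \<open>0\<close> from above.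
\<close>

definition prob_lesssim ::
  "(real \<Rightarrow> 'w measure) \<Rightarrow> (real \<Rightarrow> 'w \<Rightarrow> ennreal) \<Rightarrow> (real \<Rightarrow> real) \<Rightarrow> bool" where
  "prob_lesssim M X a \<longleftrightarrow>
     ((\<lambda>c. Limsup (at_right 0) (\<lambda>p. ereal \<P>(\<omega> in M p. X p \<omega> \<ge> ennreal (c * a p)))) \<longlongrightarrow> 0) at_top"

definition prob_gtrsim ::
  "(real \<Rightarrow> 'w measure) \<Rightarrow> (real \<Rightarrow> 'w \<Rightarrow> ennreal) \<Rightarrow> (real \<Rightarrow> real) \<Rightarrow> bool" where
  "prob_gtrsim M X a \<longleftrightarrow>
     ((\<lambda>c. Limsup (at_right 0) (\<lambda>p. ereal \<P>(\<omega> in M p. X p \<omega> \<le> ennreal (c * a p)))) \<longlongrightarrow> 0)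
       (at_right 0)"

definition prob_asymp ::
  "(real \<Rightarrow> 'w measure) \<Rightarrow> (real \<Rightarrow> 'w \<Rightarrow> ennreal) \<Rightarrow> (real \<Rightarrow> real) \<Rightarrow> bool" where
  "prob_asymp M X a \<longleftrightarrow> prob_lesssim M X a \<and> prob_gtrsim M X a"

section \<open>Critical powers\<close>

definition lower_power :: "nat \<Rightarrow> (nat \<times> nat) set \<Rightarrow> real \<Rightarrow> bool" where
  "lower_power \<rho> Z \<gamma> \<longleftrightarrow> \<gamma> > 0 \<and>
     (\<forall>\<epsilon>>0. prob_gtrsim initial_measure (\<lambda>p. hitting_time \<rho> Z) (\<lambda>p. p powr - (\<gamma> - \<epsilon>)))"

definition upper_power :: "nat \<Rightarrow> (nat \<times> nat) set \<Rightarrow> real \<Rightarrow> bool" where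
  "upper_power \<rho> Z \<gamma> \<longleftrightarrow> \<gamma> > 0 \<and>
     (\<forall>\<epsilon>>0. prob_lesssim initial_measure (\<lambda>p. hitting_time \<rho> Z) (\<lambda>p. p powr - (\<gamma> + \<epsilon>)))"

definition is_critical_power :: "nat \<Rightarrow> (nat \<times> nat) set \<Rightarrow> real \<Rightarrow> bool" where
  "is_critical_power \<rho> Z \<gamma> \<longleftrightarrow> lower_power \<rho> Z \<gamma> \<and> upper_power \<rho> Z \<gamma>"

text \<open>Only meaningful if there is exactly one \<open>\<gamma>\<close> with \<open>is_critical_power \<rho> Z \<gamma>\<close>.\<close>

definition critical_power :: "nat \<Rightarrow> (nat \<times> nat) set \<Rightarrow> real" where
  "critical_power \<rho> Z = (THE \<gamma>. is_critical_power \<rho> Z \<gamma>)"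

definition pure_critical_power :: "nat \<Rightarrow> (nat \<times> nat) set \<Rightarrow> bool" where
  "pure_critical_power \<rho> Z \<longleftrightarrow>
     prob_asymp initial_measure (\<lambda>p. hitting_time \<rho> Z) (\<lambda>p. p powr - critical_power \<rho> Z)"

section \<open>Bootstrap percolation\<close>

definition bootstrap_zero_set :: "nat \<Rightarrow> (nat \<times> nat) set" where
  "bootstrap_zero_set r = {(u, v). u + v \<le> r - 1}"

lemma zero_set_bootstrap: "zero_set (bootstrap_zero_set r)"
  by (auto simp: zero_set_def bootstrap_zero_set_def)

section \<open>Measurability of the hitting time\<close>

text \<open>
  Since \<open>measure\<close> is \<open>0\<close> on non-measurable sets, this is what makes the probabilities above genuine.
\<close>

lemma finite_nbhd: "finite (nbhd_h \<rho> x)" "finite (nbhd_v \<rho> x)"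
  by (auto simp: nbhd_h_def nbhd_v_def)

lemma measurable_occupied:
  "Measurable.pred (initial_measure p) (\<lambda>\<omega>. x \<in> occupied \<rho> Z {y. \<omega> y} t)"
proof (induction t arbitrary: x)
  case 0
  have "(\<lambda>\<omega>. \<omega> x) \<in> initial_measure p \<rightarrow>\<^sub>M measure_pmf (bernoulli_pmf p)"
    unfolding initial_measure_def by (rule measurable_component_singleton) simp
  then show ?case
    by (simp cong: measurable_cong_sets)
next
  case (Suc t)
  let ?\<xi> = "\<lambda>\<omega>. occupied \<rho> Z {y. \<omega> y} t"
  let ?A = "{P \<in> Pow (nbhd_h \<rho> x) \<times> Pow (nbhd_v \<rho> x). (card (fst P), card (snd P)) \<notin> Z}"
  have fin: "finite ?A"
    by (simp add: finite_nbhd)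
  let ?Q = "\<lambda>\<omega> P. (\<forall>y\<in>nbhd_h \<rho> x. y \<in> ?\<xi> \<omega> \<longleftrightarrow> y \<in> fst P) \<and>
               (\<forall>y\<in>nbhd_v \<rho> x. y \<in> ?\<xi> \<omega> \<longleftrightarrow> y \<in> snd P)"
  have eq: "x \<in> occupied \<rho> Z {y. \<omega> y} (Suc t) \<longleftrightarrow> x \<in> ?\<xi> \<omega> \<or> (\<exists>P\<in>?A. ?Q \<omega> P)" for \<omega>
  proof -
    let ?P0 = "(nbhd_h \<rho> x \<inter> ?\<xi> \<omega>, nbhd_v \<rho> x \<inter> ?\<xi> \<omega>)"
    have "P = ?P0" if "P \<in> ?A" "?Q \<omega> P" for P
      using that by (intro prod_eqI) (auto simp: mem_Times_iff)
    moreover have "?Q \<omega> ?P0"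
      by auto
    ultimately have "(\<exists>P\<in>?A. ?Q \<omega> P) \<longleftrightarrow> ?P0 \<in> ?A"
      by blast
    then show ?thesis
      by simp
  qed
  show ?case
    unfolding eq
    by (intro pred_intros_logic pred_intros_finite fin finite_nbhd Suc.IH) simp_all
qed

lemma measurable_hitting_time:
  "hitting_time \<rho> Z \<in> borel_measurable (initial_measure p)"
proof -
  have [measurable]: "Measurable.pred (initial_measure p) (\<lambda>\<omega>. x \<in> occupied \<rho> Z {y. \<omega> y} t)" for x t
    by (rule measurable_occupied)
  have eq: "(INF t\<in>{t. P t}. enat t) = (INF t. if P t then enat t else \<infinity>)" for P
  proof (rule antisym)
    show "(INF t\<in>{t. P t}. enat t) \<le> (INF t. if P t then enat t else \<infinity>)"
      by (rule INF_greatest) (auto intro: INF_lower)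
    show "(INF t. if P t then enat t else \<infinity>) \<le> (INF t\<in>{t. P t}. enat t)"
    proof (rule INF_greatest)
      fix t assume "t \<in> {t. P t}"
      then show "(INF t. if P t then enat t else \<infinity>) \<le> enat t"
        by (intro INF_lower2[of t]) simp_all
    qed
  qed
  have "(\<lambda>\<omega>. INF t. if (0, 0) \<in> occupied \<rho> Z {y. \<omega> y} t then enat t else \<infinity>)
      \<in> initial_measure p \<rightarrow>\<^sub>M count_space UNIV"
    by measurable
  moreover have "ennreal_of_enat \<in> count_space UNIV \<rightarrow>\<^sub>M borel"
    by simp
  ultimately show ?thesis
    unfolding hitting_time_def eq by (rule measurable_compose)
qed

end

theory Submission
  imports Defs "HOL-Real_Asymp.Real_Asymp"
begin

text \<open>
  Write \<open>a = p powr - \<gamma>\<close>; then \<open>m\<close> is the least natural number with \<open>(m + 1) * (m + 4) \<ge> 2 * r\<close>, which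
  gives \<open>r - m - 1 \<le> \<gamma> < r - m\<close>, and \<open>(m + 2) * \<gamma> = r + (r - 1) + \<dots> + (r - m)\<close>.

  Upper bound: in a square of side \<open>t = L * a\<close>, look for \<open>r\<close> consecutive rows such that the \<open>i\<close>-th one
  contains \<open>r - i\<close> contiguous occupied points. Such rows fill up one after the other and then
  spread to the origin in time of order \<open>t\<close>. Rows with \<open>i > m\<close> are available with probability bounded
  below, so the expected number of such strips is of order
  \<open>t * (\<Prod>i\<le>m. t * p ^ (r - i)) = L ^ (m + 2)\<close>, and disjoint strips are independent.

  Lower bound: enlarge the dynamics by filling the whole row and the whole column of every newly
  occupied point. A point of such a sequence of triggers which sees \<open>i\<close> earlier rows and \<open>j\<close> earlier
  columns needs \<open>r - i - j\<close> initial points, and these lie on none of the lines filled before; hence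
  different triggers use different points. Stop at the first trigger that sees \<open>m\<close> earlier rows or
  columns, has many ancestors, or lies on an axis, and keep only its ancestors. If the rows form \<open>R\<close>
  and the columns \<open>R'\<close> clusters, there are of order \<open>t ^ (R + R')\<close> possible positions, and connectedness
  forces \<open>R + R' \<le> n + 1\<close> for \<open>n\<close> triggers. The number of initial points needed is at least
  \<open>\<gamma> * (R + R')\<close> (minus \<open>\<gamma>\<close> for a trigger on an axis, which has one coordinate less to choose), so the
  union bound gives a probability of order \<open>L\<close> for \<open>t = L * a\<close>.
\<close>

section \<open>Clusters of integers\<close>

text \<open>Cut \<open>B\<close> at every gap larger than \<rho> and let \<open>L x\<close> be the
  least point of the piece containing \<open>x\<close>. Consecutive points of a piece are at most
  \<rho> apart, so its length is at most \<rho> times its number of points. The points are added in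
  increasing order.\<close>

lemma gap_cluster:
  fixes B :: "int set"
  assumes "finite B"
  shows "\<exists>L. (\<forall>x\<in>B. L x \<le> x \<and> x \<le> L x + int \<rho> * int (card B)) \<and>
             (\<forall>x\<in>B. \<forall>y\<in>B. \<bar>x - y\<bar> \<le> int \<rho> \<longrightarrow> L x = L y)"
  using assms
proof (induction B rule: finite_linorder_max_induct)
  case empty
  then show ?case by simp
next
  case (insert x B)
  then obtain L where L1: "\<And>y. y \<in> B \<Longrightarrow> L y \<le> y \<and> y \<le> L y + int \<rho> * int (card B)"
    and L2: "\<And>y z. y \<in> B \<Longrightarrow> z \<in> B \<Longrightarrow> \<bar>y - z\<bar> \<le> int \<rho> \<Longrightarrow> L y = L z"
    by blast
  have xB: "x \<notin> B" using insert.hyps by blast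
  have card: "card (insert x B) = Suc (card B)"
    using insert.hyps xB by simp
  have mono: "int \<rho> * int (card B) \<le> int \<rho> * int (Suc (card B))"
    by (intro mult_left_mono) auto
  \<comment> \<open>Any point of \<open>B\<close> within \<rho> of the new maximum \<open>x\<close>
    is also within \<rho> of \<open>Max B\<close>, which lies between them. So \<open>x\<close>
    either joins the piece of \<open>Max B\<close> or starts a piece of its own.\<close>
  define v where "v = (if \<exists>z\<in>B. x - z \<le> int \<rho> then L (Max B) else x)"
  define L' where "L' = L(x := v)"
  have L'B: "L' y = L y" if "y \<in> B" for y
    using that xB by (auto simp: L'_def)
  have near: "L y = v" if "y \<in> B" "\<bar>x - y\<bar> \<le> int \<rho>" for y
  proof -
    have ne: "B \<noteq> {}" using that by auto
    have "Max B \<in> B" "y \<le> Max B" "Max B < x"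
      using insert.hyps ne that by auto
    then have "L y = L (Max B)"
      using that by (intro L2) auto
    moreover have "x - y \<le> int \<rho>" using that(2) by linarith
    then have "v = L (Max B)"
      using that(1) unfolding v_def by auto
    ultimately show ?thesis by simp
  qed
  have v: "v \<le> x \<and> x \<le> v + int \<rho> * int (Suc (card B))"
  proof (cases "\<exists>z\<in>B. x - z \<le> int \<rho>")
    case True
    then obtain z where z: "z \<in> B" "x - z \<le> int \<rho>" by blast
    then have "z < x" using insert.hyps by blast
    then have "v = L z" using near[OF z(1)] z(2) by auto
    then show ?thesis using L1[OF z(1)] z \<open>z < x\<close> by (auto simp: algebra_simps)
  next
    case False
    then show ?thesis by (simp add: v_def)
  qed
  have "\<forall>y\<in>insert x B. L' y \<le> y \<and> y \<le> L' y + int \<rho> * int (card (insert x B))"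
    using L1 v mono L'B unfolding card by (auto simp: L'_def) (smt (verit) L1 mono)
  moreover have "\<forall>y\<in>insert x B. \<forall>z\<in>insert x B. \<bar>y - z\<bar> \<le> int \<rho> \<longrightarrow> L' y = L' z"
  proof (intro ballI impI)
    fix y z assume *: "y \<in> insert x B" "z \<in> insert x B" "\<bar>y - z\<bar> \<le> int \<rho>"
    have Lx: "L' x = v" by (simp add: L'_def)
    consider "y = x" "z = x" | "y = x" "z \<in> B" | "y \<in> B" "z = x" | "y \<in> B" "z \<in> B"
      using * by blast
    then show "L' y = L' z"
    proof cases
      case 2
      then show ?thesis using near[of z] L'B Lx *(3) by simp
    next
      case 3
      then show ?thesis using near[of y] L'B Lx *(3) by (simp add: abs_minus_commute)
    next
      case 4
      then show ?thesis using L2[of y z] L'B *(3) by simp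
    qed simp
  qed
  ultimately show ?case by blast
qed

text \<open>Rows with gaps at most \<open>\<rho>\<close> form a cluster, and \<open>f k\<close> is the last index in the cluster of \<open>k\<close>.
  Representing clusters by their last index lets linkedness to later triggers bound their number, and
  lets the condition \<open>b n = 0\<close> on the final trigger fix the position of its whole cluster.\<close>

definition cluster_last :: "nat \<Rightarrow> (nat \<Rightarrow> int) \<Rightarrow> nat \<Rightarrow> (nat \<Rightarrow> nat) \<Rightarrow> bool" where
  "cluster_last \<rho> b n f \<longleftrightarrow>
     (\<forall>k<n. k \<le> f k \<and> f k < n \<and> f (f k) = f k \<and> \<bar>b k - b (f k)\<bar> \<le> int (\<rho> * n)) \<and>
     (\<forall>k<n. \<forall>l<n. \<bar>b k - b l\<bar> \<le> int \<rho> \<longrightarrow> f k = f l)"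

text \<open>Indices with the same left end \<open>L (b k)\<close> form a cluster, and all their
  values lie in one interval of length \<rho> times \<open>n\<close> starting there. The
  representative is the largest such index.\<close>

lemma cluster_last_exists: "\<exists>f\<in>{..<n} \<rightarrow>\<^sub>E {..<n}. cluster_last \<rho> b n f"
proof -
  obtain L where L: "(\<forall>x\<in>b ` {..<n}. L x \<le> x \<and> x \<le> L x + int \<rho> * int (card (b ` {..<n}))) \<and>
      (\<forall>x\<in>b ` {..<n}. \<forall>y\<in>b ` {..<n}. \<bar>x - y\<bar> \<le> int \<rho> \<longrightarrow> L x = L y)"
    using gap_cluster[OF finite_imageI[OF finite_lessThan], of b n \<rho>] by (elim exE)
  note L1 = bspec[OF conjunct1[OF L]] and L2 = conjunct2[OF L, rule_format]
  have "card (b ` {..<n}) \<le> n"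
    using card_image_le[of "{..<n}" b] by simp
  then have "int \<rho> * int (card (b ` {..<n})) \<le> int (\<rho> * n)"
    by (simp add: mult_left_mono)
  then have L1': "L (b k) \<le> b k \<and> b k \<le> L (b k) + int (\<rho> * n)" if "k < n" for k
    using L1[of "b k"] that by fastforce
  define f where "f = (\<lambda>k\<in>{..<n}. Max {l. l < n \<and> L (b l) = L (b k)})"
  have f: "k \<le> f k" "f k < n" "L (b (f k)) = L (b k)" if "k < n" for k
  proof -
    let ?S = "{l. l < n \<and> L (b l) = L (b k)}"
    have fk: "f k = Max ?S" using that by (simp add: f_def)
    have fin: "finite ?S" and k: "k \<in> ?S" using that by auto
    show "k \<le> f k" unfolding fk by (rule Max_ge[OF fin k])
    have "f k \<in> ?S" unfolding fk by (rule Max_in[OF fin]) (use k in blast)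
    then show "f k < n" "L (b (f k)) = L (b k)" by auto
  qed
  have feq: "f k = f l" if "k < n" "l < n" "L (b k) = L (b l)" for k l
    using that by (simp add: f_def)
  have "cluster_last \<rho> b n f"
    unfolding cluster_last_def
  proof (intro conjI allI impI)
    fix k assume k: "k < n"
    show "k \<le> f k" "f k < n" using f k by auto
    show "f (f k) = f k" using f k by (intro feq) auto
    show "\<bar>b k - b (f k)\<bar> \<le> int (\<rho> * n)"
      using L1'[OF k] L1'[of "f k"] f[OF k] by linarith
  next
    fix k l assume "k < n" "l < n" "\<bar>b k - b l\<bar> \<le> int \<rho>"
    then show "f k = f l"
      by (intro feq L2) auto
  qed
  moreover have "f \<in> {..<n} \<rightarrow>\<^sub>E {..<n}"
    using f(2) by (auto simp: f_def)
  ultimately show ?thesis by blast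
qed

text \<open>A tuple is recovered from its values at the representatives outside \<open>Z\<close> and
  from the offsets \<open>b k - b (f k)\<close>. Only the former have a number of choices that grows
  with \<open>N\<close>; a zero prescribed at a representative removes one such factor.\<close>

lemma card_tuples_le:
  assumes fin: "finite I" and f: "\<And>k. k \<in> I \<Longrightarrow> f k \<in> I \<and> f (f k) = f k"
    and Z: "Z \<subseteq> f ` I"
  shows "card {b \<in> I \<rightarrow>\<^sub>E {- int N..int N}. (\<forall>k\<in>I. \<bar>b k - b (f k)\<bar> \<le> int K) \<and> (\<forall>z\<in>Z. b z = 0)}
    \<le> (2 * N + 1) ^ (card (f ` I) - card Z) * (2 * K + 1) ^ card I" (is "card ?S \<le> _")
proof -
  let ?A = "f ` I - Z"
  let ?\<phi> = "\<lambda>b. (restrict b ?A, \<lambda>k\<in>I. b k - b (f k))"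
  let ?T = "(?A \<rightarrow>\<^sub>E {- int N..int N}) \<times> (I \<rightarrow>\<^sub>E {- int K..int K})"
  have sub: "?\<phi> ` ?S \<subseteq> ?T"
  proof (intro image_subsetI SigmaI)
    fix b assume b: "b \<in> ?S"
    show "restrict b ?A \<in> ?A \<rightarrow>\<^sub>E {- int N..int N}"
      using b f by (intro restrict_PiE_iff[THEN iffD2]) (auto simp: PiE_iff)
    show "(\<lambda>k\<in>I. b k - b (f k)) \<in> I \<rightarrow>\<^sub>E {- int K..int K}"
    proof (intro restrict_PiE_iff[THEN iffD2] ballI)
      fix k assume "k \<in> I"
      then have "\<bar>b k - b (f k)\<bar> \<le> int K" using b by simp
      then show "b k - b (f k) \<in> {- int K..int K}" unfolding atLeastAtMost_iff by linarith
    qed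
  qed
  have inj: "inj_on ?\<phi> ?S"
  proof (rule inj_onI)
    fix b c assume b: "b \<in> ?S" and c: "c \<in> ?S" and eq: "?\<phi> b = ?\<phi> c"
    have 1: "b z = c z" if "z \<in> f ` I" for z
    proof (cases "z \<in> Z")
      case True
      then show ?thesis using b c by simp
    next
      case False
      then have "z \<in> ?A" using that by simp
      then show ?thesis using eq by (metis (no_types, lifting) prod.inject restrict_apply')
    qed
    show "b = c"
    proof
      fix k
      show "b k = c k"
      proof (cases "k \<in> I")
        case True
        then have "b k - b (f k) = c k - c (f k)"
          using eq by (metis (no_types, lifting) prod.inject restrict_apply')
        moreover have "b (f k) = c (f k)" using True by (intro 1) auto
        ultimately show ?thesis by simp
      next
        case False
        then show ?thesis using b c by (auto simp: PiE_iff extensional_def)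
      qed
    qed
  qed
  have finA: "finite ?A" using fin by simp
  have "card ?S \<le> card ?T"
    using sub inj by (intro card_inj_on_le[where f = ?\<phi>]) (auto intro!: finite_PiE finA fin)
  also have "\<dots> = (2 * N + 1) ^ card ?A * (2 * K + 1) ^ card I"
  proof -
    have "card {- int k..int k} = 2 * k + 1" for k by simp
    then show ?thesis
      using finA fin by (simp only: card_cartesian_product card_PiE prod_constant)
  qed
  also have "card ?A = card (f ` I) - card Z"
    using fin Z by (simp add: card_Diff_subset finite_subset)
  finally show ?thesis .
qed

section \<open>Earlier lines seen by an index\<close>

text \<open>With \<open>b\<close> the first coordinates of successive triggers, these are the filled
  columns that cross the horizontal neighborhood of the \<open>k\<close>-th one; with second
  coordinates, the filled rows that cross its vertical neighborhood.\<close>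

definition near_before :: "nat \<Rightarrow> (nat \<Rightarrow> int) \<Rightarrow> nat \<Rightarrow> nat set" where
  "near_before \<rho> b k = {l. l < k \<and> \<bar>b l - b k\<bar> \<le> int \<rho>}"

lemma finite_near_before [simp]: "finite (near_before \<rho> b k)"
  by (auto simp: near_before_def intro: finite_subset[of _ "{..<k}"])

lemma cluster_last_near_before:
  assumes "cluster_last \<rho> b n f" "k < n" "l \<in> near_before \<rho> b k"
  shows "f l = f k"
proof -
  have "l < n" "\<bar>b l - b k\<bar> \<le> int \<rho>" using assms(2,3) by (simp_all add: near_before_def)
  then show ?thesis using assms(1,2) unfolding cluster_last_def by blast
qed

lemma cluster_lastD:
  assumes "cluster_last \<rho> b n f" "k < n"
  shows "k \<le> f k" "f k < n" "f (f k) = f k" "\<bar>b k - b (f k)\<bar> \<le> int (\<rho> * n)"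
  using assms unfolding cluster_last_def by blast+

text \<open>The least index of a cluster sees nothing, since whatever it saw would be an earlier
  member of the same cluster. That \<open>A\<close> is a union of clusters keeps this argument
  inside \<open>A\<close>.\<close>

lemma card_image_le_first:
  assumes "cluster_last \<rho> b n f"
  assumes A: "A \<subseteq> {..<n}" "\<And>k l. k \<in> A \<Longrightarrow> l < n \<Longrightarrow> f l = f k \<Longrightarrow> l \<in> A"
  shows "card (f ` A) \<le> card {k\<in>A. card (near_before \<rho> b k) = 0}"
proof -
  have fin: "finite A" using A finite_subset by blast
  have "f ` A \<subseteq> f ` {k\<in>A. card (near_before \<rho> b k) = 0}"
  proof
    fix v assume "v \<in> f ` A"
    then obtain k0 where k0: "k0 \<in> A" "f k0 = v" by blast
    define k where "k = (LEAST k. k \<in> A \<and> f k = v)"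
    have k: "k \<in> A" "f k = v"
      using LeastI[of "\<lambda>k. k \<in> A \<and> f k = v" k0] k0 unfolding k_def by auto
    have least: "l \<notin> A" if "l < k" "f l = v" for l
      using not_less_Least[of l "\<lambda>k. k \<in> A \<and> f k = v"] that unfolding k_def by auto
    have kn: "k < n" using k A by auto
    have "near_before \<rho> b k = {}"
    proof (rule ccontr)
      assume "near_before \<rho> b k \<noteq> {}"
      then obtain l where l: "l \<in> near_before \<rho> b k" by blast
      then have lk: "l < k" by (simp add: near_before_def)
      have "f l = f k" using cluster_last_near_before[OF assms(1) kn l] .
      moreover have "l \<in> A" using A(2)[OF k(1)] lk kn \<open>f l = f k\<close> by auto
      ultimately show False using least lk k by auto
    qed
    then show "v \<in> f ` {k\<in>A. card (near_before \<rho> b k) = 0}" using k by auto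
  qed
  then have "card (f ` A) \<le> card (f ` {k\<in>A. card (near_before \<rho> b k) = 0})"
    using fin by (intro card_mono) auto
  also have "\<dots> \<le> card {k\<in>A. card (near_before \<rho> b k) = 0}"
    using fin by (intro card_image_le) auto
  finally show ?thesis .
qed

text \<open>Each cluster has an index that contributes 0, and every other index contributes at most
  \<open>m\<close>.\<close>

lemma sum_near_before_le:
  assumes "cluster_last \<rho> b n f"
  assumes A: "A \<subseteq> {..<n}" "\<And>k l. k \<in> A \<Longrightarrow> l < n \<Longrightarrow> f l = f k \<Longrightarrow> l \<in> A"
  assumes m: "\<And>k. k \<in> A \<Longrightarrow> card (near_before \<rho> b k) \<le> m"
  shows "(\<Sum>k\<in>A. card (near_before \<rho> b k)) + m * card (f ` A) \<le> m * card A"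
proof -
  let ?c = "\<lambda>k. card (near_before \<rho> b k)"
  let ?Z = "{k\<in>A. ?c k = 0}"
  have fin: "finite A" using A finite_subset by blast
  have "(\<Sum>k\<in>A. ?c k) = (\<Sum>k\<in>A - ?Z. ?c k)"
    using fin by (intro sum.mono_neutral_right) auto
  also have "\<dots> \<le> (\<Sum>k\<in>A - ?Z. m)"
    using m by (intro sum_mono) auto
  also have "\<dots> = m * (card A - card ?Z)"
    using fin by (simp add: card_Diff_subset)
  also have "\<dots> \<le> m * (card A - card (f ` A))"
    using card_image_le_first[OF assms(1) A] by (intro mult_left_mono diff_le_mono2) auto
  also have "\<dots> + m * card (f ` A) = m * card A"
    using card_image_le[OF fin, of f] by (simp add: algebra_simps diff_mult_distrib2)
  finally show ?thesis by simp
qed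

text \<open>The element of rank \<open>q\<close> in \<open>S\<close> contributes at most
  \<open>min q M\<close>; the ranks are exhausted from the top.\<close>

lemma sum_le_sum_min_rank:
  fixes c :: "nat \<Rightarrow> nat"
  assumes "finite S" "\<And>k. k \<in> S \<Longrightarrow> c k \<le> card {l\<in>S. l < k}" "\<And>k. k \<in> S \<Longrightarrow> c k \<le> M"
  shows "sum c S \<le> (\<Sum>q<card S. min q M)"
  using assms
proof (induction S rule: finite_linorder_max_induct)
  case (insert x S)
  have x: "x \<notin> S" using insert.hyps by blast
  have "{l \<in> insert x S. l < x} = S" using insert.hyps by auto
  then have cx: "c x \<le> min (card S) M"
    using insert.prems by (metis insertI1 min.bounded_iff)
  have "sum c S \<le> (\<Sum>q<card S. min q M)"
  proof (rule insert.IH)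
    fix k assume k: "k \<in> S"
    then have "{l \<in> insert x S. l < k} = {l \<in> S. l < k}" using insert.hyps by auto
    then show "c k \<le> card {l \<in> S. l < k}" using insert.prems(1)[of k] k by simp
    show "c k \<le> M" using insert.prems k by simp
  qed
  with cx have "c x + sum c S \<le> min (card S) M + (\<Sum>q<card S. min q M)" by (rule add_mono)
  then show ?case using x insert.hyps by (simp add: add.commute)
qed simp

text \<open>Together the first \<open>m\<close> terms fall short of \<open>m - 1\<close> each by
  \<open>m * (m - 1) / 2\<close>. This deficit is the gain that compensates for a final trigger with
  many visible lines.\<close>

lemma sum_min_eq:
  assumes "N \<ge> m"
  shows "2 * (\<Sum>q<N. min q (m - 1)) + m * (m - 1) = 2 * (m - 1) * (N::nat)"
  using assms
proof (induction N rule: dec_induct)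
  case base
  show ?case
  proof (induction m)
    case (Suc m)
    have "(\<Sum>q<Suc m. min q m) = (\<Sum>q<Suc m. q)"
      by (intro sum.cong) auto
    also have "\<dots> = (\<Sum>q<m. q) + m" by simp
    finally have 1: "(\<Sum>q<Suc m. min q m) = (\<Sum>q<m. q) + m" .
    have "2 * (\<Sum>q<m. q) = m * (m - 1)"
    proof (induction m)
      case (Suc m) then show ?case by (cases m) (auto simp: algebra_simps)
    qed simp
    then show ?case using 1 by (cases m) (simp_all add: algebra_simps)
  qed simp
next
  case (step N)
  then have "min N (m - 1) = m - 1" by simp
  with step show ?case by (simp only: sum.lessThan_Suc distrib_left mult_Suc_right)
qed

text \<open>The last element may close a gap and see more than \<open>m\<close> earlier ones; this is paid for by
  the early members of its own cluster, the \<open>q\<close>-th of which sees at most \<open>q\<close> others.\<close>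

lemma sum_near_before_last_le:
  assumes cl: "cluster_last \<rho> b (Suc n) f"
    and m: "\<And>k. k < n \<Longrightarrow> card (near_before \<rho> b k) < m"
    and last: "card (near_before \<rho> b n) \<ge> m"
  shows "2 * (\<Sum>k<Suc n. card (near_before \<rho> b k)) + 2 * m * card (f ` {..<Suc n}) + m * (m - 1)
          \<le> 2 * m * Suc n"
proof -
  let ?c = "\<lambda>k. card (near_before \<rho> b k)"
  \<comment> \<open>\<open>S\<close> is the cluster of the last index, \<open>T\<close> the earlier
    members of that cluster, and \<open>Q\<close> the union of all other clusters.\<close>
  define S where "S = {k. k < Suc n \<and> f k = f n}"
  define T where "T = S - {n}"
  define Q where "Q = {..<Suc n} - S"
  have nS: "n \<in> S" by (simp add: S_def)
  have fin: "finite S" "finite T" "finite Q" by (auto simp: S_def T_def Q_def)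
  have cS: "card S = Suc (card T)"
    using nS fin by (metis T_def card.remove)
  have part: "{..<Suc n} = Q \<union> S" "Q \<inter> S = {}" by (auto simp: Q_def S_def)
  have nb: "near_before \<rho> b k \<subseteq> {l\<in>T. l < k}" if "k \<in> S" for k
  proof
    fix l assume l: "l \<in> near_before \<rho> b k"
    have "k < Suc n" using that by (simp add: S_def)
    then have "f l = f k" using cluster_last_near_before[OF cl _ l] by simp
    moreover have "l < k" using l by (simp add: near_before_def)
    ultimately show "l \<in> {l\<in>T. l < k}" using that by (auto simp: S_def T_def)
  qed
  \<comment> \<open>Everything that \<open>n\<close> sees lies in \<open>T\<close>. Hence
    \<open>T\<close> has at least \<open>m\<close> elements, which is the range of
    \<open>sum_min_eq\<close>, and \<open>?c n\<close> adds at most 1 per element of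
    \<open>T\<close>, raising the rate there from \<open>m - 1\<close> to \<open>m\<close>.\<close>
  have cn: "?c n \<le> card T"
    using nb[OF nS] fin by (intro card_mono) auto
  have "(\<Sum>k\<in>T. ?c k) \<le> (\<Sum>q<card T. min q (m - 1))"
  proof (rule sum_le_sum_min_rank[OF fin(2)])
    fix k assume k: "k \<in> T"
    then show "?c k \<le> card {l \<in> T. l < k}"
      using nb[of k] fin by (intro card_mono) (auto simp: T_def)
    have "k < n" using k by (auto simp: T_def S_def)
    then show "?c k \<le> m - 1" using m[of k] by simp
  qed
  moreover have "2 * (\<Sum>q<card T. min q (m - 1)) + m * (m - 1) = 2 * (m - 1) * card T"
    using last cn by (intro sum_min_eq) simp
  ultimately have T: "2 * (\<Sum>k\<in>T. ?c k) + m * (m - 1) \<le> 2 * (m - 1) * card T" by linarith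
  \<comment> \<open>For \<open>m = 0\<close> the truncated \<open>m - 1\<close> would spoil the
    identity below unless \<open>T\<close> is empty; in that case \<open>n = 0\<close>, because an
    earlier index would see fewer than 0 others.\<close>
  have "m \<ge> 1 \<or> n = 0" using m[of 0] by (cases "n = 0") auto
  moreover have "T \<subseteq> {..<n}" by (auto simp: T_def S_def)
  ultimately have T': "(m - 1) * card T + card T = m * card T"
    by (cases m) auto
  have Q: "(\<Sum>k\<in>Q. ?c k) + m * card (f ` Q) \<le> m * card Q"
  proof (rule sum_near_before_le[OF cl])
    fix k assume "k \<in> Q"
    then have "k < n" by (auto simp: Q_def S_def less_Suc_eq)
    then show "?c k \<le> m" using m[of k] by simp
  qed (auto simp: Q_def S_def)
  have "card (f ` {..<Suc n}) \<le> card (f ` Q) + card (f ` S)"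
    unfolding part(1) image_Un by (rule card_Un_le)
  also have "f ` S = {f n}" using nS by (auto simp: S_def)
  finally have R: "card (f ` {..<Suc n}) \<le> card (f ` Q) + 1" by simp
  have "(\<Sum>k<Suc n. ?c k) = (\<Sum>k\<in>Q. ?c k) + (\<Sum>k\<in>S. ?c k)"
    unfolding part(1) using fin part(2) by (intro sum.union_disjoint) auto
  also have "(\<Sum>k\<in>S. ?c k) = ?c n + (\<Sum>k\<in>T. ?c k)"
    unfolding T_def using fin nS by (intro sum.remove) auto
  finally have sum: "(\<Sum>k<Suc n. ?c k) = (\<Sum>k\<in>Q. ?c k) + (?c n + (\<Sum>k\<in>T. ?c k))" .
  have "card {..<Suc n} = card Q + card S"
    unfolding part(1) using fin part(2) by (intro card_Un_disjoint) auto
  then have card: "Suc n = card Q + Suc (card T)" using cS by simp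
  have mR: "2 * m * card (f ` {..<Suc n}) \<le> 2 * m * card (f ` Q) + 2 * m"
    using mult_left_mono[OF R, of "2 * m"] by (simp add: algebra_simps)
  have 1: "2 * (m - 1) * card T + 2 * card T = 2 * m * card T"
    using T' by (metis (no_types, lifting) add_mult_distrib2 mult.assoc)
  have 2: "2 * m * Suc n = 2 * m * card Q + (2 * m + 2 * m * card T)"
    unfolding card by (simp add: algebra_simps)
  have 3: "2 * (\<Sum>k\<in>Q. ?c k) + 2 * m * card (f ` Q) \<le> 2 * m * card Q"
    using mult_left_mono[OF Q, of 2] by (simp add: algebra_simps)
  \<comment> \<open>The bounds for \<open>Q\<close>, \<open>T\<close> and \<open>n\<close> are added
    with all products regarded as atoms.\<close>
  have arith: "2 * (q + (c + t)) + r + h \<le> w"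
    if "y + 2 * s = z" "w = x + (v + z)" "2 * q + u \<le> x" "2 * t + h \<le> y" "c \<le> s" "r \<le> u + v"
    for q c t r h w y s z x v u :: nat
  proof -
    have "2 * (q + (c + t)) + r + h = 2 * q + (2 * t + h) + 2 * c + r" by simp
    also have "\<dots> \<le> 2 * q + y + 2 * s + (u + v)"
      using that by (intro add_mono) simp_all
    also have "\<dots> = (2 * q + u) + (y + 2 * s) + v" by simp
    also have "\<dots> \<le> x + z + v" using that by (intro add_mono) simp_all
    finally show ?thesis using that(2) by simp
  qed
  show ?thesis unfolding sum by (rule arith[OF 1 2 3 T cn mR])
qed

text \<open>An index \<open>k < n\<close> cannot represent its cluster in both coordinates: some
  later \<open>l\<close> sees it in one of them, so \<open>l\<close> shares that cluster and
  \<open>k\<close> is not its last index. Thus the two sets of representatives lie in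
  \<open>{..<Suc n}\<close> and have at most \<open>n\<close> in common, and inclusion-exclusion
  gives the bound.\<close>

lemma card_clusters_le:
  assumes a: "cluster_last \<rho> a (Suc n) f" and b: "cluster_last \<rho> b (Suc n) g"
    and linked: "\<And>k. k < n \<Longrightarrow> \<exists>l. k < l \<and> l \<le> n \<and> (k \<in> near_before \<rho> a l \<or> k \<in> near_before \<rho> b l)"
  shows "card (f ` {..<Suc n}) + card (g ` {..<Suc n}) \<le> n + 2"
proof -
  let ?I = "{..<Suc n}"
  have fix_le: "k = n" if kI: "k \<in> f ` ?I" "k \<in> g ` ?I" for k
  proof (rule ccontr)
    assume "k \<noteq> n"
    obtain u v where "k = f u" "u < Suc n" "k = g v" "v < Suc n" using kI by blast
    then have fk: "f k = k" "g k = k" "k < Suc n"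
      using cluster_lastD(2,3)[OF a, of u] cluster_lastD(3)[OF b, of v] by simp_all
    with \<open>k \<noteq> n\<close> have "k < n" by simp
    from linked[OF this] obtain l where l: "k < l" "l \<le> n"
      "k \<in> near_before \<rho> a l \<or> k \<in> near_before \<rho> b l" by blast
    have "f k = f l \<or> g k = g l"
      using l cluster_last_near_before[OF a, of l k] cluster_last_near_before[OF b, of l k] by auto
    moreover have "l \<le> f l" "l \<le> g l" using cluster_lastD(1)[OF a, of l] cluster_lastD(1)[OF b, of l] l by simp_all
    ultimately show False using fk l by auto
  qed
  have sub: "f ` ?I \<subseteq> ?I" "g ` ?I \<subseteq> ?I"
    using cluster_lastD(2)[OF a] cluster_lastD(2)[OF b] by auto
  have "card (f ` ?I) + card (g ` ?I) = card (f ` ?I \<union> g ` ?I) + card (f ` ?I \<inter> g ` ?I)"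
    by (intro card_Un_Int) auto
  also have "card (f ` ?I \<union> g ` ?I) \<le> card ?I" using sub by (intro card_mono) auto
  also have "card (f ` ?I \<inter> g ` ?I) \<le> card {n}" using fix_le by (intro card_mono) auto
  finally show ?thesis by simp
qed

section \<open>Events determined by finitely many sites\<close>

lemma prob_space_initial_measure: "prob_space (initial_measure p)"
  unfolding initial_measure_def by (intro prob_space_PiM prob_space_measure_pmf)

lemma space_initial_measure [simp]: "space (initial_measure p) = UNIV"
  by (simp add: initial_measure_def space_PiM)

definition determined_by :: "('a \<Rightarrow> bool) set \<Rightarrow> 'a set \<Rightarrow> bool" where
  "determined_by E K \<longleftrightarrow> (\<forall>\<omega> \<omega>'. (\<forall>x\<in>K. \<omega> x = \<omega>' x) \<longrightarrow> (\<omega> \<in> E \<longleftrightarrow> \<omega>' \<in> E))"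

lemma determined_by_mono: "determined_by E K \<Longrightarrow> K \<subseteq> L \<Longrightarrow> determined_by E L"
  unfolding determined_by_def by blast

lemma determined_by_Collect_ball:
  "(\<And>i. i \<in> I \<Longrightarrow> determined_by (E i) K) \<Longrightarrow> determined_by {\<omega>. \<forall>i\<in>I. \<omega> \<in> E i} K"
  unfolding determined_by_def mem_Collect_eq by (intro allI impI ball_cong refl) simp

lemma determined_by_Collect_not: "determined_by E K \<Longrightarrow> determined_by {\<omega>. \<omega> \<notin> E} K"
  unfolding determined_by_def by blast

text \<open>On finitely many sites every set of configurations is measurable, so \<open>E\<close> is
  the cylinder over its own image under restriction to \<open>K\<close>.\<close>

lemma determined_by_preimage:
  assumes "finite K" "determined_by E K"
  obtains A where "A \<in> sets (\<Pi>\<^sub>M x\<in>K. measure_pmf (bernoulli_pmf p))"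
    "E = {\<omega>. restrict \<omega> K \<in> A}"
proof
  let ?A = "(\<lambda>\<omega>. restrict \<omega> K) ` E"
  have "sets (\<Pi>\<^sub>M x\<in>K. measure_pmf (bernoulli_pmf p)) = sets (\<Pi>\<^sub>M x\<in>K. count_space (UNIV :: bool set))"
    by (intro sets_PiM_cong) simp_all
  also have "\<dots> = Pow (\<Pi>\<^sub>E x\<in>K. UNIV)"
    using assms(1) by (subst count_space_PiM_finite) simp_all
  finally have S: "sets (\<Pi>\<^sub>M x\<in>K. measure_pmf (bernoulli_pmf p)) = Pow (\<Pi>\<^sub>E x\<in>K. UNIV)" .
  have "?A \<subseteq> (\<Pi>\<^sub>E x\<in>K. UNIV)"
    by (intro image_subsetI) (simp add: restrict_PiE_iff)
  then show "?A \<in> sets (\<Pi>\<^sub>M x\<in>K. measure_pmf (bernoulli_pmf p))"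
    unfolding S by (rule PowI)
  show "E = {\<omega>. restrict \<omega> K \<in> ?A}"
  proof safe
    fix \<omega> \<omega>' assume eq: "restrict \<omega> K = restrict \<omega>' K" and "\<omega>' \<in> E"
    have "\<forall>x\<in>K. \<omega> x = \<omega>' x" using eq by (metis restrict_apply')
    then show "\<omega> \<in> E" using assms(2) \<open>\<omega>' \<in> E\<close> unfolding determined_by_def by blast
  qed auto
qed

lemma determined_by_sets:
  assumes "finite K" "determined_by E K"
  shows "E \<in> sets (initial_measure p)"
proof -
  obtain A where A: "A \<in> sets (\<Pi>\<^sub>M x\<in>K. measure_pmf (bernoulli_pmf p))" "E = {\<omega>. restrict \<omega> K \<in> A}"
    using determined_by_preimage[OF assms] by blast
  have "(\<lambda>\<omega>. restrict \<omega> K) \<in> initial_measure p \<rightarrow>\<^sub>M (\<Pi>\<^sub>M x\<in>K. measure_pmf (bernoulli_pmf p))"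
    unfolding initial_measure_def by (intro measurable_restrict_subset) simp
  from measurable_sets[OF this A(1)]
  have "(\<lambda>\<omega>. restrict \<omega> K) -` A \<inter> space (initial_measure p) \<in> sets (initial_measure p)" .
  also have "(\<lambda>\<omega>. restrict \<omega> K) -` A \<inter> space (initial_measure p) = E"
    unfolding A(2) by auto
  finally show ?thesis .
qed

text \<open>Independence of events that depend on disjoint finite sets of sites, obtained by
  grouping the independent coordinates into the blocks \<open>K j\<close>.\<close>

lemma prob_Inter_determined_by:
  assumes J: "finite J" and K: "\<And>j. j \<in> J \<Longrightarrow> finite (K j)" "disjoint_family_on K J"
    and E: "\<And>j. j \<in> J \<Longrightarrow> determined_by (E j) (K j)"
  shows "measure (initial_measure p) {\<omega>. \<forall>j\<in>J. \<omega> \<in> E j} = (\<Prod>j\<in>J. measure (initial_measure p) (E j))"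
proof (cases "J = {}")
  case True
  have "measure (initial_measure p) UNIV = 1"
    using prob_space.prob_space[OF prob_space_initial_measure] by (simp only: space_initial_measure)
  moreover have "{\<omega>. \<forall>j\<in>{}. \<omega> \<in> E j} = UNIV" by blast
  ultimately show ?thesis unfolding True by (simp only: prod.empty)
next
  case False
  interpret prob_space "initial_measure p" by (rule prob_space_initial_measure)
  let ?B = "\<lambda>_::int \<times> int. measure_pmf (bernoulli_pmf p)"
  \<comment> \<open>One measurable base is fixed for each cylinder event.\<close>
  define A where "A = (\<lambda>j. SOME A. A \<in> sets (PiM (K j) ?B) \<and> E j = {\<omega>. restrict \<omega> (K j) \<in> A})"
  have A: "A j \<in> sets (PiM (K j) ?B) \<and> E j = {\<omega>. restrict \<omega> (K j) \<in> A j}" if jJ: "j \<in> J" for j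
  proof -
    have "\<exists>A. A \<in> sets (PiM (K j) ?B) \<and> E j = {\<omega>. restrict \<omega> (K j) \<in> A}"
      by (rule determined_by_preimage[OF K(1)[OF jJ] E[OF jJ], of p]) (intro exI conjI)
    then show ?thesis unfolding A_def by (rule someI_ex)
  qed
  \<comment> \<open>The joint law of the coordinates is the product measure itself, which is the
    product of their marginals.\<close>
  have "indep_vars ?B (\<lambda>x \<omega>. \<omega> x) UNIV"
  proof (subst indep_vars_iff_distr_eq_PiM')
    show "distr (initial_measure p) (PiM UNIV ?B) (\<lambda>\<omega>. \<lambda>x\<in>UNIV. \<omega> x)
        = PiM UNIV (\<lambda>x. distr (initial_measure p) (?B x) (\<lambda>\<omega>. \<omega> x))"
    proof -
      interpret product_prob_space ?B UNIV
        by (intro product_prob_spaceI prob_space_measure_pmf)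
      show ?thesis
        unfolding initial_measure_def by (simp add: PiM_component restrict_UNIV distr_id2)
    qed
  qed (auto simp: initial_measure_def)
  then have ind: "indep_vars (\<lambda>j. PiM (K j) ?B) (\<lambda>j \<omega>. restrict (\<lambda>x. \<omega> x) (K j)) J"
    using K(2) by (intro indep_vars_restrict) auto
  have "prob (\<Inter>j\<in>J. (\<lambda>\<omega>. restrict (\<lambda>x. \<omega> x) (K j)) -` A j \<inter> space (initial_measure p))
      = (\<Prod>j\<in>J. prob ((\<lambda>\<omega>. restrict (\<lambda>x. \<omega> x) (K j)) -` A j \<inter> space (initial_measure p)))"
    using False J A by (intro indep_varsD_finite[OF ind]) blast+
  moreover have "(\<lambda>\<omega>. restrict (\<lambda>x. \<omega> x) (K j)) -` A j \<inter> space (initial_measure p) = E j" if "j \<in> J" for j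
    unfolding conjunct2[OF A[OF that]] by auto
  moreover have "{\<omega>. \<forall>j\<in>J. \<omega> \<in> E j} = (\<Inter>j\<in>J. E j)" by auto
  ultimately show ?thesis by simp
qed

lemma determined_by_all_occupied: "determined_by {\<omega>. \<forall>x\<in>F. \<omega> x} F"
  by (auto simp: determined_by_def)

lemma prob_all_occupied:
  assumes "finite F" "0 \<le> p" "p \<le> 1"
  shows "measure (initial_measure p) {\<omega>. \<forall>x\<in>F. \<omega> x} = p ^ card F"
proof -
  have single: "measure (initial_measure p) {\<omega>. \<omega> x} = p" for x
  proof -
    interpret product_prob_space "\<lambda>_. measure_pmf (bernoulli_pmf p)" UNIV
      by (intro product_prob_spaceI prob_space_measure_pmf)
    have "emeasure (initial_measure p) {\<omega>\<in>space (initial_measure p). \<omega> x \<in> {True}}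
        = emeasure (measure_pmf (bernoulli_pmf p)) {True}"
      unfolding initial_measure_def by (rule emeasure_PiM_Collect_single) simp_all
    also have "\<dots> = ennreal p" using assms by (simp add: emeasure_pmf_single)
    finally show ?thesis using assms by (simp add: measure_def)
  qed
  have "measure (initial_measure p) {\<omega>. \<forall>x\<in>F. \<omega> \<in> {\<omega>. \<omega> x}}
      = (\<Prod>x\<in>F. measure (initial_measure p) {\<omega>. \<omega> x})"
    using assms(1) by (intro prob_Inter_determined_by[where K = "\<lambda>x. {x}"])
      (auto simp: disjoint_family_on_def determined_by_def)
  then show ?thesis by (simp add: single)
qed

lemma prob_some_all_occupied_le:
  assumes "finite \<F>" "\<And>F. F \<in> \<F> \<Longrightarrow> finite F" "0 \<le> p" "p \<le> 1"
  shows "{\<omega>. \<exists>F\<in>\<F>. \<forall>x\<in>F. \<omega> x} \<in> sets (initial_measure p)"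
    and "measure (initial_measure p) {\<omega>. \<exists>F\<in>\<F>. \<forall>x\<in>F. \<omega> x} \<le> (\<Sum>F\<in>\<F>. p ^ card F)"
proof -
  interpret prob_space "initial_measure p" by (rule prob_space_initial_measure)
  have eq: "{\<omega>. \<exists>F\<in>\<F>. \<forall>x\<in>F. \<omega> x} = (\<Union>F\<in>\<F>. {\<omega>. \<forall>x\<in>F. \<omega> x})" by auto
  have sets: "{\<omega>. \<forall>x\<in>F. \<omega> x} \<in> sets (initial_measure p)" if "F \<in> \<F>" for F
    using determined_by_sets[OF assms(2)[OF that] determined_by_all_occupied] .
  then show "{\<omega>. \<exists>F\<in>\<F>. \<forall>x\<in>F. \<omega> x} \<in> sets (initial_measure p)"
    unfolding eq using assms(1) by (intro sets.finite_UN) auto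
  have "measure (initial_measure p) {\<omega>. \<exists>F\<in>\<F>. \<forall>x\<in>F. \<omega> x}
      \<le> (\<Sum>F\<in>\<F>. measure (initial_measure p) {\<omega>. \<forall>x\<in>F. \<omega> x})"
    unfolding eq using assms(1) sets by (intro finite_measure_subadditive_finite) auto
  also have "\<dots> = (\<Sum>F\<in>\<F>. p ^ card F)"
    using assms by (intro sum.cong refl prob_all_occupied) auto
  finally show "measure (initial_measure p) {\<omega>. \<exists>F\<in>\<F>. \<forall>x\<in>F. \<omega> x} \<le> (\<Sum>F\<in>\<F>. p ^ card F)" .
qed

lemma prob_Compl_determined_by:
  assumes "finite K" "determined_by E K"
  shows "measure (initial_measure p) {\<omega>. \<omega> \<notin> E} = 1 - measure (initial_measure p) E"
proof -
  interpret prob_space "initial_measure p" by (rule prob_space_initial_measure)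
  have "{\<omega>. \<omega> \<notin> E} = space (initial_measure p) - E" by auto
  then show ?thesis using prob_compl[OF determined_by_sets[OF assms, of p]] by simp
qed

text \<open>Three levels: strips \<open>s\<close>, rows \<open>i\<close> of a strip, blocks \<beta>
  of a row. The computed event says that no strip has a fully occupied block in each of its rows.
  Since all blocks are disjoint, independence applies first to the blocks of a row, then to the rows
  of a strip, then to the strips.\<close>

lemma prob_nested_grid:
  assumes fin: "finite S" "finite I" "finite B"
    and K: "\<And>s i \<beta>. finite (K s i \<beta>)" "\<And>s i \<beta>. card (K s i \<beta>) = c i"
    and disj: "\<And>s i \<beta> s' i' \<beta>'. i \<in> I \<Longrightarrow> i' \<in> I \<Longrightarrow> K s i \<beta> \<inter> K s' i' \<beta>' \<noteq> {} \<Longrightarrow> s = s' \<and> i = i' \<and> \<beta> = \<beta>'"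
    and p: "0 \<le> p" "p \<le> 1"
  shows "measure (initial_measure p) {\<omega>. \<forall>s\<in>S. \<not> (\<forall>i\<in>I. \<exists>\<beta>\<in>B. \<forall>x\<in>K s i \<beta>. \<omega> x)}
    = (1 - (\<Prod>i\<in>I. 1 - (1 - p ^ c i) ^ card B)) ^ card S"
proof -
  let ?P = "measure (initial_measure p)"
  let ?blk = "\<lambda>s i \<beta>. {\<omega>. \<forall>x\<in>K s i \<beta>. \<omega> x}"
  have blk: "?P {\<omega>. \<omega> \<notin> ?blk s i \<beta>} = 1 - p ^ c i" for s i \<beta>
    using prob_Compl_determined_by[OF K(1) determined_by_all_occupied] prob_all_occupied[OF K(1) p] K(2)
    by simp
  \<comment> \<open>Row \<open>i\<close> of strip \<open>s\<close> has no fully occupied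
    block.\<close>
  define R where "R = (\<lambda>s i. {\<omega>. \<forall>\<beta>\<in>B. \<omega> \<in> {\<omega>. \<omega> \<notin> ?blk s i \<beta>}})"
  have R: "?P (R s i) = (1 - p ^ c i) ^ card B" if i: "i \<in> I" for s i
  proof -
    have "?P (R s i) = (\<Prod>\<beta>\<in>B. ?P {\<omega>. \<omega> \<notin> ?blk s i \<beta>})"
      unfolding R_def
    proof (rule prob_Inter_determined_by[where K = "K s i", OF fin(3) K(1)])
      show "disjoint_family_on (K s i) B"
        using disj[OF i i] unfolding disjoint_family_on_def by blast
    qed (auto simp: determined_by_def)
    then show ?thesis unfolding blk by simp
  qed
  let ?L = "\<lambda>s i. \<Union>\<beta>\<in>B. K s i \<beta>"
  have Rdet: "determined_by (R s i) (?L s i)" for s i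
    unfolding determined_by_def R_def mem_Collect_eq by (metis UN_I)
  have finL: "finite (?L s i)" for s i using fin K by auto
  have nR: "?P {\<omega>. \<omega> \<notin> R s i} = 1 - (1 - p ^ c i) ^ card B" if "i \<in> I" for s i
    using prob_Compl_determined_by[OF finL Rdet] R[OF that] by simp
  \<comment> \<open>Strip \<open>s\<close> is good: each of its rows has a fully occupied
    block.\<close>
  define G where "G = (\<lambda>s. {\<omega>. \<forall>i\<in>I. \<omega> \<in> {\<omega>. \<omega> \<notin> R s i}})"
  have G: "?P (G s) = (\<Prod>i\<in>I. 1 - (1 - p ^ c i) ^ card B)" for s
  proof -
    have "?P (G s) = (\<Prod>i\<in>I. ?P {\<omega>. \<omega> \<notin> R s i})"
      unfolding G_def
    proof (rule prob_Inter_determined_by[where K = "?L s", OF fin(2) finL])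
      show "disjoint_family_on (?L s) I"
        using disj unfolding disjoint_family_on_def by blast
      show "determined_by {\<omega>. \<omega> \<notin> R s i} (?L s i)" for i
        by (rule determined_by_Collect_not[OF Rdet])
    qed
    then show ?thesis using nR by simp
  qed
  let ?M = "\<lambda>s. \<Union>i\<in>I. ?L s i"
  have finM: "finite (?M s)" for s using fin finL by auto
  have Gdet: "determined_by (G s) (?M s)" for s
  proof -
    have "determined_by (R s i) (?M s)" if "i \<in> I" for i
      by (rule determined_by_mono[OF Rdet]) (use that in blast)
    then show ?thesis
      unfolding G_def by (intro determined_by_Collect_ball determined_by_Collect_not)
  qed
  have nG: "?P {\<omega>. \<omega> \<notin> G s} = 1 - (\<Prod>i\<in>I. 1 - (1 - p ^ c i) ^ card B)" for s
    using prob_Compl_determined_by[OF finM Gdet] G by simp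
  have "?P {\<omega>. \<forall>s\<in>S. \<omega> \<in> {\<omega>. \<omega> \<notin> G s}} = (\<Prod>s\<in>S. ?P {\<omega>. \<omega> \<notin> G s})"
  proof (rule prob_Inter_determined_by[where K = ?M, OF fin(1) finM])
    show "disjoint_family_on ?M S"
      using disj unfolding disjoint_family_on_def by blast
    show "determined_by {\<omega>. \<omega> \<notin> G s} (?M s)" for s
      by (rule determined_by_Collect_not[OF Gdet])
  qed
  also have "\<dots> = (1 - (\<Prod>i\<in>I. 1 - (1 - p ^ c i) ^ card B)) ^ card S"
    unfolding nG by simp
  also have "{\<omega>. \<forall>s\<in>S. \<omega> \<in> {\<omega>. \<omega> \<notin> G s}} = {\<omega>. \<forall>s\<in>S. \<not> (\<forall>i\<in>I. \<exists>\<beta>\<in>B. \<forall>x\<in>K s i \<beta>. \<omega> x)}"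
    by (simp add: G_def R_def)
  finally show ?thesis .
qed

section \<open>Growth from a nucleus\<close>

abbreviation bootstrap :: "nat \<Rightarrow> nat \<Rightarrow> (int \<times> int) set \<Rightarrow> nat \<Rightarrow> (int \<times> int) set" where
  "bootstrap \<rho> r \<equiv> occupied \<rho> (bootstrap_zero_set r)"

lemma occupied_mono: "s \<le> t \<Longrightarrow> occupied \<rho> Z \<xi> s \<subseteq> occupied \<rho> Z \<xi> t"
  by (induction t rule: dec_induct) auto

lemma notin_bootstrap_zero_set: "r \<ge> 1 \<Longrightarrow> (u, v) \<notin> bootstrap_zero_set r \<longleftrightarrow> r \<le> u + v"
  by (auto simp: bootstrap_zero_set_def)

lemma bootstrap_SucI:
  assumes "r \<ge> 1"
    and H: "H \<subseteq> nbhd_h \<rho> x \<inter> bootstrap \<rho> r \<xi> t" and V: "V \<subseteq> nbhd_v \<rho> x \<inter> bootstrap \<rho> r \<xi> t"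
    and "r \<le> card H + card V"
  shows "x \<in> bootstrap \<rho> r \<xi> (Suc t)"
proof -
  have "card H \<le> card (nbhd_h \<rho> x \<inter> bootstrap \<rho> r \<xi> t)"
    "card V \<le> card (nbhd_v \<rho> x \<inter> bootstrap \<rho> r \<xi> t)"
    using H V by (auto intro!: card_mono simp: finite_nbhd)
  with assms(4) have "r \<le> card (nbhd_h \<rho> x \<inter> bootstrap \<rho> r \<xi> t) + card (nbhd_v \<rho> x \<inter> bootstrap \<rho> r \<xi> t)"
    by linarith
  then show ?thesis
    using notin_bootstrap_zero_set[OF assms(1)] by simp
qed

lemma mem_nbhd_h: "(a, b) \<in> nbhd_h \<rho> (c, d) \<longleftrightarrow> b = d \<and> \<bar>a - c\<bar> \<le> int \<rho>"
  unfolding nbhd_h_def image_def by (auto intro!: bexI[of _ "a - c"])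

lemma mem_nbhd_v: "(a, b) \<in> nbhd_v \<rho> (c, d) \<longleftrightarrow> a = c \<and> \<bar>b - d\<bar> \<le> int \<rho>"
  unfolding nbhd_v_def image_def by (auto intro!: bexI[of _ "b - d"])

text \<open>The site sees \<open>i\<close> occupied sites below it and \<open>r - i\<close> occupied
  sites of its own row on the side \<open>d\<close>, altogether \<open>r\<close>. All of them are
  within range because \<open>r \<le> \<rho>\<close>.\<close>

lemma bootstrap_row_extend:
  assumes "r \<le> \<rho>" "i < r"
    and below: "\<And>j. j < i \<Longrightarrow> (x, y + int j) \<in> bootstrap \<rho> r \<xi> t"
    and side: "\<And>j. j < r - i \<Longrightarrow> (x + d * (int j + 1), y + int i) \<in> bootstrap \<rho> r \<xi> t" "\<bar>d\<bar> = 1"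
  shows "(x, y + int i) \<in> bootstrap \<rho> r \<xi> (Suc t)"
proof (rule bootstrap_SucI)
  let ?H = "(\<lambda>j. (x + d * (int j + 1), y + int i)) ` {..<r - i}"
  let ?V = "(\<lambda>j. (x, y + int j)) ` {..<i}"
  have d: "d = 1 \<or> d = -1" using side(2) by linarith
  show "?H \<subseteq> nbhd_h \<rho> (x, y + int i) \<inter> bootstrap \<rho> r \<xi> t"
  proof (intro image_subsetI IntI)
    fix j assume j: "j \<in> {..<r - i}"
    then have "int j + 1 \<le> int \<rho>" using assms(1) by simp
    then show "(x + d * (int j + 1), y + int i) \<in> nbhd_h \<rho> (x, y + int i)"
      using d unfolding mem_nbhd_h by auto
    show "(x + d * (int j + 1), y + int i) \<in> bootstrap \<rho> r \<xi> t"
      using j by (intro side(1)) simp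
  qed
  show "?V \<subseteq> nbhd_v \<rho> (x, y + int i) \<inter> bootstrap \<rho> r \<xi> t"
    using assms(1,2) below by (auto simp: mem_nbhd_v)
  have "card ?H = r - i" using d by (subst card_image) (auto simp: inj_on_def)
  moreover have "card ?V = i" by (subst card_image) (auto simp: inj_on_def)
  ultimately show "r \<le> card ?H + card ?V" by simp
qed (use assms in simp)

text \<open>Above \<open>i\<close> filled rows, an occupied segment of \<open>r - i\<close> sites
  grows by one site per step at either end, so \<open>t\<close> steps fill the row from 0 to
  \<open>t\<close>.\<close>

lemma bootstrap_row_fill:
  assumes "r \<le> \<rho>" "i < r"
    and below: "\<And>x j. 0 \<le> x \<Longrightarrow> x \<le> int t \<Longrightarrow> j < i \<Longrightarrow> (x, y + int j) \<in> bootstrap \<rho> r \<xi> s"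
    and seg: "0 \<le> z" "z + int (r - i) \<le> int t + 1"
      "\<And>x. z \<le> x \<Longrightarrow> x < z + int (r - i) \<Longrightarrow> (x, y + int i) \<in> bootstrap \<rho> r \<xi> s"
    and x: "0 \<le> x" "x \<le> int t"
  shows "(x, y + int i) \<in> bootstrap \<rho> r \<xi> (s + t)"
proof -
  define w where "w = int (r - i)"
  have wpos: "w > 0" using assms(2) by (simp add: w_def)
  \<comment> \<open>After \<open>k\<close> more steps the segment has grown by \<open>k\<close> on
    both sides, up to clipping at 0 and \<open>t\<close>. The initial segment lies within these
    limits, so clipping never leaves fewer than \<open>r - i\<close> sites.\<close>
  have "(x, y + int i) \<in> bootstrap \<rho> r \<xi> (s + k)"
    if "0 \<le> x" "x \<le> int t" "z - int k \<le> x" "x < z + int (r - i) + int k" for k x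
    using that
  proof (induction k arbitrary: x)
    case 0
    then show ?case using seg(3) by simp
  next
    case (Suc k)
    note IH = Suc.IH
    have below': "(x, y + int j) \<in> bootstrap \<rho> r \<xi> (s + k)" if "j < i" for j
      using below[OF Suc.prems(1,2) that] occupied_mono[of s "s + k"] by auto
    consider "z - int k \<le> x" "x < z + int (r - i) + int k" | "x = z - int k - 1"
      | "x = z + int (r - i) + int k"
      using Suc.prems by linarith
    then show ?case
    proof cases
      case 1
      then have "(x, y + int i) \<in> bootstrap \<rho> r \<xi> (s + k)"
        using Suc.prems by (intro IH)
      then show ?thesis by simp
    next
      case 2
      \<comment> \<open>The new left end relies on the sites to its right; the new right end below
        relies on those to its left, hence \<open>d = -1\<close> there.\<close>
      have "(x, y + int i) \<in> bootstrap \<rho> r \<xi> (Suc (s + k))"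
      proof (rule bootstrap_row_extend[OF assms(1,2) below', where d = 1])
        fix j assume "j < r - i"
        then have "int j + 1 \<le> w" unfolding w_def by linarith
        moreover have "0 \<le> int j" "0 \<le> int k" by simp_all
        moreover note 2 Suc.prems seg(1,2) wpos
        ultimately have "0 \<le> x + 1 * (int j + 1)" "x + 1 * (int j + 1) \<le> int t"
          "z - int k \<le> x + 1 * (int j + 1)" "x + 1 * (int j + 1) < z + int (r - i) + int k"
          unfolding w_def[symmetric] of_nat_Suc mult_1 mult_minus1 by linarith+
        then show "(x + 1 * (int j + 1), y + int i) \<in> bootstrap \<rho> r \<xi> (s + k)"
          by (rule IH)
      qed auto
      then show ?thesis by simp
    next
      case 3
      have "(x, y + int i) \<in> bootstrap \<rho> r \<xi> (Suc (s + k))"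
      proof (rule bootstrap_row_extend[OF assms(1,2) below', where d = "-1"])
        fix j assume "j < r - i"
        then have "int j + 1 \<le> w" unfolding w_def by linarith
        moreover have "0 \<le> int j" "0 \<le> int k" by simp_all
        moreover note 3 Suc.prems seg(1,2) wpos
        ultimately have "0 \<le> x + - 1 * (int j + 1)" "x + - 1 * (int j + 1) \<le> int t"
          "z - int k \<le> x + - 1 * (int j + 1)" "x + - 1 * (int j + 1) < z + int (r - i) + int k"
          unfolding w_def[symmetric] of_nat_Suc mult_1 mult_minus1 by linarith+
        then show "(x + - 1 * (int j + 1), y + int i) \<in> bootstrap \<rho> r \<xi> (s + k)"
          by (rule IH)
      qed auto
      then show ?thesis by simp
    qed
  qed
  from this[of x t] show ?thesis using x seg(1,2) assms(2) by linarith
qed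

text \<open>The \<open>r\<close> rows fill one after the other, \<open>t\<close> steps each. Then
  \<open>r\<close> consecutive occupied sites in the column through the origin occupy the next site
  below them at each step, which takes \<open>y\<close> further steps.\<close>

lemma bootstrap_nucleus_reaches_origin:
  assumes "1 \<le> r" "r \<le> \<rho>" "0 \<le> y"
    and seg: "\<And>i. i < r \<Longrightarrow> \<exists>z\<ge>0. z + int (r - i) \<le> int t + 1 \<and>
       (\<forall>x. z \<le> x \<and> x < z + int (r - i) \<longrightarrow> (x, y + int i) \<in> \<xi>)"
  shows "(0, 0) \<in> bootstrap \<rho> r \<xi> (r * t + nat y)"
proof -
  have rows: "(x, y + int j) \<in> bootstrap \<rho> r \<xi> (i * t)"
    if "i \<le> r" "0 \<le> x" "x \<le> int t" "j < i" for i x j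
    using that
  proof (induction i arbitrary: x j)
    case (Suc i)
    have mono: "bootstrap \<rho> r \<xi> u \<subseteq> bootstrap \<rho> r \<xi> (u + v)" for u v
      by (rule occupied_mono) simp
    have IH: "(x, y + int j) \<in> bootstrap \<rho> r \<xi> (i * t)" if "0 \<le> x" "x \<le> int t" "j < i" for x j
      using that Suc.prems(1) by (intro Suc.IH) simp_all
    show ?case
    proof (cases "j < i")
      case True
      then show ?thesis
        using IH[OF Suc.prems(2,3)] mono[of "i * t" t] by (auto simp: add.commute)
    next
      case False
      then have j: "j = i" "i < r" using Suc.prems by auto
      obtain z where z: "z \<ge> 0" "z + int (r - i) \<le> int t + 1"
        "\<forall>x. z \<le> x \<and> x < z + int (r - i) \<longrightarrow> (x, y + int i) \<in> \<xi>"
        using seg[OF j(2)] by blast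
      have "(x, y + int i) \<in> bootstrap \<rho> r \<xi> (i * t + t)"
      proof (rule bootstrap_row_fill[OF assms(2) j(2) IH z(1,2)])
        fix x assume "z \<le> x" "x < z + int (r - i)"
        then have "(x, y + int i) \<in> bootstrap \<rho> r \<xi> 0" using z(3) by simp
        then show "(x, y + int i) \<in> bootstrap \<rho> r \<xi> (i * t)" using mono[of 0 "i * t"] by auto
      qed (use Suc.prems in auto)
      then show ?thesis using j by (simp add: add.commute)
    qed
  qed simp
  \<comment> \<open>Only the column with first coordinate 0 matters from here on: \<open>k\<close>
    steps after the rows are full, it is occupied from height \<open>y - k\<close> to the top
    row.\<close>
  have col: "(0, y + l) \<in> bootstrap \<rho> r \<xi> (r * t + k)" if "- int k \<le> l" "l < int r" for k l
    using that
  proof (induction k arbitrary: l)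
    case 0
    then show ?case using rows[of r 0 "nat l"] by simp
  next
    case (Suc k)
    show ?case
    proof (cases "- int k \<le> l")
      case True
      then have "(0, y + l) \<in> bootstrap \<rho> r \<xi> (r * t + k)" using Suc by simp
      then show ?thesis by simp
    next
      case False
      then have l: "l = - int k - 1" using Suc.prems by simp
      let ?V = "(\<lambda>j. (0::int, y + l + 1 + int j)) ` {..<r}"
      have "(0, y + l) \<in> bootstrap \<rho> r \<xi> (Suc (r * t + k))"
      proof (rule bootstrap_SucI[OF assms(1), of "{}" _ _ _ _ ?V])
        show "?V \<subseteq> nbhd_v \<rho> (0, y + l) \<inter> bootstrap \<rho> r \<xi> (r * t + k)"
        proof (intro image_subsetI IntI)
          fix j assume j: "j \<in> {..<r}"
          then show "(0, y + l + 1 + int j) \<in> nbhd_v \<rho> (0, y + l)"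
            using assms(2) unfolding mem_nbhd_v by auto
          have "(0, y + (l + 1 + int j)) \<in> bootstrap \<rho> r \<xi> (r * t + k)"
            using j l by (intro Suc.IH) auto
          then show "(0, y + l + 1 + int j) \<in> bootstrap \<rho> r \<xi> (r * t + k)"
            by (simp add: add.assoc)
        qed
        have "card ?V = r" by (subst card_image) (auto simp: inj_on_def)
        then show "r \<le> card ({} :: (int \<times> int) set) + card ?V" by simp
      qed simp
      then show ?thesis by simp
    qed
  qed
  from col[of "nat y" "- y"] show ?thesis using assms by simp
qed

section \<open>The hitting time and occupation at a fixed time\<close>

lemma hitting_time_le:
  assumes "(0, 0) \<in> occupied \<rho> Z {x. \<omega> x} t"
  shows "hitting_time \<rho> Z \<omega> \<le> of_nat t"
proof -
  have "(INF t\<in>{t. (0, 0) \<in> occupied \<rho> Z {x. \<omega> x} t}. enat t) \<le> enat t"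
    using assms by (intro INF_lower) simp
  then have "hitting_time \<rho> Z \<omega> \<le> ennreal_of_enat (enat t)"
    unfolding hitting_time_def by (simp only: ennreal_of_enat_le_iff)
  then show ?thesis by (simp add: ennreal_of_nat_eq_real_of_nat)
qed

lemma hitting_time_leD:
  assumes "hitting_time \<rho> Z \<omega> \<le> ennreal c"
  shows "(0, 0) \<in> occupied \<rho> Z {x. \<omega> x} (nat \<lfloor>c\<rfloor>)"
proof -
  let ?S = "{t. (0, 0) \<in> occupied \<rho> Z {x. \<omega> x} t}"
  have "?S \<noteq> {}"
  proof
    assume "?S = {}"
    then have "hitting_time \<rho> Z \<omega> = \<infinity>"
      unfolding hitting_time_def by (simp add: top_enat_def)
    then show False using assms by (simp add: top_unique)
  qed
  then obtain k where "k \<in> ?S" by blast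
  then have "(INF t\<in>?S. enat t) \<in> enat ` ?S"
    by (intro wellorder_InfI[of "enat k"] imageI)
  then obtain t where t: "t \<in> ?S" "(INF t\<in>?S. enat t) = enat t" by auto
  then have "of_nat t \<le> ennreal c"
    using assms unfolding hitting_time_def by simp
  then have "t \<le> nat \<lfloor>c\<rfloor>"
  proof (cases "0 \<le> c")
    case True
    then have "real t \<le> c" using \<open>of_nat t \<le> ennreal c\<close>
      by (simp add: ennreal_of_nat_eq_real_of_nat)
    then show ?thesis by linarith
  next
    \<comment> \<open>For negative \<open>c\<close> both \<open>ennreal c\<close> and
      \<open>nat \<lfloor>c\<rfloor>\<close> are 0.\<close>
    case False
    then have "t = 0" using \<open>of_nat t \<le> ennreal c\<close> by (simp add: ennreal_neg)
    then show ?thesis by simp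
  qed
  then show ?thesis using t(1) occupied_mono[of t "nat \<lfloor>c\<rfloor>"] by blast
qed

section \<open>Upper bound on the hitting time\<close>

lemma prob_hitting_time_gt_le:
  fixes t :: nat
  assumes "1 \<le> r" "r \<le> \<rho>" "0 \<le> p" "p \<le> 1"
  defines "B \<equiv> t div r"
  shows "measure (initial_measure p) {\<omega>. of_nat (r * t + t) < hitting_time \<rho> (bootstrap_zero_set r) \<omega>}
    \<le> (1 - (\<Prod>i<r. 1 - (1 - p ^ (r - i)) ^ B)) ^ B"
proof -
  interpret prob_space "initial_measure p" by (rule prob_space_initial_measure)
  \<comment> \<open>The first \<open>r - i\<close> sites of the \<beta>-th block in row
    \<open>i\<close> of strip \<open>s\<close>. All three indices can be read off a site by division
    by \<open>r\<close>, which makes these sets disjoint.\<close>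
  define K where "K = (\<lambda>s i \<beta>. (\<lambda>x. (int x, int (r * s + i))) ` {r * \<beta>..<r * \<beta> + (r - i)})"
  have K: "finite (K s i \<beta>)" "card (K s i \<beta>) = r - i" for s i \<beta>
    unfolding K_def by (auto simp: card_image inj_on_def)
  have disj: "s = s' \<and> i = i' \<and> \<beta> = \<beta>'"
    if i: "i \<in> {..<r}" "i' \<in> {..<r}" and ne: "K s i \<beta> \<inter> K s' i' \<beta>' \<noteq> {}" for s i \<beta> s' i' \<beta>'
  proof -
    obtain u where u: "u \<in> K s i \<beta>" "u \<in> K s' i' \<beta>'" using ne by blast
    obtain x where x: "r * \<beta> \<le> x" "x < r * \<beta> + (r - i)" and ux: "u = (int x, int (r * s + i))"
      using u(1) unfolding K_def image_iff by (metis atLeastLessThan_iff)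
    obtain x' where x': "r * \<beta>' \<le> x'" "x' < r * \<beta>' + (r - i')" and ux': "u = (int x', int (r * s' + i'))"
      using u(2) unfolding K_def image_iff by (metis atLeastLessThan_iff)
    have "int x = int x'" "int (r * s + i) = int (r * s' + i')" using ux ux' by simp_all
    then have xx: "x' = x" and y: "r * s + i = r * s' + i'" by (simp_all only: of_nat_eq_iff)
    have "(r * s + i) div r = s" "(r * s' + i') div r = s'"
      "(r * s + i) mod r = i" "(r * s' + i') mod r = i'"
      using i by simp_all
    then have "s = s'" "i = i'" using y by metis+
    moreover have "x div r = \<beta>"
      using x(1,2) by (intro div_nat_eqI) (auto simp: algebra_simps)
    moreover have "x div r = \<beta>'"
      using x' unfolding xx by (intro div_nat_eqI) (auto simp: algebra_simps)
    ultimately show ?thesis by blast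
  qed
  let ?bad = "{\<omega>. \<forall>s\<in>{..<B}. \<not> (\<forall>i\<in>{..<r}. \<exists>\<beta>\<in>{..<B}. \<forall>x\<in>K s i \<beta>. \<omega> x)}"
  have rB: "r * b + r \<le> t" if "b < B" for b
  proof -
    have "r * b + r = r * Suc b" by simp
    also have "\<dots> \<le> r * B" using that by (intro mult_left_mono) auto
    also have "\<dots> \<le> t" unfolding B_def by simp
    finally show ?thesis .
  qed
  have sub: "{\<omega>. of_nat (r * t + t) < hitting_time \<rho> (bootstrap_zero_set r) \<omega>} \<subseteq> ?bad"
  proof (intro subsetI, rule ccontr)
    fix \<omega> assume gt: "\<omega> \<in> {\<omega>. of_nat (r * t + t) < hitting_time \<rho> (bootstrap_zero_set r) \<omega>}"
      and "\<omega> \<notin> ?bad"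
    then obtain s where s: "s < B" and good: "\<And>i. i < r \<Longrightarrow> \<exists>\<beta>\<in>{..<B}. \<forall>x\<in>K s i \<beta>. \<omega> x"
      by blast
    have "(0, 0) \<in> bootstrap \<rho> r {x. \<omega> x} (r * t + nat (int (r * s)))"
    proof (rule bootstrap_nucleus_reaches_origin[OF assms(1,2)])
      fix i assume i: "i < r"
      then obtain \<beta> where \<beta>: "\<beta> < B" "\<forall>x\<in>K s i \<beta>. \<omega> x" using good[OF i] by auto
      show "\<exists>z\<ge>0. z + int (r - i) \<le> int t + 1 \<and>
        (\<forall>x. z \<le> x \<and> x < z + int (r - i) \<longrightarrow> (x, int (r * s) + int i) \<in> {x. \<omega> x})"
      proof (intro exI[of _ "int (r * \<beta>)"] conjI allI impI)
        have "int (r * \<beta> + (r - i)) \<le> int t"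
          using rB[OF \<beta>(1)] by (intro of_nat_mono) simp
        then show "int (r * \<beta>) + int (r - i) \<le> int t + 1" by (simp only: of_nat_add)
        fix x assume x: "int (r * \<beta>) \<le> x \<and> x < int (r * \<beta>) + int (r - i)"
        have "0 \<le> x" using x of_nat_0_le_iff[of "r * \<beta>"] by linarith
        then obtain n where n: "x = int n" by (rule nonneg_int_cases)
        have "int (r * \<beta>) \<le> int n" "int n < int (r * \<beta> + (r - i))"
          using x unfolding n of_nat_add by blast+
        then have "n \<in> {r * \<beta>..<r * \<beta> + (r - i)}"
          unfolding of_nat_le_iff of_nat_less_iff atLeastLessThan_iff by blast
        moreover have "(x, int (r * s) + int i) = (\<lambda>x. (int x, int (r * s + i))) n"
          by (simp add: n)
        ultimately have "(x, int (r * s) + int i) \<in> K s i \<beta>"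
          unfolding K_def by (intro image_eqI)
        then show "(x, int (r * s) + int i) \<in> {x. \<omega> x}" using \<beta>(2) by simp
      qed simp
    qed simp
    \<comment> \<open>Filling the rows takes \<open>r * t\<close> steps, and the descent from height
      \<open>r * s\<close> at most \<open>t\<close>.\<close>
    then have "hitting_time \<rho> (bootstrap_zero_set r) \<omega> \<le> of_nat (r * t + r * s)"
      unfolding nat_int by (rule hitting_time_le)
    also have "\<dots> \<le> of_nat (r * t + t)"
      using rB[OF s] by (intro of_nat_mono) simp
    finally show False using gt by simp
  qed
  have "?bad \<in> sets (initial_measure p)"
  proof (rule determined_by_sets)
    let ?L = "\<Union>s\<in>{..<B}. \<Union>i\<in>{..<r}. \<Union>\<beta>\<in>{..<B}. K s i \<beta>"
    show "finite ?L" using K(1) by blast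
    show "determined_by ?bad ?L"
      unfolding determined_by_def
    proof (intro allI impI)
      fix \<omega> \<omega>' :: "int \<times> int \<Rightarrow> bool" assume eq: "\<forall>x\<in>?L. \<omega> x = \<omega>' x"
      show "\<omega> \<in> ?bad \<longleftrightarrow> \<omega>' \<in> ?bad"
        unfolding mem_Collect_eq by (intro ball_cong bex_cong refl arg_cong[where f = Not])
          (use eq in blast)
    qed
  qed
  then have "measure (initial_measure p) {\<omega>. of_nat (r * t + t) < hitting_time \<rho> (bootstrap_zero_set r) \<omega>}
    \<le> measure (initial_measure p) ?bad"
    using sub by (intro finite_measure_mono) auto
  also have "\<dots> = (1 - (\<Prod>i\<in>{..<r}. 1 - (1 - p ^ (r - i)) ^ card {..<B})) ^ card {..<B}"
    by (rule prob_nested_grid[OF _ _ _ K disj assms(3,4)]) simp_all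
  finally show ?thesis by simp
qed

section \<open>Elementary estimates for powers of \<open>1 - x\<close>\<close>

lemma one_minus_power_le_exp:
  fixes x :: real
  assumes "0 \<le> x" "x \<le> 1"
  shows "(1 - x) ^ n \<le> exp (- (real n * x))"
proof -
  have "(1 - x) ^ n \<le> exp (- x) ^ n"
    using assms exp_ge_add_one_self[of "- x"] by (intro power_mono) auto
  then show ?thesis by (simp add: exp_of_nat_mult[symmetric])
qed

text \<open>The right-hand side is the probability that one of \<open>n\<close> independent events
  of probability \<open>x\<close> occurs. Up to the factor 2 it is at least any number in the unit
  interval below the expected number of occurrences.\<close>

lemma one_minus_power_ge:
  fixes x y :: real
  assumes "0 \<le> x" "x \<le> 1" "0 \<le> y" "y \<le> 1" "y \<le> real n * x"
  shows "y / 2 \<le> 1 - (1 - x) ^ n"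
proof -
  have "(1 - x) ^ n \<le> exp (- (real n * x))"
    using assms by (intro one_minus_power_le_exp)
  also have "\<dots> \<le> exp (- y)" using assms by simp
  also have "\<dots> \<le> 1 / (1 + y)"
    using assms exp_ge_add_one_self[of y] by (simp add: exp_minus field_simps)
  also have "\<dots> \<le> 1 - y / 2"
    using assms mult_left_mono[of y 1 y] by (simp add: field_simps)
  finally show ?thesis by simp
qed

text \<open>The ceiling formula is replaced by two polynomial inequalities: \<open>m_ge\<close> says
  that \<open>m\<close> satisfies \<open>(m + 1) * (m + 4) \<ge> 2 * r\<close>, and
  \<open>m_less\<close> is the failure of the same inequality for \<open>m - 1\<close>.\<close>

locale critical_exponent =
  fixes r \<rho> m :: nat and \<gamma> :: real
  assumes r_pos: "1 \<le> r" and r_le: "r \<le> \<rho>"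
    and m_less: "m * (m + 3) < 2 * r" and m_ge: "2 * r \<le> (m + 1) * (m + 4)"
    and \<gamma>_eq: "\<gamma> = (real m + 1) * (2 * real r - real m) / (2 * (real m + 2))"
begin

section \<open>Arithmetic of the exponent\<close>

lemma m_less_r: "m < r"
proof -
  have "2 * m \<le> m * (m + 3)" by (simp add: algebra_simps)
  then show ?thesis using m_less by linarith
qed

lemma \<gamma>_mult: "2 * (real m + 2) * \<gamma> = (real m + 1) * (2 * real r - real m)"
  unfolding \<gamma>_eq by (simp add: field_simps)

text \<open>Clearing the denominator turns this into \<open>m_less\<close>. It says that a block of
  \<open>r - i\<close> occupied sites with \<open>i \<le> m\<close> is rare in a row of length of
  order \<open>p powr - \<gamma>\<close>.\<close>

lemma \<gamma>_less: "\<gamma> < real r - real m"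
proof -
  have "real (m * (m + 3)) < real (2 * r)" using m_less by (simp only: of_nat_less_iff)
  then have "(real m + 1) * (2 * real r - real m) < 2 * (real m + 2) * (real r - real m)"
    by (simp add: algebra_simps)
  then show ?thesis unfolding \<gamma>_mult[symmetric] by (simp add: mult_less_cancel_left)
qed

text \<open>Clearing the denominator turns this into \<open>m_ge\<close>. It says that the blocks
  needed in the rows after the \<open>m\<close>-th are not rare at that scale.\<close>

lemma \<gamma>_ge: "real r - real m - 1 \<le> \<gamma>"
proof -
  have "real (2 * r) \<le> real ((m + 1) * (m + 4))" using m_ge by (simp only: of_nat_le_iff)
  then have "2 * (real m + 2) * (real r - real m - 1) \<le> (real m + 1) * (2 * real r - real m)"
    by (simp add: algebra_simps)
  then show ?thesis unfolding \<gamma>_mult[symmetric] by (simp add: mult_le_cancel_left)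
qed

lemma \<gamma>_pos: "0 < \<gamma>"
  unfolding \<gamma>_eq using m_less_r by (intro divide_pos_pos mult_pos_pos) auto

text \<open>As \<open>m * (m + 3)\<close> is even, \<open>m_less\<close> improves to
  \<open>m * (m + 3) + 2 \<le> 2 * r\<close>, and \<open>\<gamma>_ge\<close> then gives
  \<open>m * (m + 1) / 2 \<le> \<gamma>\<close>. The lower bound multiplies an upper bound on the
  number of clusters by \<open>\<gamma> - m\<close>.\<close>

lemma \<gamma>_ge_m: "real m \<le> \<gamma>"
proof (cases "m = 0")
  case True
  then show ?thesis using \<gamma>_pos by simp
next
  case False
  have "even (m * (m + 3))" by simp
  then obtain q where q: "m * (m + 3) = 2 * q" by (rule evenE)
  then have "q + 1 \<le> r" using m_less by simp
  then have "real (m * (m + 3)) + 2 \<le> 2 * real r" unfolding q by simp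
  moreover have "real m * 1 \<le> real m * real m" using False by (intro mult_left_mono) auto
  ultimately show ?thesis using \<gamma>_ge by (simp add: algebra_simps)
qed

text \<open>The balance that determines \<gamma>: \<open>m + 1\<close> horizontal positions and one
  vertical position, each with of order \<open>p powr - \<gamma>\<close> choices, pay for the sites
  required in the \<open>m + 1\<close> rare rows.\<close>

lemma sum_exponents: "(\<Sum>i\<le>m. real (r - i)) = (real m + 2) * \<gamma>"
proof -
  have "(\<Sum>i\<le>m. real (r - i)) = (\<Sum>i\<le>m. real r - real i)"
    using m_less_r by (intro sum.cong refl) (simp add: of_nat_diff)
  also have "\<dots> = (real m + 1) * real r - (\<Sum>i\<le>m. real i)"
    by (simp add: sum_subtractf)
  also have "(\<Sum>i\<le>m. real i) = real m * (real m + 1) / 2"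
    by (induction m) (auto simp: field_simps)
  finally show ?thesis using \<gamma>_mult by (simp add: field_simps)
qed

text \<open>With \<open>q\<close> the probability that a strip is good, all \<open>B\<close> strips
  fail with probability at most \<open>exp (- B * q)\<close>, and \<open>B * q\<close> is at least
  \<open>c * L\<close>. The constant \<open>c\<close> does not depend on \<open>L\<close>; the range
  of admissible \<open>p\<close> may.\<close>

lemma prob_hitting_time_ge_le:
  "\<exists>c>0. \<forall>L\<ge>1. \<forall>\<^sub>F p in at_right 0.
     measure (initial_measure p) {\<omega>. ennreal (L * p powr - \<gamma>) \<le> hitting_time \<rho> (bootstrap_zero_set r) \<omega>}
       \<le> exp (- c * L)"
proof -
  \<comment> \<open>Chosen so that \<open>u / (2 * r)\<close>, with the side length
    \<open>u = L * a / (4 * r)\<close> below, equals \<open>\<kappa> * L * a\<close>.\<close>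
  define \<kappa> where "\<kappa> = 1 / (8 * (real r)\<^sup>2)"
  have r1: "1 \<le> real r" using r_pos by simp
  have "1 \<le> 8 * (real r)\<^sup>2" using one_le_power[OF r1, of 2] by linarith
  then have \<kappa>: "0 < \<kappa>" "\<kappa> \<le> 1" unfolding \<kappa>_def divide_le_eq_1 zero_less_divide_1_iff by linarith+
  define c where "c = \<kappa> * (\<kappa> / 2) ^ r"
  have c: "c > 0" using \<kappa> by (simp add: c_def)
  have main: "\<forall>\<^sub>F p in at_right 0.
     measure (initial_measure p) {\<omega>. ennreal (L * p powr - \<gamma>) \<le> hitting_time \<rho> (bootstrap_zero_set r) \<omega>}
       \<le> exp (- c * L)" if L: "1 \<le> L" for L
  proof -
    have "LIM p at_right 0. p powr - \<gamma> :> at_top"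
      using \<gamma>_pos by real_asymp
    \<comment> \<open>This threshold makes \<open>u\<close> at least \<open>4 * r\<close>, so that
      the two roundings, of \<open>u\<close> to \<open>t\<close> and of \<open>t / r\<close> to
      \<open>B\<close>, cost no more than half of \<open>u / r\<close>.\<close>
    then have e1: "\<forall>\<^sub>F p in at_right 0. 16 * (real r)\<^sup>2 \<le> p powr - \<gamma>"
      by (simp add: filterlim_at_top)
    have e2: "\<forall>\<^sub>F p in at_right 0. \<kappa> * L * p powr (real (r - i) - \<gamma>) \<le> 1" if "i \<le> m" for i
    proof -
      have "real (r - i) - \<gamma> > 0" using that \<gamma>_less m_less_r by (simp add: of_nat_diff)
      then have "((\<lambda>p. \<kappa> * L * p powr (real (r - i) - \<gamma>)) \<longlongrightarrow> 0) (at_right 0)"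
        by real_asymp
      then have "\<forall>\<^sub>F p in at_right 0. \<kappa> * L * p powr (real (r - i) - \<gamma>) < 1"
        by (rule order_tendstoD) simp
      then show ?thesis by eventually_elim simp
    qed
    have e2': "\<forall>\<^sub>F p in at_right 0. \<forall>i\<in>{..m}. \<kappa> * L * p powr (real (r - i) - \<gamma>) \<le> 1"
      using e2 by (intro eventually_ball_finite) auto
    have e3: "\<forall>\<^sub>F p :: real in at_right 0. 0 < p \<and> p < 1"
      by (auto simp: eventually_at_right[of 0 1] intro!: exI[of _ 1])
    show ?thesis using e1 e2' e3
    proof eventually_elim
      case (elim p)
      then have p: "0 < p" "p < 1" by auto
      define a where "a = p powr - \<gamma>"
      have a: "16 * (real r)\<^sup>2 \<le> a" using elim by (simp add: a_def)
      have a0: "0 < a" using p by (simp add: a_def)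
      \<comment> \<open>The factor \<open>1 / (4 * r)\<close> leaves room in time:
        \<open>r * t + t\<close> is at most \<open>2 * r * u\<close>, which is half of
        \<open>L * a\<close>.\<close>
      define u where "u = L * a / (4 * real r)"
      define t where "t = nat \<lfloor>u\<rfloor>"
      define B where "B = t div r"
      have u0: "0 < u" using a0 L r1 by (simp add: u_def)
      have t: "real t \<le> u" "u < real t + 1" using u0 unfolding t_def by linarith+
      have la: "a \<le> L * a" using L a0 by simp
      have "16 * (real r)\<^sup>2 \<le> L * a" using a la by linarith
      then have u4: "4 * real r \<le> u" using r1 by (simp add: u_def field_simps power2_eq_square)
      have "u / (2 * real r) \<le> real B"
      proof -
        have "real t / real r < real B + 1"
        proof -
          have "t < r * Suc B" unfolding B_def using r_pos by (simp add: dividend_less_times_div)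
          then have "real t < real r * (real B + 1)"
            by (metis of_nat_Suc of_nat_less_iff of_nat_mult add.commute)
          then show ?thesis using r1 by (simp add: field_simps)
        qed
        moreover have "u / real r \<le> real t / real r + 1"
          using t r1 by (simp add: field_simps)
        moreover have "2 \<le> u / (2 * real r)" using u4 r1 by (simp add: field_simps)
        moreover have "u / real r = u / (2 * real r) + u / (2 * real r)" using r1 by (simp add: field_simps)
        ultimately show ?thesis by linarith
      qed
      moreover have "u / (2 * real r) = \<kappa> * L * a"
        by (simp add: u_def \<kappa>_def power2_eq_square)
      ultimately have B: "\<kappa> * L * a \<le> real B" by simp
      have Bx: "\<kappa> * L * p powr (real (r - i) - \<gamma>) \<le> real B * p ^ (r - i)" for i
      proof -
        have "p powr (real (r - i) - \<gamma>) = a * p ^ (r - i)"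
          using p by (simp add: a_def powr_diff powr_realpow powr_minus divide_inverse)
        then have "\<kappa> * L * p powr (real (r - i) - \<gamma>) = (\<kappa> * L * a) * p ^ (r - i)" by simp
        also have "\<dots> \<le> real B * p ^ (r - i)" using B p by (intro mult_right_mono) auto
        finally show ?thesis .
      qed
      \<comment> \<open>A lower bound within the unit interval for the expected number of good
        blocks in row \<open>i\<close>. For \<open>i \<le> m\<close> it tends to 0 with
        \<open>p\<close>; for the other rows \<open>\<gamma>_ge\<close> makes the power of
        \<open>p\<close> at least 1 and the constant \<kappa> suffices.\<close>
      define w where "w = (\<lambda>i. if i \<le> m then \<kappa> * L * p powr (real (r - i) - \<gamma>) else \<kappa>)"
      have w: "0 \<le> w i" "w i \<le> 1" "w i \<le> real B * p ^ (r - i)" if "i < r" for i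
      proof -
        show "0 \<le> w i" using \<kappa> L by (simp add: w_def)
        show "w i \<le> 1" using \<kappa> elim by (simp add: w_def)
        show "w i \<le> real B * p ^ (r - i)"
        proof (cases "i \<le> m")
          case True
          then show ?thesis using Bx[of i] by (simp add: w_def)
        next
          case False
          then have "real (r - i) - \<gamma> \<le> 0" using \<gamma>_ge that by (simp add: of_nat_diff)
          then have "1 \<le> p powr (real (r - i) - \<gamma>)"
            using p powr_mono'[of "real (r - i) - \<gamma>" 0 p] by simp
          then have "1 * 1 \<le> L * p powr (real (r - i) - \<gamma>)"
            using L by (intro mult_mono) auto
          then have "\<kappa> * 1 \<le> \<kappa> * (L * p powr (real (r - i) - \<gamma>))"
            using \<kappa> by (intro mult_left_mono) auto
          then show ?thesis using Bx[of i] False by (simp add: w_def mult.assoc)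
        qed
      qed
      define q where "q = (\<Prod>i<r. 1 - (1 - p ^ (r - i)) ^ B)"
      have pw: "0 \<le> p ^ k" "p ^ k \<le> 1" for k using p by (auto simp: power_le_one)
      have "(\<Prod>i<r. w i / 2) \<le> q"
        unfolding q_def using w pw by (intro prod_mono conjI one_minus_power_ge) auto
      moreover have "(\<Prod>i<r. w i / 2) \<ge> (\<kappa> / 2) ^ r * (L ^ (m + 1) * p powr \<gamma>)"
      proof -
        have "(\<Prod>i<r. w i / 2) = (\<Prod>i<r. \<kappa> / 2 * (if i \<le> m then L * p powr (real (r - i) - \<gamma>) else 1))"
          by (intro prod.cong) (auto simp: w_def)
        also have "\<dots> = (\<kappa> / 2) ^ r * (\<Prod>i<r. if i \<le> m then L * p powr (real (r - i) - \<gamma>) else 1)"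
          unfolding prod.distrib prod_constant card_lessThan by (rule refl)
        also have "(\<Prod>i<r. if i \<le> m then L * p powr (real (r - i) - \<gamma>) else 1)
            = (\<Prod>i\<le>m. L * p powr (real (r - i) - \<gamma>))"
          using m_less_r by (intro prod.mono_neutral_cong_right) auto
        also have "\<dots> = L ^ (m + 1) * (\<Prod>i\<le>m. p powr (real (r - i) - \<gamma>))"
          by (simp add: prod.distrib)
        also have "(\<Prod>i\<le>m. p powr (real (r - i) - \<gamma>)) = p powr (\<Sum>i\<le>m. real (r - i) - \<gamma>)"
          using p by (simp add: powr_sum)
        \<comment> \<open>The exponents add up to
          \<open>(m + 2) * \<gamma> - (m + 1) * \<gamma>\<close>.\<close>
        also have "(\<Sum>i\<le>m. real (r - i) - \<gamma>) = \<gamma>"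
          using sum_exponents by (simp add: sum_subtractf algebra_simps)
        finally show ?thesis by simp
      qed
      ultimately have q: "(\<kappa> / 2) ^ r * (L ^ (m + 1) * p powr \<gamma>) \<le> q" by linarith
      \<comment> \<open>The powers of \<open>p\<close> in \<open>B\<close> and in \<open>q\<close>
        cancel, leaving \<open>c\<close> times the power \<open>m + 2\<close> of \<open>L\<close>;
        since \<open>L \<ge> 1\<close>, a single factor \<open>L\<close> is enough.\<close>
      have "c * L \<le> real B * q"
      proof -
        have "a * p powr \<gamma> = 1" using p by (simp add: a_def powr_minus)
        then have "(\<kappa> * L * a) * ((\<kappa> / 2) ^ r * (L ^ (m + 1) * p powr \<gamma>)) = c * (L * L ^ (m + 1))"
          unfolding c_def by (simp add: algebra_simps)
        moreover have "(\<kappa> * L * a) * ((\<kappa> / 2) ^ r * (L ^ (m + 1) * p powr \<gamma>)) \<le> real B * q"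
          using B q \<kappa> L a0 p by (intro mult_mono) auto
        moreover have "L * 1 \<le> L * L ^ (m + 1)"
          using L one_le_power[OF L, of "m + 1"] by (intro mult_left_mono) auto
        then have "c * L \<le> c * (L * L ^ (m + 1))" using c by (intro mult_left_mono) auto
        ultimately show ?thesis by linarith
      qed
      moreover have q01: "0 \<le> q" "q \<le> 1"
        unfolding q_def using pw by (auto intro!: prod_nonneg prod_le_1 power_le_one)
      moreover have "measure (initial_measure p) {\<omega>. ennreal (L * p powr - \<gamma>) \<le> hitting_time \<rho> (bootstrap_zero_set r) \<omega>}
        \<le> (1 - q) ^ B"
      proof -
        interpret prob_space "initial_measure p" by (rule prob_space_initial_measure)
        have [measurable]: "hitting_time \<rho> (bootstrap_zero_set r) \<in> borel_measurable (initial_measure p)"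
          by (rule measurable_hitting_time)
        have "real (r * t + t) < L * a"
        proof -
          have "real (r * t + t) \<le> 2 * real r * real t"
            using r1 by (simp add: algebra_simps mult_le_cancel_right1)
          also have "\<dots> \<le> 2 * real r * u" using t r1 by (intro mult_left_mono) auto
          also have "\<dots> = L * a / 2" using r1 by (simp add: u_def)
          also have "\<dots> < L * a" using a0 la by linarith
          finally show ?thesis .
        qed
        then have lt: "of_nat (r * t + t) < ennreal (L * p powr - \<gamma>)"
          unfolding ennreal_of_nat_eq_real_of_nat a_def[symmetric] using a0 L by (intro ennreal_lessI) auto
        have "measure (initial_measure p) {\<omega>. ennreal (L * p powr - \<gamma>) \<le> hitting_time \<rho> (bootstrap_zero_set r) \<omega>}
          \<le> measure (initial_measure p) {\<omega>. of_nat (r * t + t) < hitting_time \<rho> (bootstrap_zero_set r) \<omega>}"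
        proof (rule finite_measure_mono)
          have "{\<omega>\<in>space (initial_measure p). of_nat (r * t + t) < hitting_time \<rho> (bootstrap_zero_set r) \<omega>} \<in> sets (initial_measure p)"
            by measurable
          then show "{\<omega>. of_nat (r * t + t) < hitting_time \<rho> (bootstrap_zero_set r) \<omega>} \<in> sets (initial_measure p)"
            by simp
        qed (use lt in \<open>auto intro: less_le_trans\<close>)
        also have "\<dots> \<le> (1 - q) ^ B"
          unfolding q_def B_def using p r_pos r_le by (intro prob_hitting_time_gt_le) auto
        finally show ?thesis .
      qed
      moreover have "(1 - q) ^ B \<le> exp (- (real B * q))"
        using q01 by (intro one_minus_power_le_exp)
      moreover have "exp (- (real B * q)) \<le> exp (- c * L)" using \<open>c * L \<le> real B * q\<close> by simp
      ultimately show ?case by linarith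
    qed
  qed
  show ?thesis using c main by blast
qed

end

section \<open>Trigger sequences\<close>

definition lines :: "(nat \<Rightarrow> int \<times> int) \<Rightarrow> nat \<Rightarrow> (int \<times> int) set" where
  "lines x k = {y. \<exists>l<k. fst y = fst (x l) \<or> snd y = snd (x l)}"

definition cross :: "nat \<Rightarrow> int \<times> int \<Rightarrow> (int \<times> int) set" where
  "cross \<rho> y = nbhd_h \<rho> y \<union> nbhd_v \<rho> y"

lemma finite_cross [simp]: "finite (cross \<rho> y)"
  by (simp add: cross_def finite_nbhd)

text \<open>A run of the enlarged dynamics. The threshold is reached by filled columns, filled rows
  and initial points; initial points on lines already filled are excluded, so that no initial point
  is ever charged to two triggers.\<close>

definition trigger_seq :: "nat \<Rightarrow> nat \<Rightarrow> (int \<times> int) set \<Rightarrow> nat \<Rightarrow> (nat \<Rightarrow> int \<times> int) \<Rightarrow> bool" where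
  "trigger_seq \<rho> r \<xi> n x \<longleftrightarrow> (\<forall>k<n. x k \<notin> lines x k \<and>
     r \<le> card (near_before \<rho> (fst \<circ> x) k) + card (near_before \<rho> (snd \<circ> x) k)
       + card (\<xi> \<inter> (cross \<rho> (x k) - lines x k)))"

definition in_box :: "nat \<Rightarrow> int \<times> int \<Rightarrow> bool" where
  "in_box N y \<longleftrightarrow> \<bar>fst y\<bar> \<le> int N \<and> \<bar>snd y\<bar> \<le> int N"

lemma lines_cong: "(\<And>l. l < k \<Longrightarrow> x l = x' l) \<Longrightarrow> lines x k = lines x' k"
  unfolding lines_def by (metis (no_types, lifting))

lemma near_before_cong:
  "(\<And>l. l \<le> k \<Longrightarrow> b l = b' l) \<Longrightarrow> near_before \<rho> b k = near_before \<rho> b' k"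
  unfolding near_before_def by auto

lemma trigger_seq_cong:
  assumes "\<And>l. l < n \<Longrightarrow> x l = x' l"
  shows "trigger_seq \<rho> r \<xi> n x = trigger_seq \<rho> r \<xi> n x'"
proof -
  have "lines x k = lines x' k" "near_before \<rho> (fst \<circ> x) k = near_before \<rho> (fst \<circ> x') k"
    "near_before \<rho> (snd \<circ> x) k = near_before \<rho> (snd \<circ> x') k" "x k = x' k" if "k < n" for k
    using that assms by (auto intro!: lines_cong near_before_cong)
  then show ?thesis unfolding trigger_seq_def by (metis (no_types, lifting))
qed

text \<open>A trigger on none of the earlier lines differs from every earlier trigger in both
  coordinates.\<close>

lemma trigger_seq_inj:
  assumes "trigger_seq \<rho> r \<xi> n x"
  shows "inj_on (fst \<circ> x) {..<n}" "inj_on (snd \<circ> x) {..<n}"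
proof -
  have "fst (x l) \<noteq> fst (x k) \<and> snd (x l) \<noteq> snd (x k)" if "l < k" "k < n" for l k
    using assms that unfolding trigger_seq_def lines_def by fastforce
  then have *: "fst (x l) \<noteq> fst (x k) \<and> snd (x l) \<noteq> snd (x k)" if "l \<noteq> k" "k < n" "l < n" for l k
    using that by (metis linorder_neq_iff)
  then show "inj_on (fst \<circ> x) {..<n}" "inj_on (snd \<circ> x) {..<n}"
    unfolding inj_on_def by auto
qed

text \<open>Distinct values in a window of \<open>2 * \<rho> + 1\<close> integers.\<close>

lemma card_near_before_le:
  assumes "inj_on b {..<n}" "k < n"
  shows "card (near_before \<rho> b k) \<le> 2 * \<rho> + 1"
proof -
  have "card (near_before \<rho> b k) = card (b ` near_before \<rho> b k)"
    using assms by (intro card_image[symmetric] inj_on_subset[OF assms(1)]) (auto simp: near_before_def)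
  also have "\<dots> \<le> card {b k - int \<rho>..b k + int \<rho>}"
    by (intro card_mono) (auto simp: near_before_def)
  also have "\<dots> = 2 * \<rho> + 1" by simp
  finally show ?thesis .
qed

text \<open>As \<open>y\<close> lies on no filled line, a filled site of its horizontal neighborhood
  must lie on a filled column, and one of its vertical neighborhood on a filled row. The remaining
  sites are initial and are counted once, because the two neighborhoods meet only in
  \<open>y\<close>, which is not initial.\<close>

lemma card_nbhd_le_trigger:
  assumes y: "y \<notin> \<xi> \<union> lines x n"
  shows "card (nbhd_h \<rho> y \<inter> (\<xi> \<union> lines x n)) + card (nbhd_v \<rho> y \<inter> (\<xi> \<union> lines x n))
    \<le> card (near_before \<rho> (fst \<circ> x(n := y)) n) + card (near_before \<rho> (snd \<circ> x(n := y)) n)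
       + card (\<xi> \<inter> (cross \<rho> y - lines x n))"
proof -
  obtain a b where ab: "y = (a, b)" by (cases y)
  let ?A = "near_before \<rho> (fst \<circ> x(n := y)) n" and ?B = "near_before \<rho> (snd \<circ> x(n := y)) n"
  let ?H = "\<xi> \<inter> (nbhd_h \<rho> y - lines x n)" and ?V = "\<xi> \<inter> (nbhd_v \<rho> y - lines x n)"
  have nl: "fst (x l) \<noteq> a" "snd (x l) \<noteq> b" if "l < n" for l
    using y that unfolding ab lines_def by auto
  have h: "nbhd_h \<rho> y \<inter> (\<xi> \<union> lines x n) \<subseteq> ?H \<union> (\<lambda>l. (fst (x l), b)) ` ?A"
  proof
    fix z assume z: "z \<in> nbhd_h \<rho> y \<inter> (\<xi> \<union> lines x n)"
    then obtain c where c: "z = (c, b)" "\<bar>c - a\<bar> \<le> int \<rho>"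
      unfolding ab by (cases z) (auto simp: mem_nbhd_h)
    show "z \<in> ?H \<union> (\<lambda>l. (fst (x l), b)) ` ?A"
    proof (cases "z \<in> lines x n")
      case True
      then obtain l where l: "l < n" "c = fst (x l)" using nl c unfolding lines_def by auto
      then have "l \<in> ?A" using c by (simp add: near_before_def ab)
      then show ?thesis using l c by blast
    qed (use z in auto)
  qed
  have v: "nbhd_v \<rho> y \<inter> (\<xi> \<union> lines x n) \<subseteq> ?V \<union> (\<lambda>l. (a, snd (x l))) ` ?B"
  proof
    fix z assume z: "z \<in> nbhd_v \<rho> y \<inter> (\<xi> \<union> lines x n)"
    then obtain c where c: "z = (a, c)" "\<bar>c - b\<bar> \<le> int \<rho>"
      unfolding ab by (cases z) (auto simp: mem_nbhd_v)
    show "z \<in> ?V \<union> (\<lambda>l. (a, snd (x l))) ` ?B"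
    proof (cases "z \<in> lines x n")
      case True
      then obtain l where l: "l < n" "c = snd (x l)" using nl c unfolding lines_def by auto
      then have "l \<in> ?B" using c by (simp add: near_before_def ab)
      then show ?thesis using l c by blast
    qed (use z in auto)
  qed
  have fin: "finite ?H" "finite ?V" by (simp_all add: finite_nbhd)
  have "card (nbhd_h \<rho> y \<inter> (\<xi> \<union> lines x n)) \<le> card (?H \<union> (\<lambda>l. (fst (x l), b)) ` ?A)"
    using fin by (intro card_mono[OF _ h]) simp
  also have "\<dots> \<le> card ?H + card ((\<lambda>l. (fst (x l), b)) ` ?A)" by (rule card_Un_le)
  also have "\<dots> \<le> card ?H + card ?A" by (intro add_left_mono card_image_le) simp
  finally have 1: "card (nbhd_h \<rho> y \<inter> (\<xi> \<union> lines x n)) \<le> card ?H + card ?A" .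
  have "card (nbhd_v \<rho> y \<inter> (\<xi> \<union> lines x n)) \<le> card (?V \<union> (\<lambda>l. (a, snd (x l))) ` ?B)"
    using fin by (intro card_mono[OF _ v]) simp
  also have "\<dots> \<le> card ?V + card ((\<lambda>l. (a, snd (x l))) ` ?B)" by (rule card_Un_le)
  also have "\<dots> \<le> card ?V + card ?B" by (intro add_left_mono card_image_le) simp
  finally have 2: "card (nbhd_v \<rho> y \<inter> (\<xi> \<union> lines x n)) \<le> card ?V + card ?B" .
  have "z = y" if "z \<in> nbhd_h \<rho> y" "z \<in> nbhd_v \<rho> y" for z
    using that unfolding ab by (cases z) (auto simp: mem_nbhd_h mem_nbhd_v)
  then have "?H \<inter> ?V = {}" using y by blast
  then have "card ?H + card ?V = card (?H \<union> ?V)"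
    using fin by (intro card_Un_disjoint[symmetric])
  also have "?H \<union> ?V = \<xi> \<inter> (cross \<rho> y - lines x n)" by (auto simp: cross_def)
  finally show ?thesis using 1 2 by linarith
qed

text \<open>Take a longest trigger sequence in the box; the length is at most
  \<open>2 * N + 1\<close> because first coordinates are distinct. A site of the box that still
  reached the threshold could be appended.\<close>

lemma trigger_seq_closure:
  obtains n x where "trigger_seq \<rho> r \<xi> n x" "\<And>k. k < n \<Longrightarrow> in_box N (x k)"
    "\<And>y. in_box N y \<Longrightarrow> y \<notin> \<xi> \<union> lines x n \<Longrightarrow>
      card (nbhd_h \<rho> y \<inter> (\<xi> \<union> lines x n)) + card (nbhd_v \<rho> y \<inter> (\<xi> \<union> lines x n)) < r"
proof -
  define P where "P = (\<lambda>n. \<exists>x. trigger_seq \<rho> r \<xi> n x \<and> (\<forall>k<n. in_box N (x k)))"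
  have bound: "n \<le> 2 * N + 1" if Pn: "P n" for n
  proof -
    obtain x where x: "trigger_seq \<rho> r \<xi> n x" "\<forall>k<n. in_box N (x k)"
      using Pn unfolding P_def by blast
    have "card {..<n} \<le> card {- int N..int N}"
      using x(2) by (intro card_inj_on_le[OF trigger_seq_inj(1)[OF x(1)]]) (auto simp: in_box_def abs_le_iff)
    then show ?thesis by simp
  qed
  have "P 0" unfolding P_def trigger_seq_def by simp
  then have Pn: "P (Greatest P)" and max: "P k \<Longrightarrow> k \<le> Greatest P" for k
    using bound GreatestI_nat[of P 0 "2 * N + 1"] Greatest_le_nat[of P _ "2 * N + 1"] by blast+
  define n where "n = Greatest P"
  obtain x where x: "trigger_seq \<rho> r \<xi> n x" "\<And>k. k < n \<Longrightarrow> in_box N (x k)"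
    using Pn unfolding P_def n_def by blast
  show thesis
  proof (rule that[OF x])
    fix y assume y: "in_box N y" "y \<notin> \<xi> \<union> lines x n"
    show "card (nbhd_h \<rho> y \<inter> (\<xi> \<union> lines x n)) + card (nbhd_v \<rho> y \<inter> (\<xi> \<union> lines x n)) < r"
    proof (rule ccontr)
      let ?x = "x(n := y)"
      assume "\<not> ?thesis"
      then have r: "r \<le> card (near_before \<rho> (fst \<circ> ?x) n) + card (near_before \<rho> (snd \<circ> ?x) n)
          + card (\<xi> \<inter> (cross \<rho> y - lines x n))"
        using card_nbhd_le_trigger[OF y(2), of \<rho>] by linarith
      have ln: "lines ?x n = lines x n" by (intro lines_cong) simp
      have "trigger_seq \<rho> r \<xi> n ?x" using x(1) trigger_seq_cong[of n x ?x] by simp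
      then have "trigger_seq \<rho> r \<xi> (Suc n) ?x"
        unfolding trigger_seq_def less_Suc_eq using r y(2) ln by auto
      moreover have "\<forall>k<Suc n. in_box N (?x k)" using x(2) y(1) by (simp add: less_Suc_eq)
      ultimately have "P (Suc n)" unfolding P_def by blast
      then show False using max[of "Suc n"] by (simp add: n_def)
    qed
  qed
qed

text \<open>Influence travels at most \<rho> per step, so by induction on \<open>s\<close> every
  site occupied at time \<open>s\<close> in the box of radius \<open>\<rho> * (t - s)\<close> is
  covered by the initial set and the lines of a maximal trigger sequence in the box of radius
  \<open>\<rho> * t\<close>. A line covers the origin only if its trigger lies on an axis.\<close>

lemma occupied_origin_trigger_seq:
  assumes "1 \<le> r" "(0, 0) \<in> bootstrap \<rho> r \<xi> t"
  obtains "(0, 0) \<in> \<xi>"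
  | n x k where "trigger_seq \<rho> r \<xi> n x" "\<And>k. k < n \<Longrightarrow> in_box (\<rho> * t) (x k)"
      "k < n" "fst (x k) = 0 \<or> snd (x k) = 0"
proof -
  obtain n x where x: "trigger_seq \<rho> r \<xi> n x" "\<And>k. k < n \<Longrightarrow> in_box (\<rho> * t) (x k)"
    "\<And>y. in_box (\<rho> * t) y \<Longrightarrow> y \<notin> \<xi> \<union> lines x n \<Longrightarrow>
      card (nbhd_h \<rho> y \<inter> (\<xi> \<union> lines x n)) + card (nbhd_v \<rho> y \<inter> (\<xi> \<union> lines x n)) < r"
    by (rule trigger_seq_closure[of \<rho> r \<xi> "\<rho> * t"]) (rule that)
  let ?A = "\<xi> \<union> lines x n"
  have "y \<in> ?A" if "s \<le> t" "y \<in> bootstrap \<rho> r \<xi> s" "in_box (\<rho> * (t - s)) y" for s y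
    using that
  proof (induction s arbitrary: y)
    case (Suc s)
    have st: "\<rho> * (t - Suc s) + \<rho> = \<rho> * (t - s)"
      using Suc.prems(1) by (metis Suc_diff_Suc Suc_le_lessD add.commute mult_Suc_right)
    have sub: "z \<in> ?A" if "z \<in> cross \<rho> y" "z \<in> bootstrap \<rho> r \<xi> s" for z
    proof (rule Suc.IH)
      have "\<bar>fst z - fst y\<bar> \<le> int \<rho> \<and> \<bar>snd z - snd y\<bar> \<le> int \<rho>"
        using that(1) unfolding cross_def by (cases z, cases y) (auto simp: mem_nbhd_h mem_nbhd_v)
      moreover have "int (\<rho> * (t - s)) = int (\<rho> * (t - Suc s)) + int \<rho>"
        using st by (metis of_nat_add)
      ultimately show "in_box (\<rho> * (t - s)) z"
        using Suc.prems(3) unfolding in_box_def by linarith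
    qed (use Suc.prems that in auto)
    show ?case
    proof (cases "y \<in> bootstrap \<rho> r \<xi> s")
      case True
      have "\<rho> * (t - Suc s) \<le> \<rho> * (t - s)" using st by linarith
      then have "in_box (\<rho> * (t - s)) y" using Suc.prems(3) unfolding in_box_def by linarith
      then show ?thesis using Suc.IH[of y] Suc.prems True by simp
    next
      case False
      then have "r \<le> card (nbhd_h \<rho> y \<inter> bootstrap \<rho> r \<xi> s) + card (nbhd_v \<rho> y \<inter> bootstrap \<rho> r \<xi> s)"
        using Suc.prems(2) notin_bootstrap_zero_set[OF assms(1)] by simp
      also have "\<dots> \<le> card (nbhd_h \<rho> y \<inter> ?A) + card (nbhd_v \<rho> y \<inter> ?A)"
        using sub by (intro add_mono card_mono) (auto simp: finite_nbhd cross_def)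
      finally have "\<not> (card (nbhd_h \<rho> y \<inter> ?A) + card (nbhd_v \<rho> y \<inter> ?A) < r)" by simp
      moreover have "\<rho> * (t - Suc s) \<le> \<rho> * t" by simp
      then have "in_box (\<rho> * t) y" using Suc.prems(3) unfolding in_box_def by linarith
      ultimately show ?thesis using x(3) by blast
    qed
  qed simp
  from this[of t "(0, 0)"] have "(0, 0) \<in> ?A" using assms(2) by (simp add: in_box_def)
  then show thesis
  proof
    assume "(0, 0) \<in> lines x n"
    then obtain k where "k < n" "fst (x k) = 0 \<or> snd (x k) = 0" unfolding lines_def by auto
    then show thesis using that(2)[OF x(1,2)] by blast
  qed (rule that(1))
qed

section \<open>Subsequences closed under ancestors\<close>

lemma near_before_comp:
  assumes e: "strict_mono_on {..<n} e" "q < n"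
    and closed: "near_before \<rho> b (e q) \<subseteq> e ` {..<n}"
  shows "card (near_before \<rho> (b \<circ> e) q) = card (near_before \<rho> b (e q))"
proof -
  have mono: "e p < e q \<longleftrightarrow> p < q" if "p < n" for p
    using strict_mono_on_less[OF e(1)] that e(2) by simp
  have "e ` near_before \<rho> (b \<circ> e) q = near_before \<rho> b (e q)"
  proof
    show "e ` near_before \<rho> (b \<circ> e) q \<subseteq> near_before \<rho> b (e q)"
      using mono e(2) unfolding near_before_def by auto
    show "near_before \<rho> b (e q) \<subseteq> e ` near_before \<rho> (b \<circ> e) q"
    proof
      fix l assume l: "l \<in> near_before \<rho> b (e q)"
      then obtain p where p: "p < n" "l = e p" using closed by auto
      then have "p \<in> near_before \<rho> (b \<circ> e) q" using l mono[OF p(1)] unfolding near_before_def by simp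
      then show "l \<in> e ` near_before \<rho> (b \<circ> e) q" using p by blast
    qed
  qed
  moreover have "inj_on e (near_before \<rho> (b \<circ> e) q)"
    using strict_mono_on_imp_inj_on[OF e(1)] e(2) by (rule_tac inj_on_subset) (auto simp: near_before_def)
  ultimately show ?thesis by (metis card_image)
qed

text \<open>When every line seen by a kept trigger comes from a kept trigger, the counts of visible
  lines are unchanged. Discarding other lines can only enlarge the set of initial points that lie
  off the lines.\<close>

lemma trigger_seq_comp:
  assumes x: "trigger_seq \<rho> r \<xi> N x"
    and e: "strict_mono_on {..<n} e" "e ` {..<n} \<subseteq> {..<N}"
    and closed: "\<And>q. q < n \<Longrightarrow> near_before \<rho> (fst \<circ> x) (e q) \<subseteq> e ` {..<n} \<and>
        near_before \<rho> (snd \<circ> x) (e q) \<subseteq> e ` {..<n}"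
  shows "trigger_seq \<rho> r \<xi> n (x \<circ> e)"
  unfolding trigger_seq_def
proof (intro allI impI conjI)
  fix q assume q: "q < n"
  have eq: "e q < N" using e(2) q by auto
  have lines: "lines (x \<circ> e) q \<subseteq> lines x (e q)"
  proof
    fix y assume "y \<in> lines (x \<circ> e) q"
    then obtain p where p: "p < q" "fst y = fst (x (e p)) \<or> snd y = snd (x (e p))"
      unfolding lines_def by auto
    then have "e p < e q" using strict_mono_onD[OF e(1), of p q] q by simp
    then show "y \<in> lines x (e q)" using p(2) unfolding lines_def by blast
  qed
  show "(x \<circ> e) q \<notin> lines (x \<circ> e) q" using x eq lines unfolding trigger_seq_def by auto
  have r: "r \<le> card (near_before \<rho> (fst \<circ> x) (e q)) + card (near_before \<rho> (snd \<circ> x) (e q))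
      + card (\<xi> \<inter> (cross \<rho> (x (e q)) - lines x (e q)))"
    using x eq unfolding trigger_seq_def by blast
  have c: "card (\<xi> \<inter> (cross \<rho> (x (e q)) - lines x (e q))) \<le> card (\<xi> \<inter> (cross \<rho> ((x \<circ> e) q) - lines (x \<circ> e) q))"
    using lines by (intro card_mono) auto
  have "card (near_before \<rho> (fst \<circ> (x \<circ> e)) q) = card (near_before \<rho> (fst \<circ> x) (e q))"
    "card (near_before \<rho> (snd \<circ> (x \<circ> e)) q) = card (near_before \<rho> (snd \<circ> x) (e q))"
    using near_before_comp[OF e(1) q, of \<rho> "fst \<circ> x"] near_before_comp[OF e(1) q, of \<rho> "snd \<circ> x"] closed[OF q]
    unfolding comp_assoc by blast+
  with order_trans[OF r add_left_mono[OF c]]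
  show "r \<le> card (near_before \<rho> (fst \<circ> (x \<circ> e)) q) + card (near_before \<rho> (snd \<circ> (x \<circ> e)) q)
      + card (\<xi> \<inter> (cross \<rho> ((x \<circ> e) q) - lines (x \<circ> e) q))"
    by (simp only:)
qed

text \<open>The first clause is connectedness: each trigger before the last is seen by a later one.
  The second says that none of these already sees \<open>m\<close> lines in one direction, and the
  third lists the possible reasons for stopping at index \<open>n\<close>.\<close>

definition terminal_seq :: "nat \<Rightarrow> nat \<Rightarrow> nat \<Rightarrow> nat \<Rightarrow> (nat \<Rightarrow> int \<times> int) \<Rightarrow> bool" where
  "terminal_seq \<rho> m M n x \<longleftrightarrow>
     (\<forall>k<n. \<exists>l. k < l \<and> l \<le> n \<and> (k \<in> near_before \<rho> (fst \<circ> x) l \<or> k \<in> near_before \<rho> (snd \<circ> x) l)) \<and>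
     (\<forall>k<n. card (near_before \<rho> (fst \<circ> x) k) < m \<and> card (near_before \<rho> (snd \<circ> x) k) < m) \<and>
     (m \<le> card (near_before \<rho> (fst \<circ> x) n) \<or> m \<le> card (near_before \<rho> (snd \<circ> x) n) \<or>
      M \<le> Suc n \<or> fst (x n) = 0 \<or> snd (x n) = 0)"

text \<open>Keep the ancestors of the first trigger \<open>k0\<close> that meets a stopping
  condition, in their original order. One exists because the trigger \<open>k\<close> lies on an
  axis.\<close>

lemma terminal_subseq:
  assumes x: "trigger_seq \<rho> r \<xi> N x" and k: "k < N" "fst (x k) = 0 \<or> snd (x k) = 0"
  obtains n e where "Suc n \<le> 1 + (4 * \<rho> + 2) * M" "\<And>q. q \<le> n \<Longrightarrow> e q < N"
    "trigger_seq \<rho> r \<xi> (Suc n) (x \<circ> e)" "terminal_seq \<rho> m M n (x \<circ> e)"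
proof -
  let ?A = "near_before \<rho> (fst \<circ> x)" and ?B = "near_before \<rho> (snd \<circ> x)"
  \<comment> \<open>\<open>par\<close> relates a trigger to those that see one of its lines. The
    closure in \<open>Anc\<close> is reflexive, so \<open>Anc k\<close> contains \<open>k\<close>,
    and \<open>M \<le> card (Anc k0)\<close> becomes \<open>M \<le> Suc n\<close> after
    relabelling.\<close>
  define par where "par = {(l, k). l \<in> ?A k \<or> l \<in> ?B k}"
  define Anc where "Anc = (\<lambda>k. {l. (l, k) \<in> par\<^sup>*})"
  define T where "T = (\<lambda>k. m \<le> card (?A k) \<or> m \<le> card (?B k) \<or> M \<le> card (Anc k) \<or>
    fst (x k) = 0 \<or> snd (x k) = 0)"
  define k0 where "k0 = (LEAST k. T k)"
  have Tk: "T k" unfolding T_def using k(2) by blast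
  have T0: "T k0" unfolding k0_def using Tk by (rule LeastI)
  have k0k: "k0 \<le> k" unfolding k0_def using Tk by (rule Least_le)
  have nT: "\<not> T l" if "l < k0" for l using that unfolding k0_def by (rule not_less_Least)
  have par_less: "l < k" if "(l, k) \<in> par" for l k
    using that unfolding par_def near_before_def by auto
  have anc_le: "l \<le> k" if "(l, k) \<in> par\<^sup>*" for l k
    using that by (induction rule: rtrancl_induct) (auto dest: par_less)
  have fin: "finite (Anc k)" for k
    by (rule finite_subset[of _ "{..k}"]) (simp_all add: Anc_def anc_le subset_iff)
  have par_iff: "{l. (l, k0) \<in> par} = ?A k0 \<union> ?B k0" unfolding par_def by auto
  \<comment> \<open>The trigger \<open>k0\<close> may be the first with \<open>M\<close> or more
    ancestors, but its at most \<open>4 * \<rho> + 2\<close> parents precede it and have fewer than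
    \<open>M\<close> each.\<close>
  have "card (Anc k0) \<le> 1 + (4 * \<rho> + 2) * M"
  proof -
    have "Anc k0 \<subseteq> insert k0 (\<Union>l\<in>?A k0 \<union> ?B k0. Anc l)"
    proof
      fix l assume "l \<in> Anc k0"
      then have "(l, k0) \<in> par\<^sup>*" by (simp add: Anc_def)
      then show "l \<in> insert k0 (\<Union>l\<in>?A k0 \<union> ?B k0. Anc l)"
      proof (cases rule: rtranclE)
        case (step j)
        then have "j \<in> ?A k0 \<union> ?B k0" "l \<in> Anc j" using par_iff by (auto simp: Anc_def)
        then show ?thesis by blast
      qed simp
    qed
    then have "card (Anc k0) \<le> card (insert k0 (\<Union>l\<in>?A k0 \<union> ?B k0. Anc l))"
      using fin by (intro card_mono) auto
    also have "\<dots> \<le> 1 + card (\<Union>l\<in>?A k0 \<union> ?B k0. Anc l)"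
      by (simp add: card_insert_if fin)
    also have "card (\<Union>l\<in>?A k0 \<union> ?B k0. Anc l) \<le> (\<Sum>l\<in>?A k0 \<union> ?B k0. card (Anc l))"
      by (intro card_UN_le) simp
    also have "\<dots> \<le> (\<Sum>l\<in>?A k0 \<union> ?B k0. M)"
    proof (rule sum_mono)
      fix l assume "l \<in> ?A k0 \<union> ?B k0"
      then have "l < k0" by (auto simp: near_before_def)
      then show "card (Anc l) \<le> M" using nT[of l] unfolding T_def by linarith
    qed
    also have "\<dots> = card (?A k0 \<union> ?B k0) * M" by simp
    also have "\<dots> \<le> (4 * \<rho> + 2) * M"
    proof (rule mult_right_mono)
      have "k0 < N" using k0k k(1) by simp
      then have "card (?A k0) \<le> 2 * \<rho> + 1" "card (?B k0) \<le> 2 * \<rho> + 1"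
        using card_near_before_le trigger_seq_inj[OF x] by blast+
      then show "card (?A k0 \<union> ?B k0) \<le> 4 * \<rho> + 2"
        using card_Un_le[of "?A k0" "?B k0"] by linarith
    qed simp
    finally show ?thesis by simp
  qed
  moreover obtain e where bij: "bij_betw e {..<card (Anc k0)} (Anc k0)"
    and mono: "strict_mono_on {..<card (Anc k0)} e"
    using ex_bij_betw_strict_mono_card[OF fin] by blast
  have k0A: "k0 \<in> Anc k0" by (simp add: Anc_def)
  then have "card (Anc k0) \<noteq> 0" using fin by auto
  then obtain n where n: "card (Anc k0) = Suc n" by (cases "card (Anc k0)") auto
  have img: "e ` {..<Suc n} = Anc k0" using bij n unfolding bij_betw_def by simp
  have mono: "strict_mono_on {..<Suc n} e" using mono n by simp
  have e_Anc: "e q \<in> Anc k0" if "q \<le> n" for q using img that by auto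
  have less: "e p < e q \<longleftrightarrow> p < q" if "p \<le> n" "q \<le> n" for p q
    using strict_mono_on_less[OF mono] that by simp
  \<comment> \<open>Ancestors never come later, so \<open>k0\<close> is the largest element of
    \<open>Anc k0\<close> and receives the last label.\<close>
  have en: "e n = k0"
  proof -
    obtain q where q: "q \<le> n" "e q = k0" using k0A unfolding img[symmetric] by (auto simp: less_Suc_eq_le)
    have "e n \<le> k0" using e_Anc[of n] anc_le by (simp add: Anc_def)
    then have "\<not> q < n" using less[of q n] q by auto
    then show ?thesis using q by simp
  qed
  have closed: "?A (e q) \<subseteq> e ` {..<Suc n} \<and> ?B (e q) \<subseteq> e ` {..<Suc n}" if "q \<le> n" for q
  proof -
    have "l \<in> Anc k0" if "l \<in> ?A (e q) \<union> ?B (e q)" for l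
    proof -
      have "(l, e q) \<in> par" using that unfolding par_def by auto
      moreover have "(e q, k0) \<in> par\<^sup>*" using e_Anc[OF \<open>q \<le> n\<close>] by (simp add: Anc_def)
      ultimately show ?thesis unfolding Anc_def by (simp add: converse_rtrancl_into_rtrancl)
    qed
    then show ?thesis unfolding img by blast
  qed
  have eN: "e q < N" if "q \<le> n" for q
    using e_Anc[OF that] anc_le[of "e q" k0] k0k k(1) unfolding Anc_def by simp
  have card_eq: "card (near_before \<rho> (fst \<circ> (x \<circ> e)) q) = card (?A (e q))"
    "card (near_before \<rho> (snd \<circ> (x \<circ> e)) q) = card (?B (e q))" if "q \<le> n" for q
    using near_before_comp[OF mono, of q \<rho> "fst \<circ> x"] near_before_comp[OF mono, of q \<rho> "snd \<circ> x"]
      closed[OF that] that unfolding comp_assoc by auto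
  have ts: "trigger_seq \<rho> r \<xi> (Suc n) (x \<circ> e)"
    using eN closed by (intro trigger_seq_comp[OF x mono]) (auto simp: less_Suc_eq_le)
  have "terminal_seq \<rho> m M n (x \<circ> e)"
    unfolding terminal_seq_def
  proof (intro conjI allI impI)
    fix q assume q: "q < n"
    then have "e q < k0" using less[of q n] en by simp
    then have "\<not> T (e q)" by (rule nT)
    then show "card (near_before \<rho> (fst \<circ> (x \<circ> e)) q) < m"
      "card (near_before \<rho> (snd \<circ> (x \<circ> e)) q) < m"
      using card_eq[of q] q unfolding T_def by auto
    \<comment> \<open>The first edge on a path from \<open>e q\<close> to \<open>k0\<close> leads to
      a later kept trigger that sees \<open>e q\<close>.\<close>
    have "(e q, k0) \<in> par\<^sup>*" using e_Anc[of q] q by (simp add: Anc_def)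
    then obtain j where j: "(e q, j) \<in> par" "(j, k0) \<in> par\<^sup>*"
      using \<open>e q < k0\<close> by (cases rule: converse_rtranclE) auto
    then have "j \<in> Anc k0" by (simp add: Anc_def)
    then obtain l where l: "l \<le> n" "j = e l" unfolding img[symmetric] by (auto simp: less_Suc_eq_le)
    have "q < l" using par_less[OF j(1)] less[of q l] l q by simp
    moreover have "q \<in> near_before \<rho> (fst \<circ> (x \<circ> e)) l \<or> q \<in> near_before \<rho> (snd \<circ> (x \<circ> e)) l"
      using j(1) \<open>q < l\<close> unfolding par_def l(2) near_before_def by auto
    ultimately show "\<exists>l>q. l \<le> n \<and> (q \<in> near_before \<rho> (fst \<circ> (x \<circ> e)) l \<or>
        q \<in> near_before \<rho> (snd \<circ> (x \<circ> e)) l)" using l(1) by blast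
  next
    show "m \<le> card (near_before \<rho> (fst \<circ> (x \<circ> e)) n) \<or> m \<le> card (near_before \<rho> (snd \<circ> (x \<circ> e)) n) \<or>
      M \<le> Suc n \<or> fst ((x \<circ> e) n) = 0 \<or> snd ((x \<circ> e) n) = 0"
      using T0 card_eq[of n] unfolding T_def en n by (simp add: en)
  qed
  with that[of n e] show thesis using calculation eN ts unfolding n by blast
qed

section \<open>Lower bound on the hitting time\<close>

lemma card_cross_le: "card (cross \<rho> y) \<le> 4 * \<rho> + 2"
proof -
  have "card (nbhd_h \<rho> y) \<le> card {- int \<rho>..int \<rho>}" "card (nbhd_v \<rho> y) \<le> card {- int \<rho>..int \<rho>}"
    unfolding nbhd_h_def nbhd_v_def by (intro card_image_le; simp)+
  then show ?thesis unfolding cross_def using card_Un_le[of "nbhd_h \<rho> y" "nbhd_v \<rho> y"] by simp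
qed

text \<open>Sum the threshold condition over all triggers. The sets of charged initial points are
  disjoint, since the cross of an earlier trigger lies on its own two lines, which are excluded
  later.\<close>

lemma trigger_seq_witness:
  assumes "trigger_seq \<rho> r \<xi> n x"
  shows "\<exists>F\<subseteq>\<xi>. F \<subseteq> (\<Union>k<n. cross \<rho> (x k)) \<and>
    r * n \<le> card F + (\<Sum>k<n. card (near_before \<rho> (fst \<circ> x) k)) + (\<Sum>k<n. card (near_before \<rho> (snd \<circ> x) k))"
proof -
  define D where "D = (\<lambda>k. \<xi> \<inter> (cross \<rho> (x k) - lines x k))"
  have fin: "finite (D k)" for k unfolding D_def by simp
  have disj': "D l \<inter> D k = {}" if "l < k" for l k
  proof -
    have "z \<in> lines x k" if "z \<in> cross \<rho> (x l)" for z
    proof -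
      have "fst z = fst (x l) \<or> snd z = snd (x l)"
        using that unfolding cross_def by (cases z, cases "x l") (auto simp: mem_nbhd_h mem_nbhd_v)
      then show ?thesis using \<open>l < k\<close> unfolding lines_def by blast
    qed
    then show ?thesis unfolding D_def by blast
  qed
  have disj: "D l \<inter> D k = {}" if "l \<noteq> k" for l k
    using disj'[of l k] disj'[of k l] that by (cases "l < k") (auto simp: Int_commute)
  have "card (\<Union>k<n. D k) = (\<Sum>k<n. card (D k))"
    using fin disj by (intro card_UN_disjoint) auto
  moreover have "(\<Sum>k<n. r) \<le> (\<Sum>k<n. card (near_before \<rho> (fst \<circ> x) k) + card (near_before \<rho> (snd \<circ> x) k) + card (D k))"
    using assms unfolding trigger_seq_def D_def by (intro sum_mono) blast
  ultimately have "r * n \<le> card (\<Union>k<n. D k) + (\<Sum>k<n. card (near_before \<rho> (fst \<circ> x) k)) + (\<Sum>k<n. card (near_before \<rho> (snd \<circ> x) k))"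
    by (simp add: sum.distrib mult.commute)
  moreover have "(\<Union>k<n. D k) \<subseteq> \<xi>" "(\<Union>k<n. D k) \<subseteq> (\<Union>k<n. cross \<rho> (x k))"
    unfolding D_def by auto
  ultimately show ?thesis by blast
qed

text \<open>The possible positions of \<open>n\<close> triggers with given column clusters
  \<open>f\<close> and row clusters \<open>g\<close>; \<open>Z\<close> and \<open>Z'\<close> serve
  to record a final trigger on an axis.\<close>

definition tuples :: "nat \<Rightarrow> nat \<Rightarrow> nat \<Rightarrow> (nat \<Rightarrow> nat) \<Rightarrow> (nat \<Rightarrow> nat) \<Rightarrow> nat set \<Rightarrow> nat set \<Rightarrow> (nat \<Rightarrow> int \<times> int) set" where
  "tuples \<rho> N n f g Z Z' = {x \<in> {..<n} \<rightarrow>\<^sub>E {y. in_box N y}.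
     (\<forall>k<n. \<bar>fst (x k) - fst (x (f k))\<bar> \<le> int (\<rho> * n) \<and> \<bar>snd (x k) - snd (x (g k))\<bar> \<le> int (\<rho> * n)) \<and>
     (\<forall>z\<in>Z. fst (x z) = 0) \<and> (\<forall>z\<in>Z'. snd (x z) = 0)}"

text \<open>The two coordinates are counted separately by \<open>card_tuples_le\<close>, so the
  exponent of the box size is the number of clusters in both directions minus the number of
  prescribed zeros.\<close>

lemma card_tuples_pair_le:
  assumes f: "\<And>k. k < n \<Longrightarrow> f k < n \<and> f (f k) = f k" and g: "\<And>k. k < n \<Longrightarrow> g k < n \<and> g (g k) = g k"
    and Z: "Z \<subseteq> f ` {..<n}" "Z' \<subseteq> g ` {..<n}"
  shows "finite (tuples \<rho> N n f g Z Z')"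
    "card (tuples \<rho> N n f g Z Z') \<le> (2 * N + 1) ^ (card (f ` {..<n}) - card Z + (card (g ` {..<n}) - card Z'))
       * (2 * (\<rho> * n) + 1) ^ (2 * n)"
proof -
  let ?I = "{..<n}"
  let ?S = "\<lambda>f Z. {b \<in> ?I \<rightarrow>\<^sub>E {- int N..int N}. (\<forall>k\<in>?I. \<bar>b k - b (f k)\<bar> \<le> int (\<rho> * n)) \<and> (\<forall>z\<in>Z. b z = 0)}"
  let ?\<phi> = "\<lambda>x. (\<lambda>k\<in>?I. fst (x k), \<lambda>k\<in>?I. snd (x k))"
  have finS: "finite (?S h W)" for h W
    by (rule finite_subset[of _ "?I \<rightarrow>\<^sub>E {- int N..int N}"]) (auto intro!: finite_PiE)
  have Zn: "z < n" if "z \<in> Z" for z using that Z(1) f by auto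
  have Zn': "z < n" if "z \<in> Z'" for z using that Z(2) g by auto
  have img: "?\<phi> ` tuples \<rho> N n f g Z Z' \<subseteq> ?S f Z \<times> ?S g Z'"
  proof (intro image_subsetI SigmaI)
    fix x assume x: "x \<in> tuples \<rho> N n f g Z Z'"
    have box: "in_box N (x k)" if "k < n" for k using x that unfolding tuples_def by (auto simp: PiE_iff)
    have b: "fst (x k) \<in> {- int N..int N}" "snd (x k) \<in> {- int N..int N}" if "k < n" for k
      using box[OF that] unfolding in_box_def atLeastAtMost_iff by linarith+
    show "(\<lambda>k\<in>?I. fst (x k)) \<in> ?S f Z"
    proof (intro CollectI conjI)
      show "(\<lambda>k\<in>?I. fst (x k)) \<in> ?I \<rightarrow>\<^sub>E {- int N..int N}"
        unfolding restrict_PiE_iff using b by blast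
    qed (use x f Zn in \<open>auto simp: tuples_def\<close>)
    show "(\<lambda>k\<in>?I. snd (x k)) \<in> ?S g Z'"
    proof (intro CollectI conjI)
      show "(\<lambda>k\<in>?I. snd (x k)) \<in> ?I \<rightarrow>\<^sub>E {- int N..int N}"
        unfolding restrict_PiE_iff using b by blast
    qed (use x g Zn' in \<open>auto simp: tuples_def\<close>)
  qed
  have inj: "inj_on ?\<phi> (tuples \<rho> N n f g Z Z')"
  proof (rule inj_onI)
    fix x y assume x: "x \<in> tuples \<rho> N n f g Z Z'" and y: "y \<in> tuples \<rho> N n f g Z Z'" and eq: "?\<phi> x = ?\<phi> y"
    have "fst (x k) = fst (y k)" "snd (x k) = snd (y k)" if "k < n" for k
      using fun_cong[OF arg_cong[OF eq, of fst], of k] fun_cong[OF arg_cong[OF eq, of snd], of k] that by simp_all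
    then have "x k = y k" if "k < n" for k using that by (simp add: prod_eq_iff)
    moreover have "x \<in> extensional ?I" "y \<in> extensional ?I" using x y by (auto simp: tuples_def PiE_iff)
    ultimately show "x = y" by (intro extensionalityI) auto
  qed
  show "finite (tuples \<rho> N n f g Z Z')"
    using finite_imageD[OF finite_subset[OF img] inj] finS by blast
  have "card (tuples \<rho> N n f g Z Z') \<le> card (?S f Z \<times> ?S g Z')"
    using finS by (intro card_inj_on_le[OF inj img]) auto
  also have "\<dots> = card (?S f Z) * card (?S g Z')" by (rule card_cartesian_product)
  also have "\<dots> \<le> ((2 * N + 1) ^ (card (f ` ?I) - card Z) * (2 * (\<rho> * n) + 1) ^ card ?I) *
      ((2 * N + 1) ^ (card (g ` ?I) - card Z') * (2 * (\<rho> * n) + 1) ^ card ?I)"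
    using f g Z by (intro mult_mono card_tuples_le) auto
  also have "\<dots> = (2 * N + 1) ^ (card (f ` {..<n}) - card Z + (card (g ` {..<n}) - card Z'))
       * (2 * (\<rho> * n) + 1) ^ (2 * n)"
    by (simp add: power_add mult_2)
  finally show "card (tuples \<rho> N n f g Z Z') \<le> \<dots>" .
qed

text \<open>A union bound: for each \<open>x\<close> the union of the crosses has at most
  \<open>n * (4 * \<rho> + 2)\<close> sites, which limits the number of subsets \<open>F\<close>,
  and each of them has probability at most \<open>p powr d\<close>.\<close>

lemma prob_cross_witness_le:
  fixes d :: real and n \<rho> :: nat
  assumes "finite X" "0 < p" "p < 1"
  defines "E \<equiv> {\<omega>. \<exists>F\<in>{F. \<exists>x\<in>X. F \<subseteq> (\<Union>k<n. cross \<rho> (x k)) \<and> d \<le> real (card F)}. \<forall>y\<in>F. \<omega> y}"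
  shows "E \<in> sets (initial_measure p)"
    and "measure (initial_measure p) E \<le> real (card X) * 2 ^ (n * (4 * \<rho> + 2)) * p powr d"
proof -
  let ?U = "\<lambda>x. \<Union>k<n. cross \<rho> (x k)"
  let ?\<F> = "{F. \<exists>x\<in>X. F \<subseteq> ?U x \<and> d \<le> real (card F)}"
  have finU: "finite (?U x)" for x :: "nat \<Rightarrow> int \<times> int" by simp
  have sub: "?\<F> \<subseteq> (\<Union>x\<in>X. Pow (?U x))" by blast
  have finP: "finite (\<Union>x\<in>X. Pow (?U x))" using assms(1) finU by blast
  have fin: "finite ?\<F>" by (rule finite_subset[OF sub finP])
  have finF: "finite F" if "F \<in> ?\<F>" for F using that finU finite_subset by blast
  show "E \<in> sets (initial_measure p)"
    unfolding E_def using assms(2,3) by (intro prob_some_all_occupied_le(1)[OF fin finF]) auto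
  have "measure (initial_measure p) E \<le> (\<Sum>F\<in>?\<F>. p ^ card F)"
    unfolding E_def using assms(2,3) by (intro prob_some_all_occupied_le(2)[OF fin finF]) auto
  also have "\<dots> \<le> (\<Sum>F\<in>?\<F>. p powr d)"
  proof (rule sum_mono)
    fix F assume "F \<in> ?\<F>"
    then have "d \<le> real (card F)" by blast
    then show "p ^ card F \<le> p powr d"
      using assms(2,3) powr_mono'[of d "real (card F)" p] by (simp add: powr_realpow)
  qed
  also have "\<dots> = real (card ?\<F>) * p powr d" by simp
  also have "\<dots> \<le> real (card X * 2 ^ (n * (4 * \<rho> + 2))) * p powr d"
  proof (intro mult_right_mono of_nat_mono)
    have "card ?\<F> \<le> card (\<Union>x\<in>X. Pow (?U x))" by (rule card_mono[OF finP sub])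
    also have "\<dots> \<le> (\<Sum>x\<in>X. card (Pow (?U x)))" by (rule card_UN_le[OF assms(1)])
    also have "\<dots> \<le> (\<Sum>x\<in>X. 2 ^ (n * (4 * \<rho> + 2)))"
    proof (rule sum_mono)
      fix x
      have "card (?U x) \<le> (\<Sum>k<n. card (cross \<rho> (x k)))" by (rule card_UN_le) simp
      also have "\<dots> \<le> (\<Sum>k<n. 4 * \<rho> + 2)" by (intro sum_mono card_cross_le)
      also have "\<dots> = n * (4 * \<rho> + 2)" by simp
      finally show "card (Pow (?U x)) \<le> 2 ^ (n * (4 * \<rho> + 2))"
        unfolding card_Pow[OF finU] by (intro power_increasing) auto
    qed
    finally show "card ?\<F> \<le> card X * 2 ^ (n * (4 * \<rho> + 2))" by simp
  qed simp
  finally show "measure (initial_measure p) E \<le> real (card X) * 2 ^ (n * (4 * \<rho> + 2)) * p powr d" by simp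
qed

section \<open>Cost of a terminal sequence and the union bound\<close>

context critical_exponent
begin

text \<open>The number of initial points needed, \<open>r * Suc n - I - J\<close>, is compared with
  \<gamma> times the number \<open>R\<close> of free coordinates. Each cluster saves
  \<open>m\<close> in the bound on \<open>I + J\<close>, and connectedness gives
  \<open>R \<le> n + 2\<close>. The rest depends on why the sequence stopped: many visible lines,
  many triggers, or an axis, where one coordinate is not free.\<close>

lemma terminal_exponent:
  fixes x :: "nat \<Rightarrow> int \<times> int" and n :: nat and f g :: "nat \<Rightarrow> nat"
  defines "I \<equiv> \<Sum>k<Suc n. card (near_before \<rho> (fst \<circ> x) k)"
    and "J \<equiv> \<Sum>k<Suc n. card (near_before \<rho> (snd \<circ> x) k)"
  assumes f: "cluster_last \<rho> (fst \<circ> x) (Suc n) f" and g: "cluster_last \<rho> (snd \<circ> x) (Suc n) g"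
    and x: "terminal_seq \<rho> m M n x"
    and M: "\<gamma> - real m \<le> (real r - \<gamma> - real m) * real M"
  defines "R \<equiv> card (f ` {..<Suc n}) + card (g ` {..<Suc n})"
  shows "\<gamma> * (real R - 1) \<le> real (r * Suc n) - real I - real J"
    and "fst (x n) \<noteq> 0 \<Longrightarrow> snd (x n) \<noteq> 0 \<Longrightarrow> \<gamma> * real R \<le> real (r * Suc n) - real I - real J"
proof -
  let ?a = "\<lambda>k. card (near_before \<rho> (fst \<circ> x) k)" and ?b = "\<lambda>k. card (near_before \<rho> (snd \<circ> x) k)"
  let ?Rf = "card (f ` {..<Suc n})" and ?Rg = "card (g ` {..<Suc n})"
  have lt: "?a k < m" "?b k < m" if "k < n" for k using x that unfolding terminal_seq_def by blast+
  have Rn: "R \<le> n + 2"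
    unfolding R_def using x unfolding terminal_seq_def by (intro card_clusters_le[OF f g]) blast
  have mm: "real (m * (m - 1)) = real m * (real m - 1)"
    by (cases m) (auto simp: algebra_simps)
  \<comment> \<open>If the last trigger sees \<open>m\<close> columns or more, the early members of
    its cluster yield the extra term; otherwise each index sees at most \<open>m\<close>. The same
    holds for rows in \<open>gw\<close>.\<close>
  have fw: "2 * real I + 2 * real m * real ?Rf + (if m \<le> ?a n then real m * (real m - 1) else 0) \<le> 2 * real m * (real n + 1)"
  proof (cases "m \<le> ?a n")
    case True
    from sum_near_before_last_le[OF f lt(1) True]
    have "real (2 * I + 2 * m * ?Rf + m * (m - 1)) \<le> real (2 * m * Suc n)"
      unfolding I_def of_nat_le_iff by blast
    moreover have "real (2 * I + 2 * m * ?Rf + m * (m - 1)) = 2 * real I + 2 * real m * real ?Rf + real m * (real m - 1)"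
      unfolding of_nat_add mm by simp
    moreover have "real (2 * m * Suc n) = 2 * real m * (real n + 1)" by (simp add: algebra_simps)
    ultimately have "2 * real I + 2 * real m * real ?Rf + real m * (real m - 1) \<le> 2 * real m * (real n + 1)"
      by (simp only:)
    then show ?thesis by (simp only: True if_True)
  next
    case False
    have "I + m * card (f ` {..<Suc n}) \<le> m * card {..<Suc n}"
      unfolding I_def
    proof (rule sum_near_before_le[OF f])
      fix k assume "k \<in> {..<Suc n}"
      then show "?a k \<le> m" using lt(1)[of k] False by (cases "k = n") auto
    qed auto
    then have "real (I + m * ?Rf) \<le> real (m * Suc n)" unfolding of_nat_le_iff card_lessThan .
    then show ?thesis using False by (simp add: algebra_simps)
  qed
  have gw: "2 * real J + 2 * real m * real ?Rg + (if m \<le> ?b n then real m * (real m - 1) else 0) \<le> 2 * real m * (real n + 1)"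
  proof (cases "m \<le> ?b n")
    case True
    from sum_near_before_last_le[OF g lt(2) True]
    have "real (2 * J + 2 * m * ?Rg + m * (m - 1)) \<le> real (2 * m * Suc n)"
      unfolding J_def of_nat_le_iff by blast
    moreover have "real (2 * J + 2 * m * ?Rg + m * (m - 1)) = 2 * real J + 2 * real m * real ?Rg + real m * (real m - 1)"
      unfolding of_nat_add mm by simp
    moreover have "real (2 * m * Suc n) = 2 * real m * (real n + 1)" by (simp add: algebra_simps)
    ultimately have "2 * real J + 2 * real m * real ?Rg + real m * (real m - 1) \<le> 2 * real m * (real n + 1)"
      by (simp only:)
    then show ?thesis by (simp only: True if_True)
  next
    case False
    have "J + m * card (g ` {..<Suc n}) \<le> m * card {..<Suc n}"
      unfolding J_def
    proof (rule sum_near_before_le[OF g])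
      fix k assume "k \<in> {..<Suc n}"
      then show "?b k \<le> m" using lt(2)[of k] False by (cases "k = n") auto
    qed auto
    then have "real (J + m * ?Rg) \<le> real (m * Suc n)" unfolding of_nat_le_iff card_lessThan .
    then show ?thesis using False by (simp add: algebra_simps)
  qed
  define N where "N = real n + 1"
  \<comment> \<open>The guaranteed gain; one copy is enough even if the last trigger sees
    \<open>m\<close> lines in both directions.\<close>
  define \<eta> where "\<eta> = (if m \<le> ?a n \<or> m \<le> ?b n then real m * (real m - 1) / 2 else 0)"
  have m0: "0 \<le> real m * (real m - 1)" unfolding mm[symmetric] by simp
  have IJ: "real I + real J + real m * real R + \<eta> \<le> 2 * (real m * N)"
  proof -
    have "real m * real R = real m * real ?Rf + real m * real ?Rg" by (simp add: R_def algebra_simps)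
    moreover have "\<eta> \<le> (if m \<le> ?a n then real m * (real m - 1) / 2 else 0) + (if m \<le> ?b n then real m * (real m - 1) / 2 else 0)"
      using m0 unfolding \<eta>_def by auto
    ultimately show ?thesis using fw gw unfolding N_def by (auto split: if_splits)
  qed
  have RN: "(\<gamma> - real m) * real R \<le> (\<gamma> - real m) * (N + 1)"
    using Rn \<gamma>_ge_m unfolding N_def by (intro mult_left_mono) linarith+
  \<comment> \<open>Eliminating \<open>I + J\<close> leaves \<open>- (\<gamma> - m) * R\<close>, and
    \<open>R \<le> N + 1\<close> may be inserted because \<open>\<gamma> \<ge> m\<close>.\<close>
  have key: "(real r - \<gamma> - real m) * N - (\<gamma> - real m) + \<eta> \<le> real (r * Suc n) - real I - real J - \<gamma> * real R"
  proof -
    have "real (r * Suc n) = real r * N" by (simp add: N_def algebra_simps)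
    moreover have "(real r - \<gamma> - real m) * N = real r * N - \<gamma> * N - real m * N"
      "(\<gamma> - real m) * (N + 1) = \<gamma> * N - real m * N + \<gamma> - real m"
      "(\<gamma> - real m) * real R = \<gamma> * real R - real m * real R"
      by (simp_all add: algebra_simps)
    ultimately show ?thesis using IJ RN by linarith
  qed
  have pos: "0 < real r - \<gamma> - real m" using \<gamma>_less by simp
  have N0: "0 \<le> (real r - \<gamma> - real m) * N" using pos by (simp add: N_def)
  have \<eta>0: "0 \<le> \<eta>" using m0 by (simp add: \<eta>_def)
  show "\<gamma> * (real R - 1) \<le> real (r * Suc n) - real I - real J"
  proof -
    have "\<gamma> * (real R - 1) = \<gamma> * real R - \<gamma>" by (simp add: algebra_simps)
    then show ?thesis using key N0 \<eta>0 of_nat_0_le_iff[of m, where 'a = real] by linarith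
  qed
  assume nz: "fst (x n) \<noteq> 0" "snd (x n) \<noteq> 0"
  have "0 \<le> (real r - \<gamma> - real m) * N - (\<gamma> - real m) + \<eta>"
  proof (cases "m \<le> ?a n \<or> m \<le> ?b n")
    case True
    have "card (near_before \<rho> b n) \<le> n" for b
      using card_mono[of "{..<n}" "near_before \<rho> b n"] by (auto simp: near_before_def)
    \<comment> \<open>At least \<open>m\<close> lines can be visible only after \<open>m\<close>
      triggers.\<close>
    then have "m \<le> n" using True le_trans by blast
    then have "(real r - \<gamma> - real m) * (real m + 1) \<le> (real r - \<gamma> - real m) * N"
      using pos unfolding N_def by (intro mult_left_mono) auto
    \<comment> \<open>Equality in the extremal case \<open>n = m\<close>: this is the balance
      equation for \<gamma> again, and it makes the lower and upper bounds meet.\<close>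
    moreover have "(real r - \<gamma> - real m) * (real m + 1) - (\<gamma> - real m) + real m * (real m - 1) / 2 = 0"
      using \<gamma>_mult by (simp add: field_simps)
    ultimately show ?thesis using True unfolding \<eta>_def by auto
  next
    case False
    then have "M \<le> Suc n" using x nz unfolding terminal_seq_def by blast
    then have "(real r - \<gamma> - real m) * real M \<le> (real r - \<gamma> - real m) * N"
      using pos unfolding N_def by (intro mult_left_mono) auto
    then show ?thesis using M \<eta>0 by linarith
  qed
  then show "\<gamma> * real R \<le> real (r * Suc n) - real I - real J" using key by linarith
qed

text \<open>The summand \<open>p\<close> covers an initially occupied origin. Otherwise a terminal
  sequence exists, of one of finitely many shapes in \<open>Idx\<close>; a shape with
  \<open>deg\<close> free coordinates has probability at most a constant times the
  \<open>deg\<close>-th power of \<open>(2 * \<rho> * t + 1) * p powr \<gamma>\<close>.\<close>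

lemma prob_origin_occupied_le:
  "\<exists>C\<ge>0. \<forall>p t s. 0 < p \<longrightarrow> p < 1 \<longrightarrow> (2 * real \<rho> * real t + 1) * p powr \<gamma> \<le> s \<longrightarrow> s \<le> 1 \<longrightarrow>
     measure (initial_measure p) {\<omega>. (0, 0) \<in> bootstrap \<rho> r {x. \<omega> x} t} \<le> p + C * s"
proof -
  have pos: "0 < real r - \<gamma> - real m" using \<gamma>_less by simp
  \<comment> \<open>With this many ancestors the term linear in the length already outweighs
    \<open>\<gamma> - m\<close>.\<close>
  obtain M :: nat where M: "\<gamma> - real m \<le> (real r - \<gamma> - real m) * real M"
    using reals_Archimedean3[OF pos, rule_format, of "\<gamma> - real m"] by (auto simp: mult.commute intro: less_imp_le)
  define L where "L = 1 + (4 * \<rho> + 2) * M"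
  \<comment> \<open>Cluster maps by last index are idempotent and fix the last index
    \<open>n - 1\<close>, which is therefore a representative where a zero can be
    prescribed.\<close>
  define Fn where "Fn = (\<lambda>n :: nat. {f \<in> {..<n} \<rightarrow>\<^sub>E {..<n}. (\<forall>k<n. f (f k) = f k) \<and> f (n - 1) = n - 1})"
  \<comment> \<open>The mark \<tau> is 1 if the first coordinate of the final trigger is prescribed
    to be 0, 2 if the second is, and 0 if neither is.\<close>
  define Za where "Za = (\<lambda>\<tau> n :: nat. if \<tau> = (1::nat) then {n - 1} else {} :: nat set)"
  define Zb where "Zb = (\<lambda>\<tau> n :: nat. if \<tau> = (2::nat) then {n - 1} else {} :: nat set)"
  define deg where "deg = (\<lambda>n (f :: nat \<Rightarrow> nat) (g :: nat \<Rightarrow> nat) \<tau>. card (f ` {..<n}) - card (Za \<tau> n) + (card (g ` {..<n}) - card (Zb \<tau> n)) :: nat)"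
  define A where "A = (\<lambda>n. real ((2 * (\<rho> * n) + 1) ^ (2 * n)) * 2 ^ (n * (4 * \<rho> + 2)))"
  define Idx where "Idx = (SIGMA n:{1..L}. Fn n \<times> Fn n \<times> {0, 1, 2::nat})"
  define C where "C = (\<Sum>(n, f, g, \<tau>)\<in>Idx. A n)"
  have finFn: "finite (Fn n)" for n
    unfolding Fn_def by (rule finite_subset[of _ "{..<n} \<rightarrow>\<^sub>E {..<n}"]) (auto intro!: finite_PiE)
  have finIdx: "finite Idx" unfolding Idx_def using finFn by (intro finite_SigmaI) auto
  have A0: "0 \<le> A n" for n unfolding A_def by simp
  have Fn_props: "\<And>k. k < n \<Longrightarrow> h k < n \<and> h (h k) = h k" "Za \<tau> n \<subseteq> h ` {..<n}" "Zb \<tau> n \<subseteq> h ` {..<n}"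
      "1 \<le> card (h ` {..<n})"
    if "h \<in> Fn n" "1 \<le> n" for h n \<tau>
  proof -
    show "\<And>k. k < n \<Longrightarrow> h k < n \<and> h (h k) = h k" using that unfolding Fn_def by (auto simp: PiE_iff)
    have mem: "n - 1 \<in> h ` {..<n}" using that unfolding Fn_def by (auto intro!: image_eqI[of _ _ "n - 1"])
    then show "Za \<tau> n \<subseteq> h ` {..<n}" "Zb \<tau> n \<subseteq> h ` {..<n}" unfolding Za_def Zb_def by auto
    have "h ` {..<n} \<noteq> {}" using mem by blast
    then show "1 \<le> card (h ` {..<n})" by (simp add: card_gt_0_iff Suc_le_eq)
  qed
  have main: "measure (initial_measure p) {\<omega>. (0, 0) \<in> bootstrap \<rho> r {x. \<omega> x} t} \<le> p + C * s"
    if p: "0 < p" "p < 1" and s: "(2 * real \<rho> * real t + 1) * p powr \<gamma> \<le> s" "s \<le> 1" for p t s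
  proof -
    interpret prob_space "initial_measure p" by (rule prob_space_initial_measure)
    define X where "X = (\<lambda>n f g \<tau>. tuples \<rho> (\<rho> * t) n f g (Za \<tau> n) (Zb \<tau> n))"
    define E where "E = (\<lambda>(n, f, g, \<tau>). {\<omega>. \<exists>F\<in>{F. \<exists>x\<in>X n f g \<tau>. F \<subseteq> (\<Union>k<n. cross \<rho> (x k)) \<and>
      \<gamma> * real (deg n f g \<tau>) \<le> real (card F)}. \<forall>y\<in>F. \<omega> y})"
    have b0: "0 \<le> (2 * real \<rho> * real t + 1) * p powr \<gamma>" by simp
    have Esets: "E i \<in> sets (initial_measure p)" and Eprob: "measure (initial_measure p) (E i) \<le> (case i of (n, f, g, \<tau>) \<Rightarrow> A n * s)"
      if i: "i \<in> Idx" for i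
    proof -
      obtain n f g \<tau> where i_eq: "i = (n, f, g, \<tau>)" by (cases i)
      have n: "1 \<le> n" and fg: "f \<in> Fn n" "g \<in> Fn n" and \<tau>: "\<tau> = 0 \<or> \<tau> = 1 \<or> \<tau> = 2"
        using i unfolding Idx_def i_eq by auto
      note f = Fn_props[OF fg(1) n] and g = Fn_props[OF fg(2) n]
      have finX: "finite (X n f g \<tau>)"
        and cardX: "card (X n f g \<tau>) \<le> (2 * (\<rho> * t) + 1) ^ deg n f g \<tau> * (2 * (\<rho> * n) + 1) ^ (2 * n)"
        unfolding X_def deg_def by (intro card_tuples_pair_le f(1) g(1) f(2) g(3); assumption)+
      show "E i \<in> sets (initial_measure p)"
        unfolding E_def i_eq prod.case by (rule prob_cross_witness_le(1)[OF finX p])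
      \<comment> \<open>Each direction has at least one cluster and at most one coordinate is
        prescribed, so some coordinate is free. As \<open>s \<le> 1\<close>, the power of
        \<open>s\<close> is then at most \<open>s\<close>.\<close>
      have d1: "1 \<le> deg n f g \<tau>"
        using \<tau> f(4) g(4) unfolding deg_def Za_def Zb_def by auto
      have "measure (initial_measure p) (E i)
          \<le> real (card (X n f g \<tau>)) * 2 ^ (n * (4 * \<rho> + 2)) * p powr (\<gamma> * real (deg n f g \<tau>))"
        unfolding E_def i_eq prod.case by (rule prob_cross_witness_le(2)[OF finX p])
      also have "\<dots> \<le> real ((2 * (\<rho> * t) + 1) ^ deg n f g \<tau> * (2 * (\<rho> * n) + 1) ^ (2 * n)) * 2 ^ (n * (4 * \<rho> + 2))
          * p powr (\<gamma> * real (deg n f g \<tau>))"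
        using cardX by (intro mult_right_mono of_nat_mono) auto
      also have "\<dots> = A n * (real ((2 * (\<rho> * t) + 1) ^ deg n f g \<tau>) * p powr (\<gamma> * real (deg n f g \<tau>)))"
        unfolding A_def by (simp only: of_nat_mult mult_ac)
      also have "real ((2 * (\<rho> * t) + 1) ^ deg n f g \<tau>) * p powr (\<gamma> * real (deg n f g \<tau>))
          = ((2 * real \<rho> * real t + 1) * p powr \<gamma>) ^ deg n f g \<tau>"
        using p by (simp add: power_mult_distrib powr_powr[symmetric] powr_realpow mult.assoc add.commute)
      also have "\<dots> \<le> s ^ deg n f g \<tau>" using s b0 by (intro power_mono)
      also have "\<dots> \<le> s ^ 1"
        using s(2) order_trans[OF b0 s(1)] d1 by (intro power_decreasing)
      finally show "measure (initial_measure p) (E i) \<le> (case i of (n, f, g, \<tau>) \<Rightarrow> A n * s)"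
        using A0[of n] unfolding i_eq prod.case power_one_right by (simp add: mult_left_mono)
    qed
    let ?E0 = "{\<omega> :: int \<times> int \<Rightarrow> bool. \<forall>y\<in>{(0, 0)}. \<omega> y}"
    have sub: "{\<omega>. (0, 0) \<in> bootstrap \<rho> r {x. \<omega> x} t} \<subseteq> ?E0 \<union> (\<Union>i\<in>Idx. E i)"
    proof (intro subsetI)
      fix \<omega> assume "\<omega> \<in> {\<omega>. (0, 0) \<in> bootstrap \<rho> r {x. \<omega> x} t}"
      then have "(0, 0) \<in> bootstrap \<rho> r {x. \<omega> x} t" by simp
      then show "\<omega> \<in> ?E0 \<union> (\<Union>i\<in>Idx. E i)"
      proof (rule occupied_origin_trigger_seq[OF r_pos])
        assume "(0, 0) \<in> {x. \<omega> x}"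
        then show ?thesis by simp
      next
        fix N x k assume x: "trigger_seq \<rho> r {x. \<omega> x} N x" "\<And>k. k < N \<Longrightarrow> in_box (\<rho> * t) (x k)"
          and k: "k < N" "fst (x k) = 0 \<or> snd (x k) = 0"
        obtain n e where ne: "Suc n \<le> 1 + (4 * \<rho> + 2) * M" "\<And>q. q \<le> n \<Longrightarrow> e q < N"
          "trigger_seq \<rho> r {x. \<omega> x} (Suc n) (x \<circ> e)" "terminal_seq \<rho> m M n (x \<circ> e)"
          by (rule terminal_subseq[OF x(1) k, of M m]) (rule that)
        define y where "y = x \<circ> e"
        have box: "in_box (\<rho> * t) (y q)" if "q < Suc n" for q
          using x(2)[OF ne(2)[of q]] that by (simp add: y_def)
        obtain f where f: "f \<in> {..<Suc n} \<rightarrow>\<^sub>E {..<Suc n}" "cluster_last \<rho> (fst \<circ> y) (Suc n) f"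
          using cluster_last_exists[of "Suc n" \<rho> "fst \<circ> y"] by blast
        obtain g where g: "g \<in> {..<Suc n} \<rightarrow>\<^sub>E {..<Suc n}" "cluster_last \<rho> (snd \<circ> y) (Suc n) g"
          using cluster_last_exists[of "Suc n" \<rho> "snd \<circ> y"] by blast
        have Fn: "h \<in> Fn (Suc n)" if "h \<in> {..<Suc n} \<rightarrow>\<^sub>E {..<Suc n}" "cluster_last \<rho> b (Suc n) h" for h b
        proof -
          have "h n = n" using cluster_lastD(1,2)[OF that(2), of n] by simp
          then show ?thesis using that(1) cluster_lastD(3)[OF that(2)] unfolding Fn_def by simp
        qed
        note Ff = Fn[OF f] and Fg = Fn[OF g]
        \<comment> \<open>If both coordinates vanish only the first is recorded, matching the loss
          of a single \<gamma> in \<open>terminal_exponent\<close>.\<close>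
        define \<tau> :: nat where "\<tau> = (if fst (y n) = 0 then 1 else if snd (y n) = 0 then 2 else 0)"
        have idx: "(Suc n, f, g, \<tau>) \<in> Idx"
          unfolding Idx_def L_def using ne(1) Ff Fg by (auto simp: \<tau>_def)
        obtain F where F: "F \<subseteq> {x. \<omega> x}" "F \<subseteq> (\<Union>k<Suc n. cross \<rho> (y k))"
          "r * Suc n \<le> card F + (\<Sum>k<Suc n. card (near_before \<rho> (fst \<circ> y) k)) + (\<Sum>k<Suc n. card (near_before \<rho> (snd \<circ> y) k))"
          using trigger_seq_witness[OF ne(3)] unfolding y_def by blast
        define R where "R = card (f ` {..<Suc n}) + card (g ` {..<Suc n})"
        have cF: "real (r * Suc n) - real (\<Sum>k<Suc n. card (near_before \<rho> (fst \<circ> y) k))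
            - real (\<Sum>k<Suc n. card (near_before \<rho> (snd \<circ> y) k)) \<le> real (card F)"
        proof -
          have "real (r * Suc n) \<le> real (card F + (\<Sum>k<Suc n. card (near_before \<rho> (fst \<circ> y) k)) + (\<Sum>k<Suc n. card (near_before \<rho> (snd \<circ> y) k)))"
            using F(3) by (rule of_nat_mono)
          then show ?thesis unfolding of_nat_add by linarith
        qed
        note ts = ne(4)[folded y_def]
        have card1: "1 \<le> card (f ` {..<Suc n})" "1 \<le> card (g ` {..<Suc n})"
          using Fn_props(4)[OF Ff] Fn_props(4)[OF Fg] by simp_all
        have "\<gamma> * real (deg (Suc n) f g \<tau>) \<le> real (card F)"
        proof (cases "\<tau> = 0")
          case True
          then have "fst (y n) \<noteq> 0" "snd (y n) \<noteq> 0" unfolding \<tau>_def by (auto split: if_splits)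
          from terminal_exponent(2)[OF f(2) g(2) ts M this]
          have "\<gamma> * real R \<le> real (card F)" using cF unfolding R_def by linarith
          moreover have "deg (Suc n) f g \<tau> = R" using True unfolding deg_def R_def Za_def Zb_def by simp
          ultimately show ?thesis by simp
        next
          case False
          from terminal_exponent(1)[OF f(2) g(2) ts M]
          have "\<gamma> * (real R - 1) \<le> real (card F)" using cF unfolding R_def by linarith
          moreover have "real (deg (Suc n) f g \<tau>) = real R - 1"
            using False card1 unfolding deg_def R_def Za_def Zb_def \<tau>_def by (auto split: if_splits)
          ultimately show ?thesis by simp
        qed
        moreover have "restrict y {..<Suc n} \<in> X (Suc n) f g \<tau>"
          unfolding X_def tuples_def
        proof (intro CollectI conjI)
          show "restrict y {..<Suc n} \<in> {..<Suc n} \<rightarrow>\<^sub>E {y. in_box (\<rho> * t) y}"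
            unfolding restrict_PiE_iff using box by simp
          show "\<forall>k<Suc n. \<bar>fst (restrict y {..<Suc n} k) - fst (restrict y {..<Suc n} (f k))\<bar> \<le> int (\<rho> * Suc n) \<and>
              \<bar>snd (restrict y {..<Suc n} k) - snd (restrict y {..<Suc n} (g k))\<bar> \<le> int (\<rho> * Suc n)"
          proof (intro allI impI)
            fix k assume k: "k < Suc n"
            have "restrict y {..<Suc n} k = y k" "restrict y {..<Suc n} (f k) = y (f k)"
              "restrict y {..<Suc n} (g k) = y (g k)"
              using k cluster_lastD(2)[OF f(2) k] cluster_lastD(2)[OF g(2) k] by simp_all
            then show "\<bar>fst (restrict y {..<Suc n} k) - fst (restrict y {..<Suc n} (f k))\<bar> \<le> int (\<rho> * Suc n) \<and>
              \<bar>snd (restrict y {..<Suc n} k) - snd (restrict y {..<Suc n} (g k))\<bar> \<le> int (\<rho> * Suc n)"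
              using cluster_lastD(4)[OF f(2) k] cluster_lastD(4)[OF g(2) k] by (simp only: comp_apply)
          qed
          show "\<forall>z\<in>Za \<tau> (Suc n). fst (restrict y {..<Suc n} z) = 0"
            "\<forall>z\<in>Zb \<tau> (Suc n). snd (restrict y {..<Suc n} z) = 0"
            unfolding Za_def Zb_def \<tau>_def by (auto split: if_splits)
        qed
        moreover have "F \<subseteq> (\<Union>k<Suc n. cross \<rho> (restrict y {..<Suc n} k))" using F(2) by simp
        ultimately have "\<omega> \<in> E (Suc n, f, g, \<tau>)"
          unfolding E_def prod.case using F(1) by blast
        then show ?thesis using idx by blast
      qed
    qed
    have E0sets: "?E0 \<in> sets (initial_measure p)"
      by (rule determined_by_sets[OF _ determined_by_all_occupied]) simp
    have UEsets: "(\<Union>i\<in>Idx. E i) \<in> sets (initial_measure p)"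
      using finIdx Esets by (intro sets.finite_UN) auto
    have "measure (initial_measure p) {\<omega>. (0, 0) \<in> bootstrap \<rho> r {x. \<omega> x} t}
        \<le> measure (initial_measure p) (?E0 \<union> (\<Union>i\<in>Idx. E i))"
      using sub E0sets UEsets by (intro finite_measure_mono) auto
    also have "\<dots> \<le> measure (initial_measure p) ?E0 + measure (initial_measure p) (\<Union>i\<in>Idx. E i)"
      using E0sets UEsets by (rule measure_Un_le)
    also have "measure (initial_measure p) ?E0 = p"
      using prob_all_occupied[of "{(0, 0)}" p] p by simp
    also have "measure (initial_measure p) (\<Union>i\<in>Idx. E i) \<le> (\<Sum>i\<in>Idx. measure (initial_measure p) (E i))"
      using finIdx Esets by (intro finite_measure_subadditive_finite) auto
    also have "\<dots> \<le> (\<Sum>i\<in>Idx. case i of (n, f, g, \<tau>) \<Rightarrow> A n * s)"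
      by (intro sum_mono Eprob)
    also have "\<dots> = C * s"
      unfolding C_def sum_distrib_right by (intro sum.cong) auto
    finally show ?thesis by simp
  qed
  have "0 \<le> C" unfolding C_def using A0 by (intro sum_nonneg) auto
  with main show ?thesis by blast
qed

end

section \<open>Orders of magnitude\<close>

text \<open>Replaces the limit of upper limits by nested eventual bounds, with which all later
  estimates work. Nonnegativity settles the lower side of the limit.\<close>

lemma Limsup_tendsto_0_iff:
  fixes P :: "real \<Rightarrow> real \<Rightarrow> real"
  assumes nonneg: "\<And>c p. 0 \<le> P c p"
  shows "((\<lambda>c. Limsup (at_right 0) (\<lambda>p. ereal (P c p))) \<longlongrightarrow> 0) F \<longleftrightarrow>
    (\<forall>\<epsilon>>0. \<forall>\<^sub>F c in F. \<forall>\<^sub>F p in at_right 0. P c p < \<epsilon>)" (is "?L \<longleftrightarrow> ?R")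
proof
  assume L: ?L
  show ?R
  proof (intro allI impI)
    fix \<epsilon> :: real assume "\<epsilon> > 0"
    then have "\<forall>\<^sub>F c in F. Limsup (at_right 0) (\<lambda>p. ereal (P c p)) < ereal \<epsilon>"
      by (intro order_tendstoD(2)[OF L]) simp
    then show "\<forall>\<^sub>F c in F. \<forall>\<^sub>F p in at_right 0. P c p < \<epsilon>"
      by eventually_elim (auto dest: Limsup_lessD)
  qed
next
  assume R: ?R
  show ?L
  proof (rule order_tendstoI)
    fix a :: ereal assume a: "a < 0"
    have "0 \<le> Limsup (at_right 0) (\<lambda>p. ereal (P c p))" for c
      using nonneg by (intro le_Limsup) (auto simp: trivial_limit_at_right_real)
    then show "\<forall>\<^sub>F c in F. a < Limsup (at_right 0) (\<lambda>p. ereal (P c p))"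
      using a by (intro always_eventually allI) (rule less_le_trans)
  next
    fix a :: ereal assume "0 < a"
    then obtain e where e: "0 < ereal e" "ereal e < a" using ereal_dense2 by blast
    then have "0 < e" by simp
    with R have "\<forall>\<^sub>F c in F. \<forall>\<^sub>F p in at_right 0. P c p < e" by blast
    then show "\<forall>\<^sub>F c in F. Limsup (at_right 0) (\<lambda>p. ereal (P c p)) < a"
    proof eventually_elim
      case (elim c)
      then have "Limsup (at_right 0) (\<lambda>p. ereal (P c p)) \<le> ereal e"
        by (intro Limsup_bounded) (auto elim: eventually_mono)
      then show ?case using e(2) by (rule le_less_trans)
    qed
  qed
qed

lemma prob_lesssim_iff:
  "prob_lesssim M X a \<longleftrightarrow> (\<forall>\<epsilon>>0. \<forall>\<^sub>F c in at_top. \<forall>\<^sub>F p in at_right 0.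
     \<P>(\<omega> in M p. X p \<omega> \<ge> ennreal (c * a p)) < \<epsilon>)"
  unfolding prob_lesssim_def by (rule Limsup_tendsto_0_iff) simp

lemma prob_gtrsim_iff:
  "prob_gtrsim M X a \<longleftrightarrow> (\<forall>\<epsilon>>0. \<forall>\<^sub>F c in at_right 0. \<forall>\<^sub>F p in at_right 0.
     \<P>(\<omega> in M p. X p \<omega> \<le> ennreal (c * a p)) < \<epsilon>)"
  unfolding prob_gtrsim_def by (rule Limsup_tendsto_0_iff) simp

lemma prob_lesssim_mono:
  assumes M: "\<And>p. prob_space (M p)" and X: "\<And>p. X p \<in> borel_measurable (M p)"
    and le: "\<forall>\<^sub>F p in at_right 0. a p \<le> b p" and a: "prob_lesssim M X a"
  shows "prob_lesssim M X b"
  unfolding prob_lesssim_iff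
proof (intro allI impI)
  fix \<epsilon> :: real assume "\<epsilon> > 0"
  with a have "\<forall>\<^sub>F c in at_top. \<forall>\<^sub>F p in at_right 0. \<P>(\<omega> in M p. X p \<omega> \<ge> ennreal (c * a p)) < \<epsilon>"
    unfolding prob_lesssim_iff by blast
  then show "\<forall>\<^sub>F c in at_top. \<forall>\<^sub>F p in at_right 0. \<P>(\<omega> in M p. X p \<omega> \<ge> ennreal (c * b p)) < \<epsilon>"
    using eventually_ge_at_top[of 0]
  proof eventually_elim
    case (elim c)
    from elim(1) le show ?case
    proof eventually_elim
      case (elim p)
      interpret prob_space "M p" by (rule M)
      note X[measurable]
      have "ennreal (c * a p) \<le> ennreal (c * b p)"
        using elim \<open>0 \<le> c\<close> by (intro ennreal_leI mult_left_mono)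
      then have "\<P>(\<omega> in M p. X p \<omega> \<ge> ennreal (c * b p)) \<le> \<P>(\<omega> in M p. X p \<omega> \<ge> ennreal (c * a p))"
        by (intro finite_measure_mono) (auto intro: order_trans)
      then show ?case using elim(1) by simp
    qed
  qed
qed

lemma prob_gtrsim_mono:
  assumes M: "\<And>p. prob_space (M p)" and X: "\<And>p. X p \<in> borel_measurable (M p)"
    and le: "\<forall>\<^sub>F p in at_right 0. b p \<le> a p" and a: "prob_gtrsim M X a"
  shows "prob_gtrsim M X b"
  unfolding prob_gtrsim_iff
proof (intro allI impI)
  fix \<epsilon> :: real assume "\<epsilon> > 0"
  with a have "\<forall>\<^sub>F c in at_right 0. \<forall>\<^sub>F p in at_right 0. \<P>(\<omega> in M p. X p \<omega> \<le> ennreal (c * a p)) < \<epsilon>"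
    unfolding prob_gtrsim_iff by blast
  then show "\<forall>\<^sub>F c in at_right 0. \<forall>\<^sub>F p in at_right 0. \<P>(\<omega> in M p. X p \<omega> \<le> ennreal (c * b p)) < \<epsilon>"
    using eventually_at_right_less[of 0]
  proof eventually_elim
    case (elim c)
    from elim(1) le show ?case
    proof eventually_elim
      case (elim p)
      interpret prob_space "M p" by (rule M)
      note X[measurable]
      have "ennreal (c * b p) \<le> ennreal (c * a p)"
        using elim \<open>0 < c\<close> by (intro ennreal_leI mult_left_mono) auto
      then have "\<P>(\<omega> in M p. X p \<omega> \<le> ennreal (c * b p)) \<le> \<P>(\<omega> in M p. X p \<omega> \<le> ennreal (c * a p))"
        by (intro finite_measure_mono) (auto intro: order_trans)
      then show ?case using elim(1) by simp
    qed
  qed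
qed

text \<open>If \<beta> were smaller than \<alpha>, then for small \<open>p\<close> the threshold
  \<open>d * p powr - \<beta>\<close> would lie below \<open>c * p powr - \<alpha>\<close>. The two
  events would then cover the whole space, although each has probability less than one half.\<close>

lemma prob_gtrsim_lesssim_powr_le:
  assumes M: "\<And>p. prob_space (M p)" and X: "\<And>p. X p \<in> borel_measurable (M p)"
    and lower: "prob_gtrsim M X (\<lambda>p. p powr - \<alpha>)" and upper: "prob_lesssim M X (\<lambda>p. p powr - \<beta>)"
  shows "\<alpha> \<le> \<beta>"
proof (rule ccontr)
  assume "\<not> \<alpha> \<le> \<beta>"
  then have less: "\<beta> < \<alpha>" by simp
  have "\<forall>\<^sub>F c in at_right 0. \<forall>\<^sub>F p in at_right 0. \<P>(\<omega> in M p. X p \<omega> \<le> ennreal (c * p powr - \<alpha>)) < 1 / 2"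
    by (rule lower[unfolded prob_gtrsim_iff, rule_format]) simp
  from eventually_happens[OF eventually_conj[OF this eventually_at_right_less]]
  obtain c where c: "0 < c" "\<forall>\<^sub>F p in at_right 0. \<P>(\<omega> in M p. X p \<omega> \<le> ennreal (c * p powr - \<alpha>)) < 1 / 2"
    by (auto simp: trivial_limit_at_right_real)
  have "\<forall>\<^sub>F d in at_top. \<forall>\<^sub>F p in at_right 0. \<P>(\<omega> in M p. X p \<omega> \<ge> ennreal (d * p powr - \<beta>)) < 1 / 2"
    by (rule upper[unfolded prob_lesssim_iff, rule_format]) simp
  from eventually_happens[OF eventually_conj[OF this eventually_gt_at_top[of 0]]]
  obtain d where d: "0 < d" "\<forall>\<^sub>F p in at_right 0. \<P>(\<omega> in M p. X p \<omega> \<ge> ennreal (d * p powr - \<beta>)) < 1 / 2"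
    by auto
  have "((\<lambda>p. d * p powr (\<alpha> - \<beta>)) \<longlongrightarrow> 0) (at_right 0)"
    using less by real_asymp
  then have "\<forall>\<^sub>F p in at_right 0. d * p powr (\<alpha> - \<beta>) < c"
    by (rule order_tendstoD) (rule c(1))
  with c(2) d(2) eventually_at_right_less[of 0] have "\<forall>\<^sub>F p :: real in at_right 0. False"
  proof eventually_elim
    case (elim p)
    interpret prob_space "M p" by (rule M)
    note X[measurable]
    have "d * p powr - \<beta> = d * p powr (\<alpha> - \<beta>) * p powr - \<alpha>"
      using elim by (simp add: powr_add[symmetric])
    also have "\<dots> \<le> c * p powr - \<alpha>" using elim by (intro mult_right_mono) auto
    finally have le: "ennreal (d * p powr - \<beta>) \<le> ennreal (c * p powr - \<alpha>)" by (rule ennreal_leI)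
    have "1 = prob (space (M p))" by (simp add: prob_space)
    also have "space (M p) = {\<omega>\<in>space (M p). X p \<omega> \<le> ennreal (c * p powr - \<alpha>)} \<union>
        {\<omega>\<in>space (M p). X p \<omega> \<ge> ennreal (d * p powr - \<beta>)}"
      using le by (auto simp: not_le dest: less_imp_le intro: order_trans)
    also have "prob \<dots> \<le> \<P>(\<omega> in M p. X p \<omega> \<le> ennreal (c * p powr - \<alpha>)) + \<P>(\<omega> in M p. X p \<omega> \<ge> ennreal (d * p powr - \<beta>))"
      by (intro measure_Un_le) auto
    finally show False using elim by simp
  qed
  then show False by (simp add: trivial_limit_at_right_real)
qed

section \<open>Existence, uniqueness and purity of the critical power\<close>

context critical_exponent
begin

lemma hitting_time_lesssim:
  "prob_lesssim initial_measure (\<lambda>p. hitting_time \<rho> (bootstrap_zero_set r)) (\<lambda>p. p powr - \<gamma>)"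
  unfolding prob_lesssim_iff
proof (intro allI impI)
  fix \<epsilon> :: real assume \<epsilon>: "\<epsilon> > 0"
  obtain k where k: "k > 0" "\<And>L. L \<ge> 1 \<Longrightarrow> \<forall>\<^sub>F p in at_right 0.
     measure (initial_measure p) {\<omega>. ennreal (L * p powr - \<gamma>) \<le> hitting_time \<rho> (bootstrap_zero_set r) \<omega>} \<le> exp (- k * L)"
    using prob_hitting_time_ge_le by blast
  have "((\<lambda>L. exp (- k * L)) \<longlongrightarrow> 0) at_top" using k(1) by real_asymp
  then have "\<forall>\<^sub>F L in at_top. exp (- k * L) < \<epsilon>" by (rule order_tendstoD) (rule \<epsilon>)
  with eventually_ge_at_top[of 1]
  show "\<forall>\<^sub>F c in at_top. \<forall>\<^sub>F p in at_right 0.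
    \<P>(\<omega> in initial_measure p. ennreal (c * p powr - \<gamma>) \<le> hitting_time \<rho> (bootstrap_zero_set r) \<omega>) < \<epsilon>"
  proof eventually_elim
    case (elim L)
    from k(2)[OF elim(1)] show ?case
      by eventually_elim (use elim(2) in simp)
  qed
qed

lemma hitting_time_gtrsim:
  "prob_gtrsim initial_measure (\<lambda>p. hitting_time \<rho> (bootstrap_zero_set r)) (\<lambda>p. p powr - \<gamma>)"
  unfolding prob_gtrsim_iff
proof (intro allI impI)
  fix \<epsilon> :: real assume \<epsilon>: "\<epsilon> > 0"
  obtain C where C: "C \<ge> 0" "\<And>p t s. 0 < p \<Longrightarrow> p < 1 \<Longrightarrow> (2 * real \<rho> * real t + 1) * p powr \<gamma> \<le> s \<Longrightarrow> s \<le> 1 \<Longrightarrow>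
     measure (initial_measure p) {\<omega>. (0, 0) \<in> bootstrap \<rho> r {x. \<omega> x} t} \<le> p + C * s"
    using prob_origin_occupied_le by blast
  \<comment> \<open>The union bound is used with \<open>s = (2 * \<rho> + 1) * c\<close>, which has
    to be at most 1.\<close>
  have ev1: "\<forall>\<^sub>F c in at_right 0. (2 * real \<rho> + 1) * c < 1"
  proof (rule order_tendstoD)
    show "((\<lambda>c. (2 * real \<rho> + 1) * c) \<longlongrightarrow> 0) (at_right 0)"
      by (auto intro!: tendsto_eq_intros)
  qed simp
  have ev2: "\<forall>\<^sub>F c in at_right 0. c + C * ((2 * real \<rho> + 1) * c) < \<epsilon>"
  proof (rule order_tendstoD)
    show "((\<lambda>c. c + C * ((2 * real \<rho> + 1) * c)) \<longlongrightarrow> 0) (at_right 0)"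
      by (auto intro!: tendsto_eq_intros)
  qed (rule \<epsilon>)
  show "\<forall>\<^sub>F c in at_right 0. \<forall>\<^sub>F p in at_right 0.
    \<P>(\<omega> in initial_measure p. hitting_time \<rho> (bootstrap_zero_set r) \<omega> \<le> ennreal (c * p powr - \<gamma>)) < \<epsilon>"
    using ev1 ev2 eventually_at_right_less[of 0]
  proof eventually_elim
    case (elim c)
    have "((\<lambda>p. p powr \<gamma>) \<longlongrightarrow> 0) (at_right 0)" using \<gamma>_pos by real_asymp
    then have e1: "\<forall>\<^sub>F p in at_right 0. p powr \<gamma> < c" by (rule order_tendstoD) (rule elim(3))
    have e2: "\<forall>\<^sub>F p in at_right 0. p < min c 1"
      using elim(3) by (intro order_tendstoD[OF tendsto_ident_at]) simp
    from e1 e2 eventually_at_right_less[of 0] show ?case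
    proof eventually_elim
      case (elim p)
      then have p: "0 < p" "p < 1" "p < c" by auto
      interpret prob_space "initial_measure p" by (rule prob_space_initial_measure)
      define t where "t = nat \<lfloor>c * p powr - \<gamma>\<rfloor>"
      have "real t \<le> c * p powr - \<gamma>"
        unfolding t_def using \<open>0 < c\<close> by (intro of_nat_floor) simp
      then have "real t * p powr \<gamma> \<le> c * p powr - \<gamma> * p powr \<gamma>"
        by (intro mult_right_mono) auto
      also have "\<dots> = c" using p by (simp add: powr_minus)
      finally have tp: "2 * real \<rho> * (real t * p powr \<gamma>) \<le> 2 * real \<rho> * c" by (intro mult_left_mono) auto
      \<comment> \<open>Both \<open>t * p powr \<gamma>\<close> and, for small \<open>p\<close>,
        \<open>p powr \<gamma>\<close> are at most \<open>c\<close>.\<close>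
      have "(2 * real \<rho> * real t + 1) * p powr \<gamma> = 2 * real \<rho> * (real t * p powr \<gamma>) + p powr \<gamma>"
        by (simp add: algebra_simps)
      also have "\<dots> \<le> (2 * real \<rho> + 1) * c" using tp elim(1) by (simp add: algebra_simps)
      finally have "measure (initial_measure p) {\<omega>. (0, 0) \<in> bootstrap \<rho> r {x. \<omega> x} t} \<le> p + C * ((2 * real \<rho> + 1) * c)"
        using \<open>(2 * real \<rho> + 1) * c < 1\<close> p by (intro C(2)) auto
      moreover have "measure (initial_measure p) {\<omega>\<in>space (initial_measure p). hitting_time \<rho> (bootstrap_zero_set r) \<omega> \<le> ennreal (c * p powr - \<gamma>)}
          \<le> measure (initial_measure p) {\<omega>. (0, 0) \<in> bootstrap \<rho> r {x. \<omega> x} t}"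
      proof (rule finite_measure_mono)
        have "{\<omega>\<in>space (initial_measure p). (0, 0) \<in> bootstrap \<rho> r {x. \<omega> x} t} \<in> sets (initial_measure p)"
          using measurable_occupied by measurable
        then show "{\<omega>. (0, 0) \<in> bootstrap \<rho> r {x. \<omega> x} t} \<in> sets (initial_measure p)" by simp
      qed (use hitting_time_leD in \<open>auto simp: t_def\<close>)
      ultimately show ?case using p \<open>c + C * ((2 * real \<rho> + 1) * c) < \<epsilon>\<close> by linarith
    qed
  qed
qed

text \<open>The sharp bounds at \<gamma> imply both power conditions by monotonicity. Conversely,
  comparing them with the conditions for another critical power and letting the error tend to 0
  forces equality.\<close>

lemma is_critical_power_iff: "is_critical_power \<rho> (bootstrap_zero_set r) \<gamma>' \<longleftrightarrow> \<gamma>' = \<gamma>"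
proof
  note mono = prob_space_initial_measure measurable_hitting_time
  assume crit: "is_critical_power \<rho> (bootstrap_zero_set r) \<gamma>'"
  have "\<gamma> \<le> \<gamma>'"
  proof (rule field_le_epsilon)
    fix e :: real assume "0 < e"
    then have "prob_lesssim initial_measure (\<lambda>p. hitting_time \<rho> (bootstrap_zero_set r)) (\<lambda>p. p powr - (\<gamma>' + e))"
      using crit unfolding is_critical_power_def upper_power_def by blast
    then show "\<gamma> \<le> \<gamma>' + e"
      by (rule prob_gtrsim_lesssim_powr_le[OF mono hitting_time_gtrsim])
  qed
  moreover have "\<gamma>' \<le> \<gamma>"
  proof (rule field_le_epsilon)
    fix e :: real assume "0 < e"
    then have "prob_gtrsim initial_measure (\<lambda>p. hitting_time \<rho> (bootstrap_zero_set r)) (\<lambda>p. p powr - (\<gamma>' - e))"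
      using crit unfolding is_critical_power_def lower_power_def by blast
    from prob_gtrsim_lesssim_powr_le[OF mono this hitting_time_lesssim]
    show "\<gamma>' \<le> \<gamma> + e" by simp
  qed
  ultimately show "\<gamma>' = \<gamma>" by simp
next
  note mono = prob_space_initial_measure measurable_hitting_time
  have le: "\<forall>\<^sub>F p in at_right 0. p powr - a \<le> p powr - b" if "a \<le> b" for a b :: real
  proof -
    have "\<forall>\<^sub>F p :: real in at_right 0. 0 < p \<and> p < 1"
      by (auto simp: eventually_at_right[of 0 1] intro!: exI[of _ 1])
    then show ?thesis by eventually_elim (use that in \<open>auto intro!: powr_mono'\<close>)
  qed
  assume "\<gamma>' = \<gamma>"
  moreover have "prob_lesssim initial_measure (\<lambda>p. hitting_time \<rho> (bootstrap_zero_set r)) (\<lambda>p. p powr - (\<gamma> + e))"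
    if "e > 0" for e
    by (rule prob_lesssim_mono[OF mono _ hitting_time_lesssim]) (use that in \<open>intro le; simp\<close>)
  moreover have "prob_gtrsim initial_measure (\<lambda>p. hitting_time \<rho> (bootstrap_zero_set r)) (\<lambda>p. p powr - (\<gamma> - e))"
    if "e > 0" for e
    by (rule prob_gtrsim_mono[OF mono _ hitting_time_gtrsim]) (use that in \<open>intro le; simp\<close>)
  ultimately show "is_critical_power \<rho> (bootstrap_zero_set r) \<gamma>'"
    unfolding is_critical_power_def lower_power_def upper_power_def using \<gamma>_pos by blast
qed

lemma critical_power_eq: "critical_power \<rho> (bootstrap_zero_set r) = \<gamma>"
  unfolding critical_power_def is_critical_power_iff by simp

end

text \<open>With \<open>s = sqrt (9 + 8 * r)\<close> the ceiling means \<open>2 * k + 3 < s\<close>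
  and \<open>s \<le> 2 * k + 5\<close>. Squaring gives the claim, as the squares of
  \<open>2 * k + 3\<close> and \<open>2 * k + 5\<close> exceed 9 by \<open>4 * k * (k + 3)\<close>
  and \<open>4 * (k + 1) * (k + 4)\<close>.\<close>

lemma critical_rank_bounds:
  fixes r :: nat and m :: int
  assumes "r \<ge> 1" and m: "m = \<lceil>(sqrt (9 + 8 * real r) - 5) / 2\<rceil>"
  obtains k :: nat where "m = int k" "k * (k + 3) < 2 * r" "2 * r \<le> (k + 1) * (k + 4)"
proof -
  define s where "s = sqrt (9 + 8 * real r)"
  have s2: "s * s = 9 + 8 * real r" unfolding s_def by simp
  have s3: "3 < s" unfolding s_def using assms(1) by (intro real_less_rsqrt) simp
  have up: "(s - 5) / 2 \<le> real_of_int m" unfolding m s_def by (rule le_of_int_ceiling)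
  have lo: "real_of_int m < (s - 5) / 2 + 1" unfolding m s_def
    using ceiling_correct[of "(sqrt (9 + 8 * real r) - 5) / 2"] by linarith
  \<comment> \<open>Since \<open>r \<ge> 1\<close> gives \<open>s > 3\<close>, the ceiling is
    nonnegative and hence a natural number.\<close>
  have "- 1 < real_of_int m" using up s3 by simp
  then have "0 \<le> m" by linarith
  then obtain k where k: "m = int k" by (rule nonneg_int_cases)
  have "s \<le> 2 * real k + 5" "2 * real k + 3 < s" using up lo unfolding k by (simp_all add: field_simps)
  then have "s * s \<le> (2 * real k + 5) * (2 * real k + 5)" "(2 * real k + 3) * (2 * real k + 3) < s * s"
    using s3 by (auto intro!: mult_mono mult_strict_mono)
  then have "real (2 * r) \<le> real ((k + 1) * (k + 4))" "real (k * (k + 3)) < real (2 * r)"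
    unfolding s2 by (simp_all add: algebra_simps)
  then show thesis using that[OF k] unfolding of_nat_le_iff of_nat_less_iff by blast
qed

theorem theorem1p1:
  fixes r \<rho> :: nat and m :: int
  assumes "r \<ge> 1" and "\<rho> \<ge> r"
    and "m = \<lceil>(sqrt (9 + 8 * real r) - 5) / 2\<rceil>"
  shows "(\<exists>!\<gamma>. is_critical_power \<rho> (bootstrap_zero_set r) \<gamma>) \<and>
         pure_critical_power \<rho> (bootstrap_zero_set r) \<and>
         critical_power \<rho> (bootstrap_zero_set r) =
           (real_of_int m + 1) * (2 * real r - real_of_int m) / (2 * (real_of_int m + 2))"
proof -
  obtain k where k: "m = int k" "k * (k + 3) < 2 * r" "2 * r \<le> (k + 1) * (k + 4)"
    using assms(1,3) by (rule critical_rank_bounds)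
  define \<gamma> where "\<gamma> = (real k + 1) * (2 * real r - real k) / (2 * (real k + 2))"
  interpret critical_exponent r \<rho> k \<gamma>
    using assms(1,2) k(2,3) by unfold_locales (simp_all add: \<gamma>_def)
  have "pure_critical_power \<rho> (bootstrap_zero_set r)"
    unfolding pure_critical_power_def prob_asymp_def critical_power_eq
    using hitting_time_lesssim hitting_time_gtrsim by blast
  then show ?thesis
    unfolding is_critical_power_iff critical_power_eq k(1) by (simp add: \<gamma>_def)
qed

end
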